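(* Let $n\ge2$, $x_0>0$, $K\ge0$ and $0\le K_2\le K$, and consider the contest with regret over future failure to stop described in the context, in which $M^i=\sup_{\tau^i\le t\le H_0^i}X^i_t$. Let $N=n+K(n-1)$ and, for $x\ge0$, $$F(x)=\min\Big\{\Big(\frac{x}{Nx_0}\Big)^{1/(N-1)},\,1\Big\}.$$ Then there exists a symmetric, atom-free Nash equilibrium in which, for every player $i$, $X^i_{\tau^i}$ has law $F$: that is, if every player $j\neq i$ uses a stopping time $\tau^j$ with $X^j_{\tau^j}\sim F$, then any admissible stopping time $\tau^i$ with $X^i_{\tau^i}\sim F$ maximizes player $i$'s expected payoff over all admissible stopping times of player $i$.
   Context: There are $n$ players $i\in\{1,\dots,n\}$. Player $i$ privately observes a Brownian motion $X^i$ with $X^i_0=x_0>0$, absorbed at $0$; the processes $X^1,\dots,X^n$ are independent. Let $\mathcal{F}^i_t=\sigma(X^i_s:s<t)$ and $H^i_0=\inf\{t\ge0:X^i_t=0\}$. An admissible strategy of player $i$ is an $(\mathcal{F}^i_t)$-stopping time $\tau^i\le H^i_0$. Players do not observe the other processes or stopping times. Given a random variable $M^i\ge X^i_{\tau^i}$ (here $M^i=\sup_{\tau^i\le t\le H^i_0}X^i_t$), player $i$'s payoff is $$\frac1k\mathbf 1_{\{X^i_{\tau^i}=\max_{j}X^j_{\tau^j}\}}-K\,\mathbf 1_{\{X^i_{\tau^i}<\max_{j\ne i}X^j_{\tau^j}<M^i\}}-K_2\,\mathbf 1_{\{X^i_{\tau^i}<\max_{j\ne i}X^j_{\tau^j}=M^i\}},$$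 where $k=|\{l:X^l_{\tau^l}=\max_jX^j_{\tau^j}\}|$. Each player maximizes her expected payoff. A Nash equilibrium is symmetric if all players' stopped values have the same law, and atom-free if that law has no atoms. *)

theory Defs
  imports "HOL-Probability.Probability"
begin

definition is_BM :: "'a measure \<Rightarrow> real \<Rightarrow> (real \<Rightarrow> 'a \<Rightarrow> real) \<Rightarrow> bool" where
  "is_BM M x0 W \<longleftrightarrow>
     (\<forall>t. W t \<in> borel_measurable M) \<and>
     (\<forall>\<omega>\<in>space M. W 0 \<omega> = x0 \<and> continuous_on {0..} (\<lambda>t. W t \<omega>)) \<and>
     (\<forall>s t. 0 \<le> s \<and> s < t \<longrightarrow>
        distributed M lborel (\<lambda>\<omega>. W t \<omega> - W s \<omega>) (normal_density 0 (sqrt (t - s)))) \<and>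
     (\<forall>ts::real list. sorted_wrt (<) ts \<and> (\<forall>t\<in>set ts. 0 \<le> t) \<longrightarrow>
        prob_space.indep_vars M (\<lambda>_. borel) (\<lambda>k \<omega>. W (ts ! Suc k) \<omega> - W (ts ! k) \<omega>)
          {..<length ts - 1})"

definition hit0 :: "(real \<Rightarrow> 'a \<Rightarrow> real) \<Rightarrow> 'a \<Rightarrow> ereal" where
  "hit0 W \<omega> = Inf {ereal t | t. 0 \<le> t \<and> W t \<omega> = 0}"

definition absorbed :: "(real \<Rightarrow> 'a \<Rightarrow> real) \<Rightarrow> real \<Rightarrow> 'a \<Rightarrow> real" where
  "absorbed W t \<omega> = (if ereal t < hit0 W \<omega> then W t \<omega> else 0)"

definition nat_filt :: "'a measure \<Rightarrow> (real \<Rightarrow> 'a \<Rightarrow> real) \<Rightarrow> ereal \<Rightarrow> 'a measure" where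
  "nat_filt M X t = sigma (space M)
     (\<Union>s\<in>{s. 0 \<le> s \<and> ereal s < t}. {X s -` A \<inter> space M | A. A \<in> sets borel})"

definition admissible :: "'a measure \<Rightarrow> (real \<Rightarrow> 'a \<Rightarrow> real) \<Rightarrow> ('a \<Rightarrow> ereal) \<Rightarrow> bool" where
  "admissible M X \<tau> \<longleftrightarrow> stopping_time (nat_filt M X) \<tau> \<and>
     (\<forall>\<omega>\<in>space M. 0 \<le> \<tau> \<omega> \<and> \<tau> \<omega> \<le> hit0 X \<omega>)"

text \<open>Stopped value X_tau (the value at tau = \<infinity> is irrelevant: a null event).\<close>
definition stopval :: "(real \<Rightarrow> 'a \<Rightarrow> real) \<Rightarrow> ('a \<Rightarrow> ereal) \<Rightarrow> 'a \<Rightarrow> real" where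
  "stopval X \<tau> \<omega> = X (real_of_ereal (\<tau> \<omega>)) \<omega>"

definition supafter :: "(real \<Rightarrow> 'a \<Rightarrow> real) \<Rightarrow> ('a \<Rightarrow> ereal) \<Rightarrow> 'a \<Rightarrow> real" where
  "supafter X \<tau> \<omega> = Sup {X t \<omega> | t. 0 \<le> t \<and> \<tau> \<omega> \<le> ereal t \<and> ereal t \<le> hit0 X \<omega>}"

definition payoff :: "nat \<Rightarrow> real \<Rightarrow> real \<Rightarrow> (nat \<Rightarrow> real) \<Rightarrow> real \<Rightarrow> nat \<Rightarrow> real" where
  "payoff n K K2 Y Mi i =
     (let mx = Max (Y ` {..<n});
          k = card {l\<in>{..<n}. Y l = mx};
          mo = Max (Y ` ({..<n} - {i}))
      in (if Y i = mx then 1 / real k else 0)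
         - (if Y i < mo \<and> mo < Mi then K else 0)
         - (if Y i < mo \<and> mo = Mi then K2 else 0))"

definition expected_payoff ::
  "'a measure \<Rightarrow> nat \<Rightarrow> real \<Rightarrow> real \<Rightarrow> (nat \<Rightarrow> real \<Rightarrow> 'a \<Rightarrow> real) \<Rightarrow> (nat \<Rightarrow> 'a \<Rightarrow> ereal) \<Rightarrow> nat \<Rightarrow> real" where
  "expected_payoff M n K K2 X \<tau> i =
     (\<integral>\<omega>. payoff n K K2 (\<lambda>j. stopval (X j) (\<tau> j) \<omega>) (supafter (X i) (\<tau> i) \<omega>) i \<partial>M)"

definition has_law :: "'a measure \<Rightarrow> ('a \<Rightarrow> real) \<Rightarrow> (real \<Rightarrow> real) \<Rightarrow> bool" where
  "has_law M Y F \<longleftrightarrow> Y \<in> borel_measurable M \<and> (\<forall>x. measure M {\<omega>\<in>space M. Y \<omega> \<le> x} = F x)"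

end

theory Submission
  imports Defs "HOL-Real_Asymp.Real_Asymp"
begin

text \<open>
  Put \<open>B = N x0\<close>, and let \<open>Z\<close> be the best stopped value of the other players; its distribution
  function is \<open>G(z) = (z/B)^(1/(1+K))\<close> on \<open>[0,B]\<close>. If a player stops at \<open>Y = X_\<tau>\<close>, optional stopping at
  the first exit from \<open>(0,m)\<close> after \<open>\<tau>\<close> gives \<open>m P(Y < m \<le> M) = E[Y; Y < m]\<close> for the subsequent
  maximum \<open>M\<close>. Integrating this over \<open>m\<close> against the law of \<open>Z\<close>, the expected payoff
  \<open>P(Z \<le> Y) - K P(Y < Z \<le> M)\<close> collapses to \<open>E[min(Y/B, 1)]\<close>. Since \<open>X\<close> is a nonnegative
  supermartingale, this is at most \<open>x0/B = 1/N\<close>, and it equals \<open>1/N\<close> when \<open>Y\<close> has law \<open>F\<close>, because \<open>F\<close>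
  lives on \<open>[0,B]\<close> and has mean \<open>x0\<close>.

  The law \<open>F\<close> is embedded by stopping as soon as \<open>X\<close> reaches \<open>N\<close> times its running minimum. Optional
  stopping at the minimum of this time and the first passage below \<open>y\<close> yields difference inequalities
  for \<open>p(y) = P(X_\<tau> \<le> N y)\<close> that force \<open>p(y) = (y/x0)^(1/(N-1))\<close>.
\<close>

section \<open>First passage times of continuous paths\<close>

text \<open>The constants are forced. Against a best opponent with distribution function G, stopping
  at y yields G(y) - K y times the integral of dG(z)/z over z > y. This is affine in y exactly when
  (1 + K) y G'' + K G' = 0, whose solutions vanishing at 0 are the multiples of y^(1/(1+K)). Since N
  - 1 = (n - 1)(1 + K), G is the (n-1)st power of F, and the endpoint N x0 gives F the mean x0. In
  the embedding, while the minimum falls from y to y - dy the path climbs to N y with probability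
  about dy/((N - 1) y), the logarithmic increment of y^(1/(N-1)).

  Two obstacles shape the proof. The filtration is generated by the absorbed process strictly before
  t and is not completed, so null sets cannot be discarded: every stopping time constructed is the
  first time of a condition closed in time, and compactness reduces its events to countably many
  times. And X is not uniformly integrable (it ends at 0), so optional stopping over an unbounded
  horizon is used only for differences bounded by a constant.\<close>

text \<open>A continuous function attains its infimum on \<open>C\<close>, and this infimum is the
  same over a dense subset. In the applications \<open>D\<close> is countable, so an existential
  statement over a continuum of times becomes a countable combination of measurable events.\<close>

lemma compact_ex_le_zero_iff:
  fixes f :: "'a::metric_space \<Rightarrow> real"
  assumes "compact C" "continuous_on C f" "D \<subseteq> C" "C \<subseteq> closure D"
  shows "(\<exists>x\<in>C. f x \<le> 0) \<longleftrightarrow> (\<forall>n::nat. \<exists>x\<in>D. f x < 1 / Suc n)"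
proof
  assume "\<exists>x\<in>C. f x \<le> 0"
  then obtain x where x: "x \<in> C" "f x \<le> 0" by auto
  show "\<forall>n::nat. \<exists>x\<in>D. f x < 1 / Suc n"
  proof
    fix n :: nat
    have "0 < 1 / real (Suc n)" by simp
    then obtain d where d: "d > 0" "\<And>y. y \<in> C \<Longrightarrow> dist y x < d \<Longrightarrow> dist (f y) (f x) < 1 / Suc n"
      using assms(2) x(1) unfolding continuous_on_iff by blast
    obtain y where y: "y \<in> D" "dist y x < d"
      using assms(4) x(1) d(1) by (meson closure_approachable subsetD)
    then have "dist (f y) (f x) < 1 / Suc n" using d(2) assms(3) by auto
    then have "f y < 1 / Suc n" using x(2) unfolding dist_real_def by linarith
    with y show "\<exists>x\<in>D. f x < 1 / Suc n" by auto
  qed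
next
  assume H: "\<forall>n::nat. \<exists>x\<in>D. f x < 1 / Suc n"
  then have "C \<noteq> {}" using assms(3) by blast
  then obtain x where x: "x \<in> C" "\<And>y. y \<in> C \<Longrightarrow> f x \<le> f y"
    using continuous_attains_inf[OF assms(1) _ assms(2)] by blast
  have lt: "f x < 1 / Suc n" for n :: nat
    using H x assms(3) by (meson le_less_trans subsetD)
  have "f x \<le> 0"
  proof (rule ccontr)
    assume "\<not> f x \<le> 0"
    then obtain n :: nat where "inverse (real (Suc n)) < f x"
      using reals_Archimedean[of "f x"] by auto
    with lt[of n] show False by (simp add: inverse_eq_divide)
  qed
  with x show "\<exists>x\<in>C. f x \<le> 0" by auto
qed

definition first_time :: "(real \<Rightarrow> bool) \<Rightarrow> ereal" where
  "first_time P = Inf {ereal t | t. 0 \<le> t \<and> P t}"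

lemma first_time_nonneg: "0 \<le> first_time P"
  unfolding first_time_def by (rule Inf_greatest) auto

lemma first_time_leI: "0 \<le> s \<Longrightarrow> P s \<Longrightarrow> ereal s \<le> t \<Longrightarrow> first_time P \<le> t"
  unfolding first_time_def by (rule Inf_lower2) auto

lemma first_time_antimono: "(\<And>s. 0 \<le> s \<Longrightarrow> P s \<Longrightarrow> Q s) \<Longrightarrow> first_time Q \<le> first_time P"
  unfolding first_time_def by (rule Inf_superset_mono) auto

text \<open>Compactness makes the infimum a minimum. The event on the left then speaks only of times
  up to \<open>t\<close>, which is what the stopping time property asks for.\<close>

lemma first_time_le_iff:
  assumes "\<And>t. compact {s. 0 \<le> s \<and> s \<le> t \<and> P s}"
  shows "first_time P \<le> ereal t \<longleftrightarrow> (\<exists>s. 0 \<le> s \<and> s \<le> t \<and> P s)"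
proof
  assume le: "first_time P \<le> ereal t"
  \<comment> \<open>An infimum equal to \<open>t\<close> might a priori only be approached from
    above, so a witness is first sought up to \<open>t + 1\<close>. The least element of this
    compact window then turns out to be at most \<open>t\<close>.\<close>
  define K where "K = {s. 0 \<le> s \<and> s \<le> t + 1 \<and> P s}"
  have "first_time P < ereal (t + 1)" using le by (rule order_le_less_trans) simp
  then obtain s where "0 \<le> s" "P s" "ereal s < ereal (t + 1)"
    unfolding first_time_def Inf_less_iff by (elim bexE CollectE exE conjE) simp
  then have "s \<in> K" by (simp add: K_def)
  then have "K \<noteq> {}" by blast
  moreover have "compact K" unfolding K_def by (rule assms)
  ultimately obtain s0 where s0: "s0 \<in> K" "\<forall>s\<in>K. s0 \<le> s"
    using compact_attains_inf[of K] by blast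
  have "ereal s0 \<le> first_time P"
    unfolding first_time_def
  proof (rule Inf_greatest, clarify)
    fix s assume "0 \<le> s" "P s"
    then show "ereal s0 \<le> ereal s" using s0 by (cases "s \<le> t + 1") (auto simp: K_def)
  qed
  then have "ereal s0 \<le> ereal t" using le by (rule order_trans)
  with s0(1) show "\<exists>s. 0 \<le> s \<and> s \<le> t \<and> P s" by (auto simp: K_def)
qed (auto intro: first_time_leI)

lemma first_time_attained:
  assumes "\<And>t. compact {s. 0 \<le> s \<and> s \<le> t \<and> P s}" "first_time P = ereal t"
  shows "0 \<le> t" "P t"
proof -
  obtain s where s: "0 \<le> s" "s \<le> t" "P s"
    using first_time_le_iff[OF assms(1), of t] assms(2) by auto
  then have "ereal t \<le> ereal s" using first_time_leI[of s P "ereal s"] assms(2) by simp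
  with s have "s = t" by simp
  with s show "0 \<le> t" "P t" by auto
qed

text \<open>The bound \<open>a\<close> is a starting time, later the value of another stopping time.
  It is a closed condition on \<open>s\<close>, so first times after a stopping time are attained as
  well.\<close>

lemma compact_le_zero_set:
  fixes f :: "real \<Rightarrow> real"
  assumes "continuous_on {0..} f"
  shows "compact {s. 0 \<le> s \<and> s \<le> t \<and> a \<le> ereal s \<and> f s \<le> 0}"
proof -
  have "closed {s\<in>{0..t}. f s \<le> 0}"
    using continuous_closed_preimage[of "{0..t}" f "{..0}"] continuous_on_subset[OF assms, of "{0..t}"]
    by (simp add: vimage_def Int_def Icc_subset_Ici_iff)
  moreover have "closed {s. a \<le> ereal s}"
    by (intro closed_Collect_le continuous_intros continuous_on_ereal)
  ultimately have "closed ({s\<in>{0..t}. f s \<le> 0} \<inter> {s. a \<le> ereal s})" by auto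
  moreover have "bounded ({s\<in>{0..t}. f s \<le> 0} \<inter> {s. a \<le> ereal s})"
    by (rule bounded_subset[of "{0..t}"]) auto
  moreover have "{s\<in>{0..t}. f s \<le> 0} \<inter> {s. a \<le> ereal s} = {s. 0 \<le> s \<and> s \<le> t \<and> a \<le> ereal s \<and> f s \<le> 0}"
    by auto
  ultimately show ?thesis by (metis compact_eq_bounded_closed)
qed

text \<open>The endpoint \<open>t\<close> is adjoined for the degenerate interval with
  \<open>l = t\<close> irrational, which contains no rational.\<close>

lemma interval_subset_closure_rationals:
  fixes l t :: real
  shows "{l..t} \<subseteq> closure ({s\<in>\<rat>. l \<le> s \<and> s \<le> t} \<union> {t})"
proof
  fix s assume s: "s \<in> {l..t}"
  show "s \<in> closure ({s\<in>\<rat>. l \<le> s \<and> s \<le> t} \<union> {t})"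
    unfolding closure_approachable
  proof (intro allI impI)
    fix e :: real assume "e > 0"
    show "\<exists>y\<in>{s\<in>\<rat>. l \<le> s \<and> s \<le> t} \<union> {t}. dist y s < e"
    proof (cases "s = t")
      case False
      then have "s < min t (s + e)" using s \<open>e > 0\<close> by auto
      then obtain q where "q \<in> \<rat>" "s < q" "q < min t (s + e)" using Rats_dense_in_real by blast
      then show ?thesis using s by (intro bexI[of _ q]) (auto simp: dist_real_def)
    qed (use \<open>e > 0\<close> in auto)
  qed
qed


subsection \<open>Absorption at zero\<close>

lemma hit0_eq_first_time: "hit0 W w = first_time (\<lambda>t. W t w = 0)"
  by (simp add: hit0_def first_time_def)

lemma hit0_nonneg: "0 \<le> hit0 W w"
  by (simp add: hit0_eq_first_time first_time_nonneg)

context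
  fixes W :: "real \<Rightarrow> 'a \<Rightarrow> real" and w :: 'a
  assumes cont: "continuous_on {0..} (\<lambda>t. W t w)" and pos: "W 0 w > 0"
begin

lemma compact_zeros: "compact {s. 0 \<le> s \<and> s \<le> t \<and> W s w = 0}"
proof -
  have "continuous_on {0..} (\<lambda>s. \<bar>W s w\<bar>)" using cont by (intro continuous_intros)
  from compact_le_zero_set[OF this, of t 0] show ?thesis by (simp cong: conj_cong)
qed

lemma hit0_le_iff: "hit0 W w \<le> ereal t \<longleftrightarrow> (\<exists>s. 0 \<le> s \<and> s \<le> t \<and> W s w = 0)"
  unfolding hit0_eq_first_time by (rule first_time_le_iff[OF compact_zeros])

lemma hit0_attained: "hit0 W w = ereal h \<Longrightarrow> 0 \<le> h \<and> W h w = 0"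
  unfolding hit0_eq_first_time using first_time_attained[OF compact_zeros] by blast

lemma pos_before_hit0:
  assumes "0 \<le> t" "ereal t < hit0 W w"
  shows "W t w > 0"
proof (rule ccontr)
  assume "\<not> W t w > 0"
  then have "\<exists>s\<ge>0. s \<le> t \<and> W s w = 0"
    using IVT2'[of "\<lambda>t. W t w" t 0 0] pos assms(1) continuous_on_subset[OF cont, of "{0..t}"] by auto
  then have "hit0 W w \<le> ereal t" unfolding hit0_le_iff by auto
  with assms(2) show False by simp
qed

lemma absorbed_zero_iff: "0 \<le> t \<Longrightarrow> absorbed W t w = 0 \<longleftrightarrow> hit0 W w \<le> ereal t"
  using pos_before_hit0[of t] by (auto simp: absorbed_def not_less)

lemma absorbed_nonneg: "0 \<le> t \<Longrightarrow> 0 \<le> absorbed W t w"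
  using pos_before_hit0[of t] by (auto simp: absorbed_def)

lemma absorbed_0: "absorbed W 0 w = W 0 w"
proof -
  have "\<not> hit0 W w \<le> ereal 0" unfolding hit0_le_iff using pos by auto
  then show ?thesis by (simp add: absorbed_def zero_ereal_def)
qed

lemma absorbed_eq: "0 \<le> t \<Longrightarrow> ereal t \<le> hit0 W w \<Longrightarrow> absorbed W t w = W t w"
  using hit0_attained[of t] by (auto simp: absorbed_def)

text \<open>Admissibility refers to the hitting time of the absorbed process. Identifying it with
  that of the free motion shows that up to any admissible time the two paths coincide.\<close>

lemma hit0_absorbed: "hit0 (absorbed W) w = hit0 W w"
proof (rule antisym)
  show "hit0 (absorbed W) w \<le> hit0 W w"
    unfolding hit0_eq_first_time
  proof (rule first_time_antimono)
    fix s assume "0 \<le> s" "W s w = 0"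
    then show "absorbed W s w = 0" by (auto simp: absorbed_def)
  qed
  show "hit0 W w \<le> hit0 (absorbed W) w"
    unfolding hit0_def[of "absorbed W"] using absorbed_zero_iff by (intro Inf_greatest) auto
qed

lemma continuous_on_absorbed: "continuous_on {0..} (\<lambda>t. absorbed W t w)"
proof (cases "hit0 W w")
  case (real h)
  then have h: "0 \<le> h" "W h w = 0" using hit0_attained by auto
  have "continuous_on {0..} (\<lambda>t. W (min t h) w)"
    by (rule continuous_on_compose2[OF cont]) (use h in \<open>auto intro!: continuous_intros\<close>)
  moreover have "W (min t h) w = absorbed W t w" if "t \<in> {0..}" for t
    using that real h by (auto simp: absorbed_def min_def)
  ultimately show ?thesis by (rule continuous_on_eq)
next
  case PInf
  then show ?thesis using cont by (simp add: absorbed_def)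
next
  case MInf
  then show ?thesis using hit0_nonneg[of W w] by simp
qed

end

subsection \<open>Measurability\<close>

text \<open>Measurability of \<open>\<sigma>\<close> and of the process is assumed only up to time
  \<open>t\<close>, so \<open>G\<close> may be the information available at \<open>t\<close>. For
  each path the existential over the window from \<open>\<sigma>\<close> to \<open>t\<close> is
  reduced to rational times and \<open>t\<close> by compactness.\<close>

lemma sets_debut:
  fixes f :: "real \<Rightarrow> 'a \<Rightarrow> real"
  assumes \<sigma>: "\<And>q. 0 \<le> q \<Longrightarrow> q \<le> t \<Longrightarrow> {w\<in>space G. \<sigma> w \<le> ereal q} \<in> sets G"
    and f: "\<And>q. 0 \<le> q \<Longrightarrow> q \<le> t \<Longrightarrow> f q \<in> borel_measurable G"
    and cont: "\<And>w. w \<in> space G \<Longrightarrow> continuous_on {0..} (\<lambda>s. f s w)"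
    and "0 \<le> t"
  shows "{w\<in>space G. \<exists>s. 0 \<le> s \<and> s \<le> t \<and> \<sigma> w \<le> ereal s \<and> f s w \<le> 0} \<in> sets G"
proof -
  let ?D = "{s\<in>\<rat>. 0 \<le> s \<and> s \<le> t} \<union> {t}"
  have path: "(\<exists>s. 0 \<le> s \<and> s \<le> t \<and> \<sigma> w \<le> ereal s \<and> f s w \<le> 0) \<longleftrightarrow>
      (\<forall>n::nat. \<exists>q\<in>?D. \<sigma> w \<le> ereal q \<and> f q w < 1 / Suc n)" if w: "w \<in> space G" for w
  proof (cases "\<sigma> w \<le> ereal t")
    case False
    then have "\<not> \<sigma> w \<le> ereal s" if "s \<le> t" for s
      using that order_trans[of "\<sigma> w" "ereal s" "ereal t"] by auto
    then have "\<not> (\<exists>q\<in>?D. \<sigma> w \<le> ereal q \<and> f q w < 1 / Suc 0)" by blast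
    moreover have "\<not> (\<exists>s. 0 \<le> s \<and> s \<le> t \<and> \<sigma> w \<le> ereal s \<and> f s w \<le> 0)"
      using \<open>\<And>s. s \<le> t \<Longrightarrow> \<not> \<sigma> w \<le> ereal s\<close> by blast
    ultimately show ?thesis by blast
  next
    case True
    \<comment> \<open>When \<open>\<sigma> w\<close> is at most \<open>t\<close>, the eligible times
      form the interval from \<open>l\<close> to \<open>t\<close>; the maximum covers a negative
      \<open>\<sigma> w\<close>.\<close>
    define l where "l = real_of_ereal (max 0 (\<sigma> w))"
    have l: "0 \<le> l" "ereal l = max 0 (\<sigma> w)"
      using True by (cases "\<sigma> w"; simp add: l_def max_def zero_ereal_def)+
    have iff: "l \<le> s \<longleftrightarrow> 0 \<le> s \<and> \<sigma> w \<le> ereal s" for s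
    proof -
      have "ereal l \<le> ereal s \<longleftrightarrow> 0 \<le> ereal s \<and> \<sigma> w \<le> ereal s" unfolding l(2) by (rule max.bounded_iff)
      then show ?thesis by simp
    qed
    define D where "D = {s\<in>\<rat>. l \<le> s \<and> s \<le> t} \<union> {t}"
    have D: "D = {q\<in>?D. \<sigma> w \<le> ereal q}"
      unfolding D_def iff using True by blast
    have "(\<exists>s\<in>{l..t}. f s w \<le> 0) \<longleftrightarrow> (\<forall>n::nat. \<exists>q\<in>D. f q w < 1 / Suc n)"
    proof (rule compact_ex_le_zero_iff)
      show "compact {l..t}" by (rule compact_Icc)
      show "continuous_on {l..t} (\<lambda>s. f s w)"
        by (rule continuous_on_subset[OF cont[OF w]]) (use l(1) in auto)
      have "l \<le> t" using True \<open>0 \<le> t\<close> iff[of t] by blast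
      then show "D \<subseteq> {l..t}" unfolding D_def by auto
      show "{l..t} \<subseteq> closure D" unfolding D_def by (rule interval_subset_closure_rationals)
    qed
    moreover have "(\<exists>q\<in>D. f q w < 1 / Suc n) \<longleftrightarrow>
        (\<exists>q\<in>?D. \<sigma> w \<le> ereal q \<and> f q w < 1 / Suc n)" for n :: nat
      unfolding D by blast
    moreover have "(\<exists>s\<in>{l..t}. f s w \<le> 0) \<longleftrightarrow> (\<exists>s. 0 \<le> s \<and> s \<le> t \<and> \<sigma> w \<le> ereal s \<and> f s w \<le> 0)"
      unfolding Bex_def atLeastAtMost_iff iff by blast
    ultimately show ?thesis by (simp only:)
  qed
  have "{w\<in>space G. \<exists>s. 0 \<le> s \<and> s \<le> t \<and> \<sigma> w \<le> ereal s \<and> f s w \<le> 0} =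
      {w\<in>space G. \<forall>n::nat. \<exists>q\<in>?D. \<sigma> w \<le> ereal q \<and> f q w < 1 / Suc n}"
    using path by blast
  also have "... \<in> sets G"
  proof (intro sets.sets_Collect_countable_All)
    fix n :: nat
    have "{w\<in>space G. \<sigma> w \<le> ereal q \<and> f q w < 1 / Suc n} \<in> sets G" if "q \<in> ?D" for q
    proof -
      have q: "0 \<le> q" "q \<le> t" using that \<open>0 \<le> t\<close> by auto
      have "{w\<in>space G. f q w < 1 / Suc n} \<in> sets G" using f[OF q] by measurable
      with \<sigma>[OF q] have "{w\<in>space G. \<sigma> w \<le> ereal q} \<inter> {w\<in>space G. f q w < 1 / Suc n} \<in> sets G"
        by (rule sets.Int)
      then show ?thesis by (simp add: Int_def conj_ac cong: conj_cong)
    qed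
    moreover have "countable ?D" by (auto intro: countable_subset[OF _ countable_rat])
    ultimately have "(\<Union>q\<in>?D. {w\<in>space G. \<sigma> w \<le> ereal q \<and> f q w < 1 / Suc n}) \<in> sets G"
      by (intro sets.countable_UN'') auto
    also have "(\<Union>q\<in>?D. {w\<in>space G. \<sigma> w \<le> ereal q \<and> f q w < 1 / Suc n}) =
        {w\<in>space G. \<exists>q\<in>?D. \<sigma> w \<le> ereal q \<and> f q w < 1 / Suc n}" by blast
    finally show "{w\<in>space G. \<exists>q\<in>?D. \<sigma> w \<le> ereal q \<and> f q w < 1 / Suc n} \<in> sets G" .
  qed
  finally show ?thesis .
qed

lemma ceiling_grid_tendsto:
  fixes s :: real
  shows "(\<lambda>n. of_int \<lceil>real (Suc n) * s\<rceil> / real (Suc n)) \<longlonglongrightarrow> s"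
proof (rule real_tendsto_sandwich[where f="\<lambda>n. s" and h="\<lambda>n. s + 1 / real (Suc n)"])
  show "\<forall>\<^sub>F n in sequentially. s \<le> of_int \<lceil>real (Suc n) * s\<rceil> / real (Suc n)"
    by (intro always_eventually allI) (simp add: field_simps le_of_int_ceiling)
  show "\<forall>\<^sub>F n in sequentially. of_int \<lceil>real (Suc n) * s\<rceil> / real (Suc n) \<le> s + 1 / real (Suc n)"
  proof (intro always_eventually allI)
    fix n
    have "of_int \<lceil>real (Suc n) * s\<rceil> \<le> (s + 1 / real (Suc n)) * real (Suc n)"
      using of_int_ceiling_le_add_one[of "real (Suc n) * s"]
      by (simp add: algebra_simps del: of_nat_Suc)
    then show "of_int \<lceil>real (Suc n) * s\<rceil> / real (Suc n) \<le> s + 1 / real (Suc n)"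
      by (subst pos_divide_le_eq) auto
  qed
  show "(\<lambda>n. s + 1 / real (Suc n)) \<longlonglongrightarrow> s"
    using tendsto_add[OF tendsto_const LIMSEQ_inverse_real_of_nat, of s] by (simp add: inverse_eq_divide)
qed auto

lemma path_tendsto_grid:
  fixes f :: "real \<Rightarrow> real"
  assumes "continuous_on {0..} f" "0 \<le> s"
  shows "(\<lambda>n. f (of_int \<lceil>real (Suc n) * s\<rceil> / real (Suc n))) \<longlonglongrightarrow> f s"
proof (rule continuous_on_tendsto_compose[OF assms(1) ceiling_grid_tendsto])
  have "0 \<le> \<lceil>real (Suc n) * s\<rceil>" for n
    using mult_nonneg_nonneg[OF _ assms(2), of "real (Suc n)"] by linarith
  then show "\<forall>\<^sub>F n in sequentially. real_of_int \<lceil>real (Suc n) * s\<rceil> / real (Suc n) \<in> {0..}"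
    by (intro always_eventually allI) (metis atLeast_iff divide_nonneg_nonneg of_int_0_le_iff of_nat_0_le_iff)
qed (use assms(2) in auto)

text \<open>Rounding the time up to a grid of mesh 1/(n+1) leaves countably many values, for which
  measurability is immediate. Path continuity carries it to the limit.\<close>

lemma measurable_at_random_time:
  fixes X :: "real \<Rightarrow> 'a \<Rightarrow> real"
  assumes X: "\<And>t. 0 \<le> t \<Longrightarrow> X t \<in> borel_measurable G"
    and cont: "\<And>w. w \<in> space G \<Longrightarrow> continuous_on {0..} (\<lambda>s. X s w)"
    and s[measurable]: "s \<in> borel_measurable G" and nn: "\<And>w. w \<in> space G \<Longrightarrow> 0 \<le> s w"
  shows "(\<lambda>w. X (s w) w) \<in> borel_measurable G"
proof (rule borel_measurable_LIMSEQ_real)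
  fix n :: nat
  \<comment> \<open>Composition with a countably valued map needs measurability for every integer,
    also a negative one. The maximum with 0 keeps each grid time in the range where \<open>X\<close>
    is known to be measurable.\<close>
  have "(\<lambda>w. X (of_int (max 0 \<lceil>real (Suc n) * s w\<rceil>) / real (Suc n)) w) \<in> borel_measurable G"
  proof (rule measurable_compose_countable[where g="\<lambda>w. max 0 \<lceil>real (Suc n) * s w\<rceil>"
        and f="\<lambda>k w. X (of_int (max 0 k) / real (Suc n)) w", simplified max.left_idem])
    show "X (of_int (max 0 k) / real (Suc n)) \<in> borel_measurable G" for k
      by (rule X) simp
  qed measurable
  then show "(\<lambda>w. X (of_int (max 0 \<lceil>real (Suc n) * s w\<rceil>) / real (Suc n)) w) \<in> borel_measurable G" .
next
  fix w assume w: "w \<in> space G"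
  have "max 0 \<lceil>real (Suc n) * s w\<rceil> = \<lceil>real (Suc n) * s w\<rceil>" for n
    using mult_nonneg_nonneg[OF _ nn[OF w], of "real (Suc n)"] by (intro max_absorb2) linarith
  then show "(\<lambda>n. X (of_int (max 0 \<lceil>real (Suc n) * s w\<rceil>) / real (Suc n)) w) \<longlonglongrightarrow> X (s w) w"
    using path_tendsto_grid[OF cont[OF w] nn[OF w]] by simp
qed

text \<open>Whether absorption has occurred by \<open>t\<close> is the event that the absolute value
  of \<open>W\<close> is at most 0 at some time up to \<open>t\<close>, a case of
  \<open>sets_debut\<close>. Hence only the path up to \<open>t\<close> matters.\<close>

lemma absorbed_measurable:
  assumes W: "\<And>u. 0 \<le> u \<Longrightarrow> u \<le> t \<Longrightarrow> W u \<in> borel_measurable G" and "0 \<le> t"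
    and cont: "\<And>w. w \<in> space G \<Longrightarrow> continuous_on {0..} (\<lambda>t. W t w)"
    and pos: "\<And>w. w \<in> space G \<Longrightarrow> W 0 w > 0"
  shows "absorbed W t \<in> borel_measurable G"
proof -
  have "{w\<in>space G. \<exists>s. 0 \<le> s \<and> s \<le> t \<and> 0 \<le> ereal s \<and> \<bar>W s w\<bar> \<le> 0} \<in> sets G"
    using W cont \<open>0 \<le> t\<close> by (intro sets_debut) (auto intro!: continuous_intros)
  moreover have "{w\<in>space G. \<exists>s. 0 \<le> s \<and> s \<le> t \<and> 0 \<le> ereal s \<and> \<bar>W s w\<bar> \<le> 0} =
      {w\<in>space G. \<not> ereal t < hit0 W w}"
  proof (intro Collect_cong conj_cong refl)
    fix w assume "w \<in> space G"
    from hit0_le_iff[where W=W, OF cont[OF this] pos[OF this]]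
    show "(\<exists>s\<ge>0. s \<le> t \<and> 0 \<le> ereal s \<and> \<bar>W s w\<bar> \<le> 0) = (\<not> ereal t < hit0 W w)" by (auto simp: not_less)
  qed
  ultimately have "Measurable.pred G (\<lambda>w. \<not> ereal t < hit0 W w)"
    by (simp add: Measurable.pred_def)
  from pred_intros_logic(2)[OF this]
  have [measurable]: "Measurable.pred G (\<lambda>w. ereal t < hit0 W w)" by simp
  have [measurable]: "W t \<in> borel_measurable G" using W \<open>0 \<le> t\<close> by auto
  show ?thesis unfolding absorbed_def[abs_def] by measurable
qed

subsection \<open>The natural filtration\<close>

lemma space_nat_filt [simp]: "space (nat_filt M X t) = space M"
  unfolding nat_filt_def by (rule space_measure_of) auto

lemma sets_nat_filt: "sets (nat_filt M X t) = sigma_sets (space M)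
     (\<Union>s\<in>{s. 0 \<le> s \<and> ereal s < t}. {X s -` A \<inter> space M | A. A \<in> sets borel})"
  unfolding nat_filt_def by (rule sets_measure_of) auto

lemma sets_nat_filt_mono: "s \<le> t \<Longrightarrow> sets (nat_filt M X s) \<subseteq> sets (nat_filt M X t)"
  unfolding sets_nat_filt by (intro sigma_sets_mono' UN_mono) auto

lemma sets_nat_filt_subset:
  assumes "\<And>s. 0 \<le> s \<Longrightarrow> ereal s < t \<Longrightarrow> X s \<in> borel_measurable G" "space G = space M"
  shows "sets (nat_filt M X t) \<subseteq> sets G"
  unfolding sets_nat_filt assms(2)[symmetric]
  by (rule sets.sigma_sets_subset) (use assms(1) in \<open>auto intro: measurable_sets\<close>)

lemma nat_filt_measurable_less:
  assumes "0 \<le> s" "ereal s < t"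
  shows "X s \<in> borel_measurable (nat_filt M X t)"
  by (rule measurableI) (use assms in \<open>auto simp: sets_nat_filt intro!: sigma_sets.Basic\<close>)

text \<open>The filtration at \<open>t\<close> is generated by times strictly before
  \<open>t\<close>. Left continuity of paths recovers the value at \<open>t\<close> itself, and at
  time 0, where no generator is present, the deterministic start does.\<close>

lemma nat_filt_measurable:
  fixes X :: "real \<Rightarrow> 'a \<Rightarrow> real"
  assumes cont: "\<And>w. w \<in> space M \<Longrightarrow> continuous_on {0..} (\<lambda>s. X s w)"
    and const: "\<And>w. w \<in> space M \<Longrightarrow> X 0 w = c" and s: "0 \<le> s" "ereal s \<le> t"
  shows "X s \<in> borel_measurable (nat_filt M X t)"
proof (cases "s = 0")
  case True
  then show ?thesis
    using const by (subst measurable_cong[of _ _ "\<lambda>_. c"]) auto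
next
  case False
  with s have s: "0 < s" "ereal s \<le> t" by auto
  show ?thesis
  proof (rule borel_measurable_LIMSEQ_real)
    fix n :: nat
    have "ereal (s * (1 - 1 / Suc n)) < ereal s" using s(1) by simp
    then have "ereal (s * (1 - 1 / Suc n)) < t" using s(2) by (rule order_less_le_trans)
    then show "X (s * (1 - 1 / Suc n)) \<in> borel_measurable (nat_filt M X t)"
      using s by (intro nat_filt_measurable_less) auto
  next
    fix w assume w: "w \<in> space (nat_filt M X t)"
    show "(\<lambda>n. X (s * (1 - 1 / Suc n)) w) \<longlonglongrightarrow> X s w"
    proof (rule continuous_on_tendsto_compose[OF cont])
      have "(\<lambda>n. s * (1 - inverse (real (Suc n)))) \<longlonglongrightarrow> s * (1 - 0)"
        by (intro tendsto_intros LIMSEQ_inverse_real_of_nat)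
      then show "(\<lambda>n. s * (1 - 1 / Suc n)) \<longlonglongrightarrow> s" by (simp add: inverse_eq_divide)
    qed (use w s in auto)
  qed
qed

section \<open>Independence of Brownian increments from the past\<close>

locale brownian = prob_space M for M :: "'a measure" +
  fixes W :: "real \<Rightarrow> 'a \<Rightarrow> real" and x0 :: real
  assumes BM: "is_BM M x0 W" and x0_pos: "0 < x0"
begin

lemma W_measurable [measurable]: "W t \<in> borel_measurable M"
  using BM by (simp add: is_BM_def)

lemma W_0: "w \<in> space M \<Longrightarrow> W 0 w = x0"
  using BM by (simp add: is_BM_def)

lemma W_cont: "w \<in> space M \<Longrightarrow> continuous_on {0..} (\<lambda>t. W t w)"
  using BM by (simp add: is_BM_def)

lemma W_normal: "0 \<le> s \<Longrightarrow> s < t \<Longrightarrow>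
    distributed M lborel (\<lambda>w. W t w - W s w) (normal_density 0 (sqrt (t - s)))"
  using BM by (simp add: is_BM_def)

text \<open>The path up to \<open>t\<close> as one random element of a product space. Its cylinder
  sets form a generator of the past that is closed under intersection.\<close>

definition Wpath :: "real \<Rightarrow> 'a \<Rightarrow> real \<Rightarrow> real" where
  "Wpath t w = (\<lambda>s\<in>{0..t}. W s w)"

text \<open>The past of the free motion, including time \<open>t\<close>. It contains the filtration
  of the absorbed process, so independence and the martingale property need only be proved
  here.\<close>

definition FW :: "real \<Rightarrow> 'a measure" where
  "FW t = vimage_algebra (space M) (Wpath t) (PiM {0..t} (\<lambda>_. borel))"

lemma space_FW [simp]: "space (FW t) = space M"
  by (simp add: FW_def)

lemma FW_measurable: "0 \<le> s \<Longrightarrow> s \<le> t \<Longrightarrow> W s \<in> borel_measurable (FW t)"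
proof -
  assume s: "0 \<le> s" "s \<le> t"
  have "Wpath t \<in> measurable (FW t) (PiM {0..t} (\<lambda>_. borel))"
    unfolding FW_def by (rule measurable_vimage_algebra1) (auto simp: Wpath_def space_PiM)
  then have "(\<lambda>w. Wpath t w s) \<in> borel_measurable (FW t)"
    by (rule measurable_compose) (use s in \<open>auto intro: measurable_component_singleton\<close>)
  with s show ?thesis by (simp add: Wpath_def)
qed

lemma Wpath_measurable: "Wpath t \<in> measurable M (PiM {0..t} (\<lambda>_. borel))"
  unfolding Wpath_def[abs_def] by measurable

lemma sets_FW_subset: "sets (FW t) \<subseteq> events"
  unfolding FW_def by (rule sets_image_in_sets[OF refl Wpath_measurable])

lemma sets_FW: "sets (FW t) = sigma_sets (space M)
    {Wpath t -` A \<inter> space M | A. A \<in> prod_algebra {0..t} (\<lambda>_. borel)}"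
proof -
  have p: "Wpath t \<in> space M \<rightarrow> (\<Pi>\<^sub>E i\<in>{0..t}. space borel)" by (auto simp: Wpath_def)
  have "sets (FW t) = {Wpath t -` A \<inter> space M | A. A \<in> sets (PiM {0..t} (\<lambda>_. borel))}"
    unfolding FW_def using p by (intro sets_vimage_algebra2) (simp add: space_PiM)
  then show ?thesis unfolding sets_PiM sigma_sets_vimage_commute[OF p] .
qed

text \<open>Values at finitely many times up to \<open>t\<close> are partial sums of increments over
  a grid ending at \<open>t\<close>, while \<open>W T - W t\<close> is the one further increment.
  Independence of increments along a finite list therefore separates the two events.\<close>

lemma increment_indep_cylinder:
  assumes J: "finite J" "J \<subseteq> {0..t}" and "0 \<le> t" "t < T"
    and E: "\<And>j. j \<in> J \<Longrightarrow> E j \<in> sets borel" and B: "B \<in> sets borel"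
  shows "prob ({w\<in>space M. \<forall>j\<in>J. W j w \<in> E j} \<inter> {w\<in>space M. W T w - W t w \<in> B}) =
    prob {w\<in>space M. \<forall>j\<in>J. W j w \<in> E j} * prob {w\<in>space M. W T w - W t w \<in> B}"
proof -
  \<comment> \<open>Time 0 anchors the partial sums at the known value \<open>x0\<close>; time
    \<open>t\<close> makes the last increment of \<open>ts\<close> equal to
    \<open>W T - W t\<close>.\<close>
  define S where "S = insert 0 (insert t J)"
  define L where "L = sorted_list_of_set S"
  define r where "r = length L"
  define ts where "ts = L @ [T]"
  have S: "finite S" "S \<noteq> {}" "S \<subseteq> {0..t}" using assms by (auto simp: S_def)
  have L: "set L = S" "sorted_wrt (<) L" using S by (auto simp: L_def)
  have r: "0 < r" using S L by (auto simp: r_def)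
  have "L ! 0 = 0"
  proof -
    have "0 \<in> set L" unfolding L(1) S_def by blast
    then obtain i where i: "i < r" "L ! i = 0" unfolding in_set_conv_nth r_def by blast
    show ?thesis
    proof (cases "i = 0")
      case False
      then have "L ! 0 < L ! i" using i L(2) unfolding sorted_wrt_iff_nth_less r_def by blast
      moreover have "L ! 0 \<in> {0..t}" using nth_mem[of 0 L] L(1) S(3) r unfolding r_def by blast
      ultimately show ?thesis using i by auto
    qed (use i in auto)
  qed
  have "L ! (r - 1) = t"
  proof -
    have "t \<in> set L" unfolding L(1) S_def by blast
    then obtain i where i: "i < r" "L ! i = t" unfolding in_set_conv_nth r_def by blast
    show ?thesis
    proof (cases "i = r - 1")
      case False
      then have "i < r - 1" "r - 1 < length L" using i by (auto simp: r_def)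
      then have "L ! i < L ! (r - 1)" using L(2) unfolding sorted_wrt_iff_nth_less by blast
      moreover have "L ! (r - 1) \<in> {0..t}" using nth_mem[of "r - 1" L] L(1) S(3) \<open>r - 1 < length L\<close> by blast
      ultimately show ?thesis using i by auto
    qed (use i in auto)
  qed
  define X where "X = (\<lambda>k w. W (ts ! Suc k) w - W (ts ! k) w)"
  have "sorted_wrt (<) ts" "\<forall>s\<in>set ts. 0 \<le> s"
    using L S(3) \<open>0 \<le> t\<close> \<open>t < T\<close> by (auto simp: ts_def sorted_wrt_append)
  then have "indep_vars (\<lambda>_. borel) X {..<length ts - 1}"
    using BM unfolding is_BM_def X_def by blast
  then have ind: "indep_vars (\<lambda>_. borel) X {..<r}" by (simp add: ts_def r_def)
  have tele: "W (L ! k) w = x0 + (\<Sum>i<k. X i w)" if "k < r" "w \<in> space M" for k w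
  proof -
    have "(\<Sum>i<k. X i w) = W (ts ! k) w - W (ts ! 0) w"
      unfolding X_def by (rule sum_lessThan_telescope)
    also have "... = W (L ! k) w - x0"
      using that r \<open>L ! 0 = 0\<close> W_0 by (simp add: ts_def nth_append r_def)
    finally show ?thesis by simp
  qed
  have last: "X (r - 1) w = W T w - W t w" for w
    using r \<open>L ! (r - 1) = t\<close> by (simp add: X_def ts_def nth_append r_def)
  have iv: "indep_var (PiM {..<r - 1} (\<lambda>_. borel)) (\<lambda>w. restrict (\<lambda>i. X i w) {..<r - 1})
      (PiM {r - 1} (\<lambda>_. borel)) (\<lambda>w. restrict (\<lambda>i. X i w) {r - 1})"
    using r by (intro indep_var_restrict[OF ind]) auto
  \<comment> \<open>The cylinder event expressed through the increments before the last one, each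
    value being rebuilt as \<open>x0\<close> plus a partial sum.\<close>
  define A' where "A' = {d\<in>space (PiM {..<r - 1} (\<lambda>_. borel :: real measure)).
      \<forall>k\<in>{k. k < r \<and> L ! k \<in> J}. x0 + (\<Sum>i<k. d i) \<in> E (L ! k)}"
  define B' where "B' = {d\<in>space (PiM {r - 1} (\<lambda>_. borel :: real measure)). d (r - 1) \<in> B}"
  have "A' \<in> sets (PiM {..<r - 1} (\<lambda>_. borel))"
    unfolding A'_def
  proof (rule sets.sets_Collect_finite_All)
    fix k assume k: "k \<in> {k. k < r \<and> L ! k \<in> J}"
    have "(\<lambda>d. x0 + (\<Sum>i<k. d i)) \<in> borel_measurable (PiM {..<r - 1} (\<lambda>_. borel :: real measure))"
      using k by (intro borel_measurable_add borel_measurable_sum measurable_component_singleton) auto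
    from measurable_sets[OF this E[of "L ! k"]] k
    show "{d\<in>space (PiM {..<r - 1} (\<lambda>_. borel :: real measure)). x0 + (\<Sum>i<k. d i) \<in> E (L ! k)}
        \<in> sets (PiM {..<r - 1} (\<lambda>_. borel))"
      by (simp add: vimage_def Int_def conj_ac)
  qed auto
  moreover have "B' \<in> sets (PiM {r - 1} (\<lambda>_. borel))"
  proof -
    have "(\<lambda>d. d (r - 1)) \<in> borel_measurable (PiM {r - 1} (\<lambda>_. borel :: real measure))"
      by (intro measurable_component_singleton) auto
    from measurable_sets[OF this B] show ?thesis by (simp add: B'_def vimage_def Int_def conj_ac)
  qed
  ultimately have "prob ((\<lambda>w. (restrict (\<lambda>i. X i w) {..<r - 1}, restrict (\<lambda>i. X i w) {r - 1})) -` (A' \<times> B') \<inter> space M)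
     = prob ((\<lambda>w. restrict (\<lambda>i. X i w) {..<r - 1}) -` A' \<inter> space M) * prob ((\<lambda>w. restrict (\<lambda>i. X i w) {r - 1}) -` B' \<inter> space M)"
    by (rule indep_varD[OF iv])
  moreover have B'': "(\<lambda>w. restrict (\<lambda>i. X i w) {r - 1}) -` B' \<inter> space M = {w\<in>space M. W T w - W t w \<in> B}"
    unfolding B'_def last[symmetric] by (auto simp: space_PiM)
  moreover have A'': "(\<lambda>w. restrict (\<lambda>i. X i w) {..<r - 1}) -` A' \<inter> space M = {w\<in>space M. \<forall>j\<in>J. W j w \<in> E j}"
  proof -
    have sum_eq: "(\<Sum>i<k. restrict (\<lambda>i. X i w) {..<r - 1} i) = (\<Sum>i<k. X i w)" if "k < r" for k w
      using that by (intro sum.cong) auto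
    have all: "(\<forall>k\<in>{k. k < r \<and> L ! k \<in> J}. P (L ! k)) \<longleftrightarrow> (\<forall>j\<in>J. P j)" for P
    proof -
      have "\<exists>k<r. L ! k = j" if "j \<in> J" for j
      proof -
        have "j \<in> set L" unfolding L(1) S_def using that by blast
        then show ?thesis unfolding in_set_conv_nth r_def by blast
      qed
      then show ?thesis by blast
    qed
    have "restrict (\<lambda>i. X i w) {..<r - 1} \<in> A' \<longleftrightarrow> (\<forall>j\<in>J. W j w \<in> E j)" if "w \<in> space M" for w
    proof -
      have "restrict (\<lambda>i. X i w) {..<r - 1} \<in> space (PiM {..<r - 1} (\<lambda>_. borel :: real measure))"
        by (simp add: space_PiM)
      moreover have "x0 + (\<Sum>i<k. restrict (\<lambda>i. X i w) {..<r - 1} i) = W (L ! k) w" if "k < r" for k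
        unfolding sum_eq[OF that] using tele[OF that \<open>w \<in> space M\<close>] by (rule sym)
      ultimately have "restrict (\<lambda>i. X i w) {..<r - 1} \<in> A' \<longleftrightarrow> (\<forall>k\<in>{k. k < r \<and> L ! k \<in> J}. W (L ! k) w \<in> E (L ! k))"
        unfolding A'_def mem_Collect_eq by simp
      then show ?thesis unfolding all[of "\<lambda>j. W j w \<in> E j"] .
    qed
    then show ?thesis by auto
  qed
  moreover have "(\<lambda>w. (restrict (\<lambda>i. X i w) {..<r - 1}, restrict (\<lambda>i. X i w) {r - 1})) -` (A' \<times> B') \<inter> space M =
      ((\<lambda>w. restrict (\<lambda>i. X i w) {..<r - 1}) -` A' \<inter> space M) \<inter> ((\<lambda>w. restrict (\<lambda>i. X i w) {r - 1}) -` B' \<inter> space M)"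
    by auto
  ultimately show ?thesis by (simp only:)
qed

text \<open>The product formula on cylinder sets extends to all of \<open>FW t\<close>, because both
  generators are closed under intersection.\<close>

lemma increment_indep_FW:
  assumes "0 \<le> t" "t < T" and U: "U \<in> borel_measurable (FW t)"
  shows "indep_var borel U borel (\<lambda>w. W T w - W t w)"
proof -
  let ?D = "{(\<lambda>w. W T w - W t w) -` B \<inter> space M | B. B \<in> sets borel}"
  let ?P = "{Wpath t -` A \<inter> space M | A. A \<in> prod_algebra {0..t} (\<lambda>_. borel)}"
  have D: "?D \<subseteq> events" by auto
  have P: "?P \<subseteq> events" 
    by (rule order_trans[OF sigma_sets_superset_generator sets_FW_subset[of t, unfolded sets_FW]])
  have "indep_set ?P ?D"
  proof (rule indep_setI[OF P D])
    fix a b assume "a \<in> ?P" "b \<in> ?D"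
    then obtain A B where A: "A \<in> prod_algebra {0..t} (\<lambda>_. borel)" "a = Wpath t -` A \<inter> space M"
      and B: "B \<in> sets borel" "b = (\<lambda>w. W T w - W t w) -` B \<inter> space M" by auto
    from A(1) obtain J E where J: "A = prod_emb {0..t} (\<lambda>_. borel) J (\<Pi>\<^sub>E j\<in>J. E j)"
      "finite J" "J \<subseteq> {0..t}" "\<And>i. i \<in> J \<Longrightarrow> E i \<in> sets (borel :: real measure)"
      by (rule prod_algebraE) blast
    have "Wpath t w \<in> A \<longleftrightarrow> (\<forall>j\<in>J. W j w \<in> E j)" for w
    proof -
      have "Wpath t w \<in> A \<longleftrightarrow> restrict (Wpath t w) J \<in> Pi\<^sub>E J E"
        by (simp add: J(1) prod_emb_def Wpath_def)
      also have "... \<longleftrightarrow> (\<forall>j\<in>J. Wpath t w j \<in> E j)" by (simp add: PiE_iff)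
      also have "... \<longleftrightarrow> (\<forall>j\<in>J. W j w \<in> E j)" using J(3) by (intro ball_cong) (auto simp: Wpath_def)
      finally show ?thesis .
    qed
    then have "a = {w\<in>space M. \<forall>j\<in>J. W j w \<in> E j}" by (auto simp: A(2))
    moreover have "b = {w\<in>space M. W T w - W t w \<in> B}" by (auto simp: B(2))
    ultimately show "prob (a \<inter> b) = prob a * prob b"
      using increment_indep_cylinder[OF J(2,3) assms(1,2) J(4) B(1)] by simp
  qed
  moreover have "Int_stable ?P"
  proof (rule Int_stableI)
    fix a b assume "a \<in> ?P" "b \<in> ?P"
    then obtain A B where AB: "A \<in> prod_algebra {0..t} (\<lambda>_. borel)" "a = Wpath t -` A \<inter> space M"
      "B \<in> prod_algebra {0..t} (\<lambda>_. borel)" "b = Wpath t -` B \<inter> space M" by auto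
    moreover from this have "A \<inter> B \<in> prod_algebra {0..t} (\<lambda>_. borel)"
      using Int_stable_prod_algebra unfolding Int_stable_def by blast
    moreover have "a \<inter> b = Wpath t -` (A \<inter> B) \<inter> space M" using AB by auto
    ultimately show "a \<inter> b \<in> ?P" unfolding mem_Collect_eq by (intro exI[of _ "A \<inter> B"] conjI)
  qed
  moreover have "Int_stable ?D"
  proof (rule Int_stableI)
    fix a b assume "a \<in> ?D" "b \<in> ?D"
    then obtain A B where AB: "A \<in> sets borel" "a = (\<lambda>w. W T w - W t w) -` A \<inter> space M"
      "B \<in> sets borel" "b = (\<lambda>w. W T w - W t w) -` B \<inter> space M" by auto
    moreover from this have "A \<inter> B \<in> sets borel" by auto
    moreover have "a \<inter> b = (\<lambda>w. W T w - W t w) -` (A \<inter> B) \<inter> space M" using AB by auto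
    ultimately show "a \<inter> b \<in> ?D" unfolding mem_Collect_eq by (intro exI[of _ "A \<inter> B"] conjI)
  qed
  ultimately have ind: "indep_set (sets (FW t)) (sigma_sets (space M) ?D)"
    unfolding sets_FW by (rule indep_set_sigma_sets)
  have "sigma_sets (space M) {U -` A \<inter> space M | A. A \<in> sets borel} \<subseteq> sets (FW t)"
    by (rule sets.sigma_sets_subset[of _ "FW t", unfolded space_FW])
      (use measurable_sets[OF U] in auto)
  then have "indep_set (sigma_sets (space M) {U -` A \<inter> space M | A. A \<in> sets borel}) (sigma_sets (space M) ?D)"
    using ind unfolding indep_sets2_eq by blast
  moreover have "U \<in> borel_measurable M"
    by (rule measurable_from_subalg[OF _ U]) (simp add: subalgebra_def sets_FW_subset)
  ultimately show ?thesis unfolding indep_var_eq by simp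
qed

end

section \<open>Optional stopping\<close>

text \<open>A common bound on second moments gives uniform integrability. Cutting off at level R
  changes each integral by at most C/R; the truncated integrals converge by dominated convergence;
  Fatou transfers the second moment bound to the limit.\<close>

lemma (in prob_space) L2_bounded_integral_tendsto:
  fixes f :: "nat \<Rightarrow> 'a \<Rightarrow> real"
  assumes f [measurable]: "\<And>n. f n \<in> borel_measurable M"
    and lim: "\<And>w. w \<in> space M \<Longrightarrow> (\<lambda>n. f n w) \<longlonglongrightarrow> g w"
    and f2: "\<And>n. integrable M (\<lambda>w. (f n w)\<^sup>2)" "\<And>n. (\<integral>w. (f n w)\<^sup>2 \<partial>M) \<le> C"
  shows "integrable M g" "(\<lambda>n. \<integral>w. f n w \<partial>M) \<longlonglongrightarrow> (\<integral>w. g w \<partial>M)"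
proof -
  have g [measurable]: "g \<in> borel_measurable M"
    using f lim by (rule borel_measurable_LIMSEQ_real[rotated])
  have "0 \<le> (\<integral>w. (f 0 w)\<^sup>2 \<partial>M)" by simp
  with f2(2)[of 0] have C: "0 \<le> C" by linarith
  have "(\<integral>\<^sup>+w. ennreal ((g w)\<^sup>2) \<partial>M) = (\<integral>\<^sup>+w. liminf (\<lambda>n. ennreal ((f n w)\<^sup>2)) \<partial>M)"
  proof (rule nn_integral_cong)
    fix w assume "w \<in> space M"
    then have "(\<lambda>n. ennreal ((f n w)\<^sup>2)) \<longlonglongrightarrow> ennreal ((g w)\<^sup>2)"
      using lim by (intro tendsto_ennrealI tendsto_power) auto
    then show "ennreal ((g w)\<^sup>2) = liminf (\<lambda>n. ennreal ((f n w)\<^sup>2))"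
      by (intro lim_imp_Liminf[symmetric]) auto
  qed
  also have "... \<le> liminf (\<lambda>n. \<integral>\<^sup>+w. ennreal ((f n w)\<^sup>2) \<partial>M)"
    by (rule nn_integral_liminf) measurable
  also have "... \<le> ennreal C"
  proof (rule Liminf_le)
    show "\<forall>\<^sub>F n in sequentially. (\<integral>\<^sup>+w. ennreal ((f n w)\<^sup>2) \<partial>M) \<le> ennreal C"
      using f2 by (intro always_eventually allI) (subst nn_integral_eq_integral, auto intro: ennreal_leI)
  qed auto
  finally have le: "(\<integral>\<^sup>+w. ennreal ((g w)\<^sup>2) \<partial>M) \<le> ennreal C" .
  have g2: "integrable M (\<lambda>w. (g w)\<^sup>2)"
    by (rule integrableI_nonneg) (auto intro!: order_le_less_trans[OF le])
  have g2le: "(\<integral>w. (g w)\<^sup>2 \<partial>M) \<le> C"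
    using le C g2 by (subst (asm) nn_integral_eq_integral) auto
  show int_g: "integrable M g" by (rule square_integrable_imp_integrable[OF g g2])
  have int_f: "integrable M (f n)" for n by (rule square_integrable_imp_integrable[OF f f2(1)])
  define c :: "real \<Rightarrow> real \<Rightarrow> real" where "c R x = max (- R) (min R x)" for R x
  have c [measurable]: "c R \<in> borel_measurable borel" for R unfolding c_def[abs_def] by measurable
  have cR: "\<bar>c R x\<bar> \<le> R" "\<bar>x - c R x\<bar> \<le> x\<^sup>2 / R" if "R > 0" for R x
  proof -
    show "\<bar>c R x\<bar> \<le> R" using that by (auto simp: c_def)
    show "\<bar>x - c R x\<bar> \<le> x\<^sup>2 / R"
    proof (cases "\<bar>x\<bar> \<le> R")
      case True
      then have "c R x = x" by (auto simp: c_def)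
      with that show ?thesis by simp
    next
      case False
      have "\<bar>x - c R x\<bar> \<le> \<bar>x\<bar>" using that by (auto simp: c_def)
      moreover have "\<bar>x\<bar> * R \<le> \<bar>x\<bar> * \<bar>x\<bar>" using False by (intro mult_left_mono) auto
      then have "\<bar>x\<bar> \<le> x\<^sup>2 / R"
        using that by (simp add: pos_le_divide_eq power2_eq_square)
      ultimately show ?thesis by linarith
    qed
  qed
  have trunc: "\<bar>(\<integral>w. h w \<partial>M) - (\<integral>w. c R (h w) \<partial>M)\<bar> \<le> C / R"
    if "R > 0" "integrable M h" "integrable M (\<lambda>w. (h w)\<^sup>2)" "(\<integral>w. (h w)\<^sup>2 \<partial>M) \<le> C" for R h
  proof -
    have [measurable]: "h \<in> borel_measurable M" using that(2) by auto
    have ic: "integrable M (\<lambda>w. c R (h w))"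
      using cR(1)[OF that(1)] by (intro integrable_const_bound[where B=R]) auto
    have "\<bar>(\<integral>w. h w \<partial>M) - (\<integral>w. c R (h w) \<partial>M)\<bar> = \<bar>\<integral>w. h w - c R (h w) \<partial>M\<bar>"
      using that(2) ic by simp
    also have "... \<le> (\<integral>w. \<bar>h w - c R (h w)\<bar> \<partial>M)" by (rule integral_abs_bound)
    also have "... \<le> (\<integral>w. (h w)\<^sup>2 / R \<partial>M)"
      using that ic cR(2)[OF that(1)] by (intro integral_mono) auto
    also have "... \<le> C / R" using that by (simp add: divide_right_mono)
    finally show ?thesis .
  qed
  show "(\<lambda>n. \<integral>w. f n w \<partial>M) \<longlonglongrightarrow> (\<integral>w. g w \<partial>M)"
  proof (rule LIMSEQ_I)
    fix e :: real assume "e > 0"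
    \<comment> \<open>This level makes the truncation errors of \<open>f n\<close> and of
      \<open>g\<close> smaller than \<open>e / 3\<close> each, leaving \<open>e / 3\<close> for the
      convergence of the truncated integrals. Adding 1 to \<open>C\<close> keeps \<open>R\<close>
      positive when \<open>C = 0\<close>.\<close>
    define R where "R = 3 * (C + 1) / e"
    have R: "R > 0" "C / R < e / 3" using C \<open>e > 0\<close> by (auto simp: R_def field_simps)
    have "(\<lambda>n. \<integral>w. c R (f n w) \<partial>M) \<longlonglongrightarrow> (\<integral>w. c R (g w) \<partial>M)"
    proof (rule integral_dominated_convergence[where w="\<lambda>_. R"])
      show "AE w in M. (\<lambda>n. c R (f n w)) \<longlonglongrightarrow> c R (g w)"
        using lim by (intro AE_I2) (auto simp: c_def intro!: tendsto_intros)
    qed (use cR(1)[OF R(1)] in auto)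
    moreover have "e / 3 > 0" using \<open>e > 0\<close> by simp
    ultimately obtain N where N: "\<And>n. n \<ge> N \<Longrightarrow> norm ((\<integral>w. c R (f n w) \<partial>M) - (\<integral>w. c R (g w) \<partial>M)) < e / 3"
      using LIMSEQ_D by blast
    show "\<exists>N. \<forall>n\<ge>N. norm ((\<integral>w. f n w \<partial>M) - (\<integral>w. g w \<partial>M)) < e"
    proof (intro exI[of _ N] allI impI)
      fix n assume "n \<ge> N"
      from N[OF this] trunc[OF R(1) int_f f2(1,2), of n] trunc[OF R(1) int_g g2 g2le] R(2)
      show "norm ((\<integral>w. f n w \<partial>M) - (\<integral>w. g w \<partial>M)) < e" unfolding real_norm_def by linarith
    qed
  qed
qed

context brownian
begin

lemma sets_FW_mono: "s \<le> t \<Longrightarrow> sets (FW s) \<subseteq> sets (FW t)"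
proof -
  assume "s \<le> t"
  then have "Wpath s \<in> measurable (FW t) (PiM {0..s} (\<lambda>_. borel))"
    unfolding Wpath_def[abs_def] by (intro measurable_restrict FW_measurable) auto
  then show ?thesis unfolding FW_def[of s] by (intro sets_image_in_sets) auto
qed

lemma increment_moments:
  assumes "0 \<le> s" "s < t"
  shows "integrable M (\<lambda>w. W t w - W s w)" "(\<integral>w. W t w - W s w \<partial>M) = 0"
    "integrable M (\<lambda>w. (W t w - W s w)\<^sup>2)"
proof -
  note D = W_normal[OF assms]
  have sd: "0 < sqrt (t - s)" using assms by simp
  show "integrable M (\<lambda>w. W t w - W s w)"
    using distributed_integrable[OF D, of "\<lambda>x. x"] integrable_normal_moment_nz_1[OF sd, of 0] by simp
  show "(\<integral>w. W t w - W s w \<partial>M) = 0"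
    by (rule normal_distributed_expectation[OF sd D])
  show "integrable M (\<lambda>w. (W t w - W s w)\<^sup>2)"
    using distributed_integrable[OF D, of "\<lambda>x. x\<^sup>2"] integrable_normal_moment[OF sd, of 0 2] by simp
qed

lemma W_moments:
  assumes "0 \<le> t"
  shows "integrable M (W t)" "(\<integral>w. W t w \<partial>M) = x0" "integrable M (\<lambda>w. (W t w)\<^sup>2)"
proof -
  have "integrable M (W t) \<and> (\<integral>w. W t w \<partial>M) = x0 \<and> integrable M (\<lambda>w. (W t w)\<^sup>2)"
  proof (cases "t = 0")
    case True
    have "integrable M (W 0) \<longleftrightarrow> integrable M (\<lambda>w. x0)"
      "integrable M (\<lambda>w. (W 0 w)\<^sup>2) \<longleftrightarrow> integrable M (\<lambda>w. x0\<^sup>2)" "(\<integral>w. W 0 w \<partial>M) = (\<integral>w. x0 \<partial>M)"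
      by (intro Bochner_Integration.integrable_cong Bochner_Integration.integral_cong refl; simp add: W_0)+
    with True show ?thesis by (simp add: prob_space)
  next
    case False
    with assms have "0 < t" by simp
    note D = increment_moments[OF order_refl this]
    have "integrable M (W t) \<longleftrightarrow> integrable M (\<lambda>w. x0 + (W t w - W 0 w))"
      "integrable M (\<lambda>w. (W t w)\<^sup>2) \<longleftrightarrow> integrable M (\<lambda>w. x0\<^sup>2 + (2 * x0 * (W t w - W 0 w) + (W t w - W 0 w)\<^sup>2))"
      "(\<integral>w. W t w \<partial>M) = (\<integral>w. x0 + (W t w - W 0 w) \<partial>M)"
      by (intro Bochner_Integration.integrable_cong Bochner_Integration.integral_cong refl;
          simp add: W_0 power2_eq_square algebra_simps)+
    with D show ?thesis by (simp add: prob_space del: Bochner_Integration.integral_diff)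
  qed
  then show "integrable M (W t)" "(\<integral>w. W t w \<partial>M) = x0" "integrable M (\<lambda>w. (W t w)\<^sup>2)" by auto
qed

text \<open>Write \<open>W T\<close> as \<open>W t\<close> plus an increment that is centred and
  independent of \<open>FW t\<close>: the cross terms vanish. The second claim, the submartingale
  property of the square, supplies the uniform second moment bound for optional stopping.\<close>

lemma martingale_property:
  assumes A: "A \<in> sets (FW t)" and "0 \<le> t" "t \<le> T"
  shows "(\<integral>w. indicator A w * W T w \<partial>M) = (\<integral>w. indicator A w * W t w \<partial>M)"
    "(\<integral>w. indicator A w * (W t w)\<^sup>2 \<partial>M) \<le> (\<integral>w. indicator A w * (W T w)\<^sup>2 \<partial>M)"
proof -
  have T: "0 \<le> T" using assms by simp
  have AM [measurable]: "A \<in> events" using A sets_FW_subset by auto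
  have ind_int: "integrable M (\<lambda>w. indicator A w * f w)" if "integrable M f" for f :: "'a \<Rightarrow> real"
    using integrable_mult_indicator[OF AM that] by simp
  have "(\<integral>w. indicator A w * W T w \<partial>M) = (\<integral>w. indicator A w * W t w \<partial>M) \<and>
    (\<integral>w. indicator A w * (W t w)\<^sup>2 \<partial>M) \<le> (\<integral>w. indicator A w * (W T w)\<^sup>2 \<partial>M)"
  proof (cases "t = T")
    case False
    with assms have tT: "t < T" by simp
    let ?D = "\<lambda>w. W T w - W t w"
    note D = increment_moments[OF assms(2) tT]
    have U: "indicator A \<in> borel_measurable (FW t)" "(\<lambda>w. indicator A w * W t w) \<in> borel_measurable (FW t)"
      using A FW_measurable[of t t] assms(2) by auto
    have 1: "(\<integral>w. indicator A w * ?D w \<partial>M) = 0"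
      using indep_var_lebesgue_integral[OF increment_indep_FW[OF assms(2) tT U(1)]] D(1,2)
      by (simp add: integrable_real_indicator less_top[symmetric])
    have 2: "(\<integral>w. (indicator A w * W t w) * ?D w \<partial>M) = 0"
      using indep_var_lebesgue_integral[OF increment_indep_FW[OF assms(2) tT U(2)]
        ind_int[OF W_moments(1)[OF assms(2)]] D(1)] D(2) by simp
    have int2: "integrable M (\<lambda>w. (indicator A w * W t w) * ?D w)"
      by (rule indep_var_integrable[OF increment_indep_FW[OF assms(2) tT U(2)]
        ind_int[OF W_moments(1)[OF assms(2)]] D(1)])
    have "(\<integral>w. indicator A w * W T w \<partial>M) = (\<integral>w. indicator A w * W t w + indicator A w * ?D w \<partial>M)"
      by (rule Bochner_Integration.integral_cong) (auto simp: algebra_simps)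
    also have "... = (\<integral>w. indicator A w * W t w \<partial>M)"
      using 1 ind_int[OF W_moments(1)[OF assms(2)]] ind_int[OF D(1)]
      by (subst Bochner_Integration.integral_add) auto
    finally have a: "(\<integral>w. indicator A w * W T w \<partial>M) = (\<integral>w. indicator A w * W t w \<partial>M)" .
    have "(\<integral>w. indicator A w * (W t w)\<^sup>2 \<partial>M) \<le> (\<integral>w. indicator A w * (W t w)\<^sup>2 \<partial>M) + (\<integral>w. indicator A w * (?D w)\<^sup>2 \<partial>M)"
      by simp
    also have "... = (\<integral>w. indicator A w * (W t w)\<^sup>2 + indicator A w * (?D w)\<^sup>2 \<partial>M)"
      using ind_int[OF W_moments(3)[OF assms(2)]] ind_int[OF D(3)] by simp
    also have "... = (\<integral>w. (indicator A w * (W t w)\<^sup>2 + indicator A w * (?D w)\<^sup>2) + 2 * ((indicator A w * W t w) * ?D w) \<partial>M)"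
      using ind_int[OF W_moments(3)[OF assms(2)]] ind_int[OF D(3)] 2 int2
      by (subst (2) Bochner_Integration.integral_add) (auto intro: Bochner_Integration.integrable_add integrable_mult_right)
    also have "... = (\<integral>w. indicator A w * (W T w)\<^sup>2 \<partial>M)"
      by (rule Bochner_Integration.integral_cong) (auto simp: algebra_simps power2_eq_square)
    finally show ?thesis using a by simp
  qed simp
  then show "(\<integral>w. indicator A w * W T w \<partial>M) = (\<integral>w. indicator A w * W t w \<partial>M)"
    "(\<integral>w. indicator A w * (W t w)\<^sup>2 \<partial>M) \<le> (\<integral>w. indicator A w * (W T w)\<^sup>2 \<partial>M)" by auto
qed

text \<open>Round \<open>\<rho>\<close> up to the grid of mesh 1/(n+1). The event that the rounded
  time is a given grid point belongs to the past of that point, so on each such event the stopped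
  value may be replaced by \<open>W T\<close> without changing the expectation. The second moments
  stay below that of \<open>W T\<close>, which permits letting the mesh tend to 0.\<close>

lemma optional_stopping_bounded:
  fixes T :: nat and \<rho> :: "'a \<Rightarrow> real"
  assumes \<rho>: "\<And>w. w \<in> space M \<Longrightarrow> 0 \<le> \<rho> w \<and> \<rho> w \<le> T"
    and stop: "\<And>t. 0 \<le> t \<Longrightarrow> {w\<in>space M. \<rho> w \<le> t} \<in> sets (FW t)"
  shows "integrable M (\<lambda>w. W (\<rho> w) w)" "(\<integral>w. W (\<rho> w) w \<partial>M) = x0"
proof -
  note [simp del] = of_nat_Suc mult_Suc mult_Suc_right
  define r where "r n w = of_int \<lceil>real (Suc n) * \<rho> w\<rceil> / real (Suc n)" for n w
  define A where "A n j = {w\<in>space M. \<lceil>real (Suc n) * \<rho> w\<rceil> = int j}" for n j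
  have A: "A n j \<in> sets (FW (real j / real (Suc n)))" for n j
  proof (cases j)
    case 0
    have "A n j = {w\<in>space M. \<rho> w \<le> 0}"
    proof -
      have "\<lceil>real (Suc n) * \<rho> w\<rceil> = 0 \<longleftrightarrow> \<rho> w \<le> 0" if "w \<in> space M" for w
      proof
        assume "\<lceil>real (Suc n) * \<rho> w\<rceil> = 0"
        then have "real (Suc n) * \<rho> w \<le> 0" by linarith
        then show "\<rho> w \<le> 0" by (simp add: mult_le_0_iff)
      next
        assume "\<rho> w \<le> 0"
        then have "\<rho> w = 0" using \<rho>[OF that] by linarith
        then show "\<lceil>real (Suc n) * \<rho> w\<rceil> = 0" by simp
      qed
      then show ?thesis by (auto simp: A_def 0)
    qed
    with stop[of 0] 0 show ?thesis by simp
  next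
    case (Suc i)
    have "A n j = {w\<in>space M. \<rho> w \<le> real j / real (Suc n)} - {w\<in>space M. \<rho> w \<le> real i / real (Suc n)}"
    proof -
      have "\<lceil>real (Suc n) * \<rho> w\<rceil> = int j \<longleftrightarrow> \<rho> w \<le> real j / real (Suc n) \<and> \<not> \<rho> w \<le> real i / real (Suc n)" for w
        by (simp add: ceiling_eq_iff Suc pos_le_divide_eq mult.commute not_le del: of_nat_Suc) auto
      then show ?thesis by (auto simp: A_def)
    qed
    moreover have "{w\<in>space M. \<rho> w \<le> real i / real (Suc n)} \<in> sets (FW (real j / real (Suc n)))"
      using stop[of "real i / real (Suc n)"] sets_FW_mono[of "real i / real (Suc n)" "real j / real (Suc n)"]
      by (auto simp: Suc divide_right_mono)
    ultimately show ?thesis using stop[of "real j / real (Suc n)"] by auto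
  qed
  then have AM [measurable]: "A n j \<in> events" for n j using sets_FW_subset by blast
  have jT: "real j / real (Suc n) \<le> T" if "j \<le> Suc n * T" for n j
  proof -
    have "real j \<le> real (Suc n * T)" using that by (simp only: of_nat_le_iff)
    then show ?thesis by (simp add: pos_divide_le_eq mult.commute del: of_nat_Suc)
  qed
  have part: "g (W (r n w) w) = (\<Sum>j\<le>Suc n * T. indicator (A n j) w * g (W (real j / real (Suc n)) w))"
    if w: "w \<in> space M" for g :: "real \<Rightarrow> real" and n w
  proof -
    define k where "k = nat \<lceil>real (Suc n) * \<rho> w\<rceil>"
    have "0 \<le> real (Suc n) * \<rho> w" using \<rho>[OF w] by simp
    then have k0: "\<lceil>real (Suc n) * \<rho> w\<rceil> = int k" unfolding k_def by linarith
    have "real (Suc n) * \<rho> w \<le> real (Suc n) * T" using \<rho>[OF w] by (intro mult_left_mono) auto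
    then have "\<lceil>real (Suc n) * \<rho> w\<rceil> \<le> int (Suc n * T)" by (simp add: ceiling_le_iff del: of_nat_Suc)
    then have kT: "k \<le> Suc n * T" unfolding k0 by (simp only: of_nat_le_iff)
    have "indicator (A n j) w * g (W (real j / real (Suc n)) w) =
        (if j = k then g (W (real k / real (Suc n)) w) else 0)" for j
      using w by (auto simp: A_def k0 indicator_def)
    then have "(\<Sum>j\<le>Suc n * T. indicator (A n j) w * g (W (real j / real (Suc n)) w)) = g (W (real k / real (Suc n)) w)"
      using kT by (simp only: sum.delta finite_atMost) auto
    moreover have "r n w = real k / real (Suc n)" unfolding r_def k0 by simp
    ultimately show ?thesis by simp
  qed
  \<comment> \<open>The events \<open>A n j\<close> partition the space, so summing the pieces gives
    back the full expectation.\<close>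
  have sum1: "(\<Sum>j\<le>Suc n * T. indicator (A n j) w * c) = (c::real)" if "w \<in> space M" for n w c
    using part[OF that, of "\<lambda>_. c"] by simp
  have ind_int: "integrable M (\<lambda>w. indicator (A n j) w * f w)" if "integrable M f" for f :: "'a \<Rightarrow> real" and n j
    using integrable_mult_indicator[OF AM that] by simp
  have W2: "integrable M (\<lambda>w. (W (r n w) w)\<^sup>2)" for n
  proof -
    have "integrable M (\<lambda>w. \<Sum>j\<le>Suc n * T. indicator (A n j) w * (W (real j / real (Suc n)) w)\<^sup>2)"
      by (intro Bochner_Integration.integrable_sum ind_int W_moments) auto
    then show ?thesis
      by (subst Bochner_Integration.integrable_cong[OF refl part[of _ "\<lambda>x. x\<^sup>2" n]])
  qed
  have E2: "(\<integral>w. (W (r n w) w)\<^sup>2 \<partial>M) \<le> (\<integral>w. (W T w)\<^sup>2 \<partial>M)" for n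
  proof -
    have 1: "(\<integral>w. (W (r n w) w)\<^sup>2 \<partial>M) = (\<integral>w. (\<Sum>j\<le>Suc n * T. indicator (A n j) w * (W (real j / real (Suc n)) w)\<^sup>2) \<partial>M)"
      by (rule Bochner_Integration.integral_cong[OF refl part[of _ "\<lambda>x. x\<^sup>2" n]])
    have 2: "(\<integral>w. (\<Sum>j\<le>Suc n * T. indicator (A n j) w * (W (real j / real (Suc n)) w)\<^sup>2) \<partial>M) =
        (\<Sum>j\<le>Suc n * T. \<integral>w. indicator (A n j) w * (W (real j / real (Suc n)) w)\<^sup>2 \<partial>M)"
      by (intro Bochner_Integration.integral_sum ind_int W_moments) auto
    have 3: "(\<Sum>j\<le>Suc n * T. \<integral>w. indicator (A n j) w * (W (real j / real (Suc n)) w)\<^sup>2 \<partial>M) \<le>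
        (\<Sum>j\<le>Suc n * T. \<integral>w. indicator (A n j) w * (W T w)\<^sup>2 \<partial>M)"
      using jT by (intro sum_mono martingale_property(2)[OF A]) auto
    have 4: "(\<integral>w. (\<Sum>j\<le>Suc n * T. indicator (A n j) w * (W T w)\<^sup>2) \<partial>M) =
        (\<Sum>j\<le>Suc n * T. \<integral>w. indicator (A n j) w * (W T w)\<^sup>2 \<partial>M)"
      by (intro Bochner_Integration.integral_sum ind_int W_moments) auto
    have 5: "(\<integral>w. (\<Sum>j\<le>Suc n * T. indicator (A n j) w * (W T w)\<^sup>2) \<partial>M) = (\<integral>w. (W T w)\<^sup>2 \<partial>M)"
      by (rule Bochner_Integration.integral_cong[OF refl sum1])
    show ?thesis unfolding 1 2 5[symmetric] 4 by (rule 3)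
  qed
  have E1: "(\<integral>w. W (r n w) w \<partial>M) = x0" for n
  proof -
    have 1: "(\<integral>w. W (r n w) w \<partial>M) = (\<integral>w. (\<Sum>j\<le>Suc n * T. indicator (A n j) w * W (real j / real (Suc n)) w) \<partial>M)"
      by (rule Bochner_Integration.integral_cong[OF refl part[of _ "\<lambda>x. x" n]])
    have 2: "(\<integral>w. (\<Sum>j\<le>Suc n * T. indicator (A n j) w * W (real j / real (Suc n)) w) \<partial>M) =
        (\<Sum>j\<le>Suc n * T. \<integral>w. indicator (A n j) w * W (real j / real (Suc n)) w \<partial>M)"
      by (intro Bochner_Integration.integral_sum ind_int W_moments) auto
    have 3: "(\<Sum>j\<le>Suc n * T. \<integral>w. indicator (A n j) w * W (real j / real (Suc n)) w \<partial>M) =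
        (\<Sum>j\<le>Suc n * T. \<integral>w. indicator (A n j) w * W T w \<partial>M)"
      using jT by (intro sum.cong refl martingale_property(1)[OF A, symmetric]) auto
    have 4: "(\<Sum>j\<le>Suc n * T. \<integral>w. indicator (A n j) w * W T w \<partial>M) =
        (\<integral>w. (\<Sum>j\<le>Suc n * T. indicator (A n j) w * W T w) \<partial>M)"
      by (intro Bochner_Integration.integral_sum[symmetric] ind_int W_moments) auto
    have 5: "(\<integral>w. (\<Sum>j\<le>Suc n * T. indicator (A n j) w * W T w) \<partial>M) = (\<integral>w. W T w \<partial>M)"
      by (rule Bochner_Integration.integral_cong[OF refl sum1])
    show ?thesis unfolding 1 2 3 4 5 using W_moments(2)[of T] by simp
  qed
  have meas: "(\<lambda>w. W (r n w) w) \<in> borel_measurable M" for n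
  proof -
    have "(\<lambda>w. \<Sum>j\<le>Suc n * T. indicator (A n j) w * W (real j / real (Suc n)) w) \<in> borel_measurable M"
      by measurable
    then show ?thesis by (rule measurable_cong[THEN iffD2, rotated]) (rule part[of _ "\<lambda>x. x" n])
  qed
  have lim: "(\<lambda>n. W (r n w) w) \<longlonglongrightarrow> W (\<rho> w) w" if "w \<in> space M" for w
    unfolding r_def using \<rho>[OF that] by (intro path_tendsto_grid W_cont[OF that]) auto
  show "integrable M (\<lambda>w. W (\<rho> w) w)"
    by (rule L2_bounded_integral_tendsto(1)[OF meas lim W2 E2])
  have "(\<lambda>n. \<integral>w. W (r n w) w \<partial>M) \<longlonglongrightarrow> (\<integral>w. W (\<rho> w) w \<partial>M)"
    by (rule L2_bounded_integral_tendsto(2)[OF meas lim W2 E2])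
  then show "(\<integral>w. W (\<rho> w) w \<partial>M) = x0"
    unfolding E1 by (rule LIMSEQ_unique[OF _ tendsto_const])
qed

end

section \<open>Stopping times of the absorbed process\<close>

context brownian
begin

abbreviation X :: "real \<Rightarrow> 'a \<Rightarrow> real" where "X \<equiv> absorbed W"

abbreviation stopped :: "('a \<Rightarrow> ereal) \<Rightarrow> nat \<Rightarrow> 'a \<Rightarrow> real" where
  "stopped \<tau> T \<equiv> stopval X (\<lambda>w. min (\<tau> w) (ereal (real T)))"

lemma W_0_pos: "w \<in> space M \<Longrightarrow> W 0 w > 0"
  using W_0 x0_pos by simp

lemma X_cont: "w \<in> space M \<Longrightarrow> continuous_on {0..} (\<lambda>t. X t w)"
  by (rule continuous_on_absorbed[where W=W, OF W_cont W_0_pos])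

lemma X_0: "w \<in> space M \<Longrightarrow> X 0 w = x0"
  using absorbed_0[where W=W, OF W_cont W_0_pos] W_0 by simp

lemma X_nonneg: "w \<in> space M \<Longrightarrow> 0 \<le> t \<Longrightarrow> 0 \<le> X t w"
  by (rule absorbed_nonneg[where W=W, OF W_cont W_0_pos])

lemma hit0_X: "w \<in> space M \<Longrightarrow> hit0 X w = hit0 W w"
  by (rule hit0_absorbed[where W=W, OF W_cont W_0_pos])

lemma X_zero_iff: "w \<in> space M \<Longrightarrow> 0 \<le> t \<Longrightarrow> X t w = 0 \<longleftrightarrow> hit0 X w \<le> ereal t"
  using absorbed_zero_iff[where W=W, OF W_cont W_0_pos] hit0_X by simp

lemma X_eq_W: "w \<in> space M \<Longrightarrow> 0 \<le> t \<Longrightarrow> ereal t \<le> hit0 X w \<Longrightarrow> X t w = W t w"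
  using absorbed_eq[where W=W, OF W_cont W_0_pos] hit0_X by simp

lemma X_nat_filt: "0 \<le> s \<Longrightarrow> ereal s \<le> t \<Longrightarrow> X s \<in> borel_measurable (nat_filt M X t)"
  using X_cont X_0 by (rule nat_filt_measurable)

lemma X_measurable_sub:
  assumes "space G = space M" "\<And>u. 0 \<le> u \<Longrightarrow> u \<le> t \<Longrightarrow> W u \<in> borel_measurable G" "0 \<le> t"
  shows "X t \<in> borel_measurable G"
  using assms W_cont W_0_pos by (intro absorbed_measurable) auto

lemma sets_nat_filt_X_subset:
  assumes "space G = space M" "\<And>u. 0 \<le> u \<Longrightarrow> W u \<in> borel_measurable G"
  shows "sets (nat_filt M X t) \<subseteq> sets G"
  using assms by (intro sets_nat_filt_subset X_measurable_sub) auto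

lemma sets_nat_filt_FW: "sets (nat_filt M X (ereal t)) \<subseteq> sets (FW t)"
  by (intro sets_nat_filt_subset X_measurable_sub FW_measurable) auto

lemma admissible_bounds:
  "admissible M X \<tau> \<Longrightarrow> w \<in> space M \<Longrightarrow> 0 \<le> \<tau> w \<and> \<tau> w \<le> hit0 X w"
  by (simp add: admissible_def)

lemma admissible_sets:
  assumes "admissible M X \<tau>"
  shows "{w\<in>space M. \<tau> w \<le> t} \<in> sets (nat_filt M X t)"
  using assms stopping_timeD[of "nat_filt M X" \<tau> t] by (simp add: admissible_def Measurable.pred_def)

lemma admissible_measurable:
  assumes "admissible M X \<tau>" "space G = space M" "\<And>u. 0 \<le> u \<Longrightarrow> W u \<in> borel_measurable G"
  shows "\<tau> \<in> borel_measurable G"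
  by (rule measurable_stopping_time[where F="nat_filt M X"])
    (use assms sets_nat_filt_X_subset[OF assms(2,3)] in \<open>auto simp: admissible_def\<close>)

lemma stopval_measurable_sub:
  assumes "admissible M X \<tau>" "space G = space M" "\<And>u. 0 \<le> u \<Longrightarrow> W u \<in> borel_measurable G"
  shows "stopval X \<tau> \<in> borel_measurable G"
  unfolding stopval_def[abs_def]
proof (rule measurable_at_random_time[where X=X and s="\<lambda>w. real_of_ereal (\<tau> w)"])
  have [measurable]: "\<tau> \<in> borel_measurable G" by (rule admissible_measurable[OF assms])
  show "(\<lambda>w. real_of_ereal (\<tau> w)) \<in> borel_measurable G" by measurable
qed (use assms X_measurable_sub X_cont admissible_bounds[OF assms(1)] in \<open>auto intro!: real_of_ereal_pos\<close>)

lemma stopval_measurable: "admissible M X \<tau> \<Longrightarrow> stopval X \<tau> \<in> borel_measurable M"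
  by (rule stopval_measurable_sub) auto

text \<open>Stopping times are indexed here by all extended reals. At a negative index the event is
  empty and at infinity it is everything, which leaves the finite nonnegative times to be
  checked.\<close>

lemma admissibleI:
  assumes "\<And>t. 0 \<le> t \<Longrightarrow> {w\<in>space M. \<tau> w \<le> ereal t} \<in> sets (nat_filt M X (ereal t))"
    and "\<And>w. w \<in> space M \<Longrightarrow> 0 \<le> \<tau> w" "\<And>w. w \<in> space M \<Longrightarrow> \<tau> w \<le> hit0 X w"
  shows "admissible M X \<tau>"
  unfolding admissible_def
proof (intro conjI stopping_timeI ballI)
  fix t :: ereal
  have "{w\<in>space M. \<tau> w \<le> t} \<in> sets (nat_filt M X t)"
  proof (cases "0 \<le> t")
    case False
    then have "\<not> \<tau> w \<le> t" if "w \<in> space M" for w using order_trans[OF assms(2)[OF that]] by blast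
    then have "{w\<in>space M. \<tau> w \<le> t} = {}" by blast
    then show ?thesis by (simp only: sets.empty_sets)
  next
    case True
    then show ?thesis
    proof (cases t)
      case (real r)
      then show ?thesis using assms(1)[of r] True by simp
    next
      case PInf
      then show ?thesis using sets.top[of "nat_filt M X t"] by simp
    qed simp
  qed
  then show "Measurable.pred (nat_filt M X t) (\<lambda>w. \<tau> w \<le> t)" by (simp add: Measurable.pred_def)
qed (use assms in auto)

lemma admissible_min:
  assumes "admissible M X \<tau>" "admissible M X \<sigma>"
  shows "admissible M X (\<lambda>w. min (\<tau> w) (\<sigma> w))"
  using assms unfolding admissible_def by (auto intro: stopping_time_min simp: min_le_iff_disj)

lemma admissible_zero: "admissible M X (\<lambda>_. 0)"
  unfolding admissible_def by (auto intro: stopping_time_const hit0_nonneg)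

lemma admissible_min_const:
  assumes "admissible M X \<tau>" "0 \<le> t"
  shows "admissible M X (\<lambda>w. min (\<tau> w) t)"
  using assms unfolding admissible_def
  by (auto intro: stopping_time_min stopping_time_const simp: min_le_iff_disj)

section \<open>Debuts of closed sets and optional stopping up to a finite horizon\<close>

lemma hit0_real: "w \<in> space M \<Longrightarrow> hit0 X w = ereal h \<Longrightarrow> 0 \<le> h \<and> X h w = 0"
  using hit0_nonneg[of X w] X_zero_iff[of w h] by auto

text \<open>The first time from \<open>\<sigma>\<close> on at which \<open>X\<close> lies in the
  closed set where \<open>g\<close> is at most 0. Suitable \<open>g\<close> give the exit from (0,
  m), the first passage below a level, and the absorption time.\<close>

definition debut :: "('a \<Rightarrow> ereal) \<Rightarrow> (real \<Rightarrow> real) \<Rightarrow> 'a \<Rightarrow> ereal" where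
  "debut \<sigma> g w = first_time (\<lambda>s. \<sigma> w \<le> ereal s \<and> g (X s w) \<le> 0)"

context
  fixes g :: "real \<Rightarrow> real"
  assumes g: "continuous_on UNIV g"
begin

lemma compact_debut:
  assumes "w \<in> space M"
  shows "compact {s. 0 \<le> s \<and> s \<le> t \<and> \<sigma> w \<le> ereal s \<and> g (X s w) \<le> 0}"
  by (rule compact_le_zero_set) (rule continuous_on_compose2[OF g X_cont[OF assms]], simp)

lemma debut_le_iff:
  assumes "w \<in> space M"
  shows "debut \<sigma> g w \<le> ereal t \<longleftrightarrow> (\<exists>s. 0 \<le> s \<and> s \<le> t \<and> \<sigma> w \<le> ereal s \<and> g (X s w) \<le> 0)"
  unfolding debut_def by (rule first_time_le_iff) (rule compact_debut[OF assms])

lemma debut_attained: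
  assumes "w \<in> space M" "debut \<sigma> g w = ereal t"
  shows "0 \<le> t" "\<sigma> w \<le> ereal t" "g (X t w) \<le> 0"
  using first_time_attained[where P="\<lambda>s. \<sigma> w \<le> ereal s \<and> g (X s w) \<le> 0", OF compact_debut[where \<sigma>=\<sigma>, OF assms(1)]
      assms(2)[unfolded debut_def]] by auto

text \<open>The condition \<open>g 0 \<le> 0\<close> puts the absorbing state into the target set,
  so the debut comes no later than absorption.\<close>

lemma debut_admissible:
  assumes "admissible M X \<sigma>" "g 0 \<le> 0"
  shows "admissible M X (debut \<sigma> g)"
proof (rule admissibleI)
  fix t :: real assume t: "0 \<le> t"
  let ?F = "nat_filt M X (ereal t)"
  have "{w\<in>space (?F). \<exists>s. 0 \<le> s \<and> s \<le> t \<and> \<sigma> w \<le> ereal s \<and> g (X s w) \<le> 0}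
      \<in> sets (?F)"
  proof (rule sets_debut)
    fix q assume q: "0 \<le> q" "q \<le> t"
    show "{w\<in>space (?F). \<sigma> w \<le> ereal q} \<in> sets (?F)"
      using admissible_sets[OF assms(1), of "ereal q"] sets_nat_filt_mono[of "ereal q" "ereal t"] q by auto
    have [measurable]: "g \<in> borel_measurable borel" using g by (rule borel_measurable_continuous_onI)
    have [measurable]: "X q \<in> borel_measurable (?F)" using X_nat_filt q by simp
    show "(\<lambda>w. g (X q w)) \<in> borel_measurable (?F)" by measurable
  next
    fix w assume "w \<in> space (?F)"
    then show "continuous_on {0..} (\<lambda>s. g (X s w))"
      by (intro continuous_on_compose2[OF g X_cont]) auto
  qed fact
  moreover have "{w\<in>space (?F). \<exists>s. 0 \<le> s \<and> s \<le> t \<and> \<sigma> w \<le> ereal s \<and> g (X s w) \<le> 0} =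
      {w\<in>space M. debut \<sigma> g w \<le> ereal t}"
    by (intro Collect_cong conj_cong) (simp_all only: space_nat_filt debut_le_iff)
  ultimately show "{w\<in>space M. debut \<sigma> g w \<le> ereal t} \<in> sets (?F)" by simp
next
  fix w assume w: "w \<in> space M"
  show "0 \<le> debut \<sigma> g w" unfolding debut_def by (rule first_time_nonneg)
  show "debut \<sigma> g w \<le> hit0 X w"
  proof (cases "hit0 X w")
    case (real h)
    with hit0_real[OF w real] show ?thesis
      using admissible_bounds[OF assms(1) w] assms(2) by (auto simp: debut_def intro!: first_time_leI)
  qed (use hit0_nonneg[of X w] in auto)
qed

end

text \<open>An admissible time never exceeds the absorption time, so the stopped absorbed process is
  the free motion stopped at a bounded time.\<close>

lemma optional_stopping_min:
  fixes T :: nat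
  assumes \<tau>: "admissible M X \<tau>"
  shows "integrable M (stopped \<tau> T)"
    "(\<integral>w. stopped \<tau> T w \<partial>M) = x0"
proof -
  define \<rho> where "\<rho> w = real_of_ereal (min (\<tau> w) (ereal T))" for w
  have \<rho>: "0 \<le> \<rho> w" "\<rho> w \<le> T" "ereal (\<rho> w) = min (\<tau> w) (ereal T)" if "w \<in> space M" for w
    using admissible_bounds[OF \<tau> that] by (cases "\<tau> w"; simp add: \<rho>_def min_def)+
  have eq: "stopped \<tau> T w = W (\<rho> w) w" if "w \<in> space M" for w
  proof -
    have "ereal (\<rho> w) \<le> hit0 X w"
      unfolding \<rho>(3)[OF that] using admissible_bounds[OF \<tau> that] by (simp add: min_le_iff_disj)
    then show ?thesis unfolding stopval_def \<rho>_def[symmetric] by (rule X_eq_W[OF that \<rho>(1)[OF that]])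
  qed
  have stop: "{w\<in>space M. \<rho> w \<le> t} \<in> sets (FW t)" if "0 \<le> t" for t
  proof -
    have iff: "\<rho> w \<le> t \<longleftrightarrow> \<tau> w \<le> ereal t \<or> real T \<le> t" if "w \<in> space M" for w
      using \<rho>(3)[OF that] min_le_iff_disj[of "\<tau> w" "ereal T" "ereal t"] by (metis ereal_less_eq(3))
    show ?thesis
    proof (cases "real T \<le> t")
      case True
      then have "{w\<in>space M. \<rho> w \<le> t} = space (FW t)" using iff by auto
      then show ?thesis by (simp only: sets.top)
    next
      case False
      then have "{w\<in>space M. \<rho> w \<le> t} = {w\<in>space M. \<tau> w \<le> ereal t}" using iff by auto
      then show ?thesis using admissible_sets[OF \<tau>, of "ereal t"] sets_nat_filt_FW[of t] by auto
    qed
  qed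
  have b: "0 \<le> \<rho> w \<and> \<rho> w \<le> T" if "w \<in> space M" for w using \<rho>[OF that] by blast
  note os = optional_stopping_bounded[OF b stop]
  show "integrable M (stopped \<tau> T)"
    by (subst Bochner_Integration.integrable_cong[OF refl eq]) (simp_all add: os)
  show "(\<integral>w. stopped \<tau> T w \<partial>M) = x0"
    by (subst Bochner_Integration.integral_cong[OF refl eq]) (simp_all add: os)
qed

section \<open>Almost sure absorption at 0\<close>

lemma stopval_nonneg: "admissible M X \<tau> \<Longrightarrow> w \<in> space M \<Longrightarrow> 0 \<le> stopval X \<tau> w"
  unfolding stopval_def using admissible_bounds[of \<tau> w] by (intro X_nonneg real_of_ereal_pos) auto

text \<open>A normal density with variance t never exceeds its peak 1/sqrt(2 pi t), and the interval
  has length \<open>R\<close>.\<close>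

lemma prob_W_interval:
  assumes "0 < t" "0 \<le> R"
  shows "prob {w\<in>space M. 0 < W t w \<and> W t w < R} \<le> R / sqrt (2 * pi * t)"
proof -
  note D = W_normal[OF order_refl assms(1)]
  let ?A = "{- x0<..<R - x0}"
  have "{w\<in>space M. 0 < W t w \<and> W t w < R} = (\<lambda>w. W t w - W 0 w) -` ?A \<inter> space M"
    using W_0 by auto
  then have "emeasure M {w\<in>space M. 0 < W t w \<and> W t w < R} =
      (\<integral>\<^sup>+x. ennreal (normal_density 0 (sqrt (t - 0)) x) * indicator ?A x \<partial>lborel)"
    using distributed_emeasure[OF D, of ?A] by simp
  also have "... \<le> (\<integral>\<^sup>+x. ennreal (1 / sqrt (2 * pi * t)) * indicator ?A x \<partial>lborel)"
  proof (intro nn_integral_mono mult_right_mono ennreal_leI)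
    fix x :: real
    have "1 / sqrt (2 * pi * t) * exp (- x\<^sup>2 / (2 * t)) \<le> 1 / sqrt (2 * pi * t) * 1"
      using assms by (intro mult_left_mono) auto
    then show "normal_density 0 (sqrt (t - 0)) x \<le> 1 / sqrt (2 * pi * t)"
      using assms by (simp add: normal_density_def)
  qed auto
  also have "... = ennreal (1 / sqrt (2 * pi * t)) * emeasure lborel ?A"
    by (subst nn_integral_cmult_indicator) auto
  also have "... = ennreal (1 / sqrt (2 * pi * t)) * ennreal R"
    using assms by simp
  also have "... = ennreal (R / sqrt (2 * pi * t))"
    using assms by (simp add: ennreal_mult[symmetric])
  finally show ?thesis using assms by (simp add: emeasure_eq_measure)
qed

text \<open>A path that never reaches 0 either attains \<open>R\<close> by time \<open>T\<close>,
  which has probability at most x0/R by Markov's inequality for the stopped martingale, or is still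
  inside (0, R) at time \<open>T\<close>, which is unlikely because the normal law spreads
  out.\<close>

lemma prob_not_hit_le:
  fixes T :: nat
  assumes "0 < T" "0 < R"
  shows "prob {w\<in>space M. hit0 X w = \<infinity>} \<le> x0 / R + R / sqrt (2 * pi * T)"
proof -
  define g where "g x = min x (R - x)" for x :: real
  have g: "continuous_on UNIV g" unfolding g_def[abs_def] by (intro continuous_intros)
  have \<rho>: "admissible M X (debut (\<lambda>_. 0) g)"
    using assms by (intro debut_admissible[OF g] admissible_zero) (simp add: g_def)
  let ?Y = "stopped (debut (\<lambda>_. 0) g) T"
  have adm: "admissible M X (\<lambda>w. min (debut (\<lambda>_. 0) g w) (ereal T))"
    by (rule admissible_min_const[OF \<rho>]) simp
  have [measurable]: "?Y \<in> borel_measurable M" by (rule stopval_measurable[OF adm])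
  have "{w\<in>space M. hit0 X w = \<infinity>} \<subseteq> {w\<in>space M. ?Y w \<ge> R} \<union> {w\<in>space M. 0 < W T w \<and> W T w < R}"
  proof (rule subsetI, elim CollectE conjE)
    fix w assume w: "w \<in> space M" "hit0 X w = \<infinity>"
    have pos: "0 < X s w" if "0 \<le> s" for s
      using X_zero_iff[OF w(1) that] X_nonneg[OF w(1) that] w(2) by auto
    show "w \<in> {w\<in>space M. ?Y w \<ge> R} \<union> {w\<in>space M. 0 < W T w \<and> W T w < R}"
    proof (cases "debut (\<lambda>_. 0) g w \<le> ereal T")
      case True
      moreover have "0 \<le> debut (\<lambda>_. 0) g w" using admissible_bounds[OF \<rho> w(1)] by simp
      ultimately obtain r where r: "debut (\<lambda>_. 0) g w = ereal r" by (cases "debut (\<lambda>_. 0) g w") auto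
      have "0 \<le> r" "g (X r w) \<le> 0" using debut_attained[OF g w(1) r] by auto
      then have "R \<le> X r w" using pos[of r] by (auto simp: g_def min_def split: if_splits)
      moreover have "?Y w = X r w" using True r by (simp add: stopval_def min_def)
      ultimately show ?thesis using w by simp
    next
      case False
      then have "\<not> (0 \<le> (0::ereal) \<and> g (X T w) \<le> 0)"
        using debut_le_iff[OF g w(1), of "\<lambda>_. 0" T] by auto
      then have "0 < X T w \<and> X T w < R" by (auto simp: g_def min_def split: if_splits)
      then show ?thesis using X_eq_W[OF w(1), of T] w by simp
    qed
  qed
  then have "prob {w\<in>space M. hit0 X w = \<infinity>} \<le> prob ({w\<in>space M. ?Y w \<ge> R} \<union> {w\<in>space M. 0 < W T w \<and> W T w < R})"
    by (rule finite_measure_mono) measurable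
  also have "... \<le> prob {w\<in>space M. ?Y w \<ge> R} + prob {w\<in>space M. 0 < W T w \<and> W T w < R}"
    by (rule measure_Un_le) measurable
  also have "... \<le> x0 / R + R / sqrt (2 * pi * T)"
  proof (rule add_mono)
    have "prob {w\<in>space M. ?Y w \<ge> R} \<le> (\<integral>w. ?Y w \<partial>M) / R"
      by (rule integral_Markov_inequality_measure[OF optional_stopping_min(1)[OF \<rho>] sets.empty_sets])
        (use stopval_nonneg[OF adm] assms in auto)
    then show "prob {w\<in>space M. ?Y w \<ge> R} \<le> x0 / R" using optional_stopping_min(2)[OF \<rho>, of T] by simp
    show "prob {w\<in>space M. 0 < W T w \<and> W T w < R} \<le> R / sqrt (2 * pi * T)"
      using assms by (intro prob_W_interval) auto
  qed
  finally show ?thesis .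
qed

text \<open>Measurability of the event comes from recognizing the absorption time as the debut for
  the identity function. Its probability is then squeezed to 0 by the preceding bound.\<close>

lemma hit0_finite: "AE w in M. hit0 X w < \<infinity>"
proof -
  have m: "{w\<in>space M. hit0 X w = \<infinity>} \<in> events"
  proof -
    have "continuous_on UNIV (\<lambda>x::real. x)" by simp
    from debut_admissible[OF this admissible_zero] have a: "admissible M X (debut (\<lambda>_. 0) (\<lambda>x. x))" by simp
    have "debut (\<lambda>_. 0) (\<lambda>x. x) w = hit0 X w" if "w \<in> space M" for w
      unfolding debut_def hit0_eq_first_time first_time_def
      by (rule arg_cong[where f=Inf], rule Collect_cong) (use X_nonneg[OF that] in \<open>auto intro: antisym\<close>)
    then have "{w\<in>space M. hit0 X w = \<infinity>} = {w\<in>space M. debut (\<lambda>_. 0) (\<lambda>x. x) w = \<infinity>}" by auto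
    moreover have [measurable]: "debut (\<lambda>_. 0) (\<lambda>x. x) \<in> borel_measurable M"
      by (rule admissible_measurable[OF a]) auto
    ultimately show ?thesis by simp
  qed
  have "prob {w\<in>space M. hit0 X w = \<infinity>} \<le> 0"
  proof (rule LIMSEQ_le_const)
    show "(\<lambda>n. (x0 + 1) * inverse (real (Suc n))) \<longlonglongrightarrow> 0"
      using tendsto_mult[OF tendsto_const LIMSEQ_inverse_real_of_nat, of "x0 + 1"] by simp
    show "\<exists>N. \<forall>n\<ge>N. prob {w\<in>space M. hit0 X w = \<infinity>} \<le> (x0 + 1) * inverse (real (Suc n))"
    proof (intro exI allI impI)
      fix n :: nat
      let ?R = "real (Suc n)"
      \<comment> \<open>The horizon is the fourth power of the level R, so that R / sqrt(T) = 1/R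
        and both terms of the bound are of order 1/R.\<close>
      have "prob {w\<in>space M. hit0 X w = \<infinity>} \<le> x0 / ?R + ?R / sqrt (2 * pi * real (Suc n ^ 4))"
        by (rule prob_not_hit_le) auto
      also have "... \<le> x0 / ?R + ?R / ?R\<^sup>2"
      proof (intro add_left_mono divide_left_mono)
        have "?R\<^sup>2 = sqrt (real (Suc n ^ 4))" by (rule real_sqrt_unique[symmetric]) (simp_all add: power_mult[symmetric])
        also have "... \<le> sqrt (2 * pi * real (Suc n ^ 4))"
        proof (rule real_sqrt_le_mono)
          have "1 * real (Suc n ^ 4) \<le> 2 * pi * real (Suc n ^ 4)"
            using pi_gt3 by (intro mult_right_mono) auto
          then show "real (Suc n ^ 4) \<le> 2 * pi * real (Suc n ^ 4)" by simp
        qed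
        finally show "?R\<^sup>2 \<le> sqrt (2 * pi * real (Suc n ^ 4))" .
      qed auto
      also have "... = (x0 + 1) * inverse ?R"
        by (simp add: field_simps power2_eq_square del: of_nat_Suc)
      finally show "prob {w\<in>space M. hit0 X w = \<infinity>} \<le> (x0 + 1) * inverse ?R" .
    qed
  qed
  then have "prob {w\<in>space M. hit0 X w = \<infinity>} = 0" by (simp add: measure_le_0_iff)
  then show ?thesis using m
    by (intro AE_I[of _ _ "{w\<in>space M. hit0 X w = \<infinity>}"]) (auto simp: emeasure_eq_measure)
qed


section \<open>Optional stopping without a horizon\<close>

lemma stopval_min_tendsto:
  assumes "w \<in> space M" "admissible M X \<tau>" "hit0 X w < \<infinity>"
  shows "(\<lambda>T. stopped \<tau> T w) \<longlonglongrightarrow> stopval X \<tau> w"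
proof -
  have "\<tau> w < \<infinity>" "0 \<le> \<tau> w" using admissible_bounds[OF assms(2,1)] assms(3) by (auto intro: order_le_less_trans)
  then obtain s where s: "\<tau> w = ereal s" by (cases "\<tau> w") auto
  obtain N :: nat where N: "s \<le> N" using real_arch_simple by blast
  have "\<forall>\<^sub>F T in sequentially. stopped \<tau> T w = stopval X \<tau> w"
    unfolding eventually_sequentially
  proof (intro exI[of _ N] allI impI)
    fix T assume "N \<le> T"
    then have "min (\<tau> w) (ereal (real T)) = \<tau> w" using N s by simp
    then show "stopped \<tau> T w = stopval X \<tau> w" by (simp add: stopval_def)
  qed
  then show ?thesis by (rule tendsto_eventually)
qed

text \<open>Fatou's lemma along growing horizons. Equality fails in general: waiting until
  absorption gives expectation 0.\<close>

lemma stopval_expectation_le: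
  assumes \<tau>: "admissible M X \<tau>"
  shows "integrable M (stopval X \<tau>)" "(\<integral>w. stopval X \<tau> w \<partial>M) \<le> x0"
proof -
  let ?Y = "stopped \<tau>"
  have adm: "admissible M X (\<lambda>w. min (\<tau> w) (ereal (real T)))" for T :: nat
    by (rule admissible_min_const[OF \<tau>]) simp
  note [measurable] = stopval_measurable[OF \<tau>] stopval_measurable[OF adm]
  have "(\<integral>\<^sup>+w. ennreal (stopval X \<tau> w) \<partial>M) = (\<integral>\<^sup>+w. liminf (\<lambda>T. ennreal (?Y T w)) \<partial>M)"
  proof (rule nn_integral_cong_AE)
    show "AE w in M. ennreal (stopval X \<tau> w) = liminf (\<lambda>T. ennreal (?Y T w))"
      using hit0_finite AE_space
    proof eventually_elim
      case (elim w)
      have "(\<lambda>T. ennreal (?Y T w)) \<longlonglongrightarrow> ennreal (stopval X \<tau> w)"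
        using elim \<tau> by (intro tendsto_ennrealI stopval_min_tendsto)
      then show ?case by (intro lim_imp_Liminf[symmetric]) auto
    qed
  qed
  also have "... \<le> liminf (\<lambda>T. \<integral>\<^sup>+w. ennreal (?Y T w) \<partial>M)"
    by (rule nn_integral_liminf) measurable
  also have "... \<le> ennreal x0"
  proof (rule Liminf_le)
    have "(\<integral>\<^sup>+w. ennreal (?Y T w) \<partial>M) = ennreal x0" for T
      using optional_stopping_min[OF \<tau>, of T] stopval_nonneg[OF adm]
      by (subst nn_integral_eq_integral) auto
    then show "\<forall>\<^sub>F T in sequentially. (\<integral>\<^sup>+w. ennreal (?Y T w) \<partial>M) \<le> ennreal x0" by simp
  qed simp
  finally have le: "(\<integral>\<^sup>+w. ennreal (stopval X \<tau> w) \<partial>M) \<le> ennreal x0" .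
  show int: "integrable M (stopval X \<tau>)"
    by (rule integrableI_nonneg) (use stopval_nonneg[OF \<tau>] in \<open>auto intro!: order_le_less_trans[OF le]\<close>)
  show "(\<integral>w. stopval X \<tau> w \<partial>M) \<le> x0"
    using le x0_pos stopval_nonneg[OF \<tau>] int by (subst (asm) nn_integral_eq_integral) auto
qed

text \<open>Either expectation alone may drop below \<open>x0\<close> in the limit. A uniform bound
  on the difference gives dominated convergence for it, so the two losses cancel.\<close>

lemma optional_stopping_diff:
  assumes \<sigma>: "admissible M X \<sigma>" and \<rho>: "admissible M X \<rho>"
    and bound: "\<And>w (T::nat). w \<in> space M \<Longrightarrow>
      \<bar>stopped \<rho> T w - stopped \<sigma> T w\<bar> \<le> C"
  shows "(\<integral>w. stopval X \<rho> w - stopval X \<sigma> w \<partial>M) = 0"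
proof -
  have adm: "admissible M X (\<lambda>w. min (\<tau> w) (ereal (real T)))" if "admissible M X \<tau>" for \<tau> and T :: nat
    by (rule admissible_min_const[OF that]) simp
  note [measurable] = stopval_measurable[OF \<sigma>] stopval_measurable[OF \<rho>]
    stopval_measurable[OF adm[OF \<sigma>]] stopval_measurable[OF adm[OF \<rho>]]
  have "(\<lambda>T. \<integral>w. stopped \<rho> T w - stopped \<sigma> T w \<partial>M) \<longlonglongrightarrow> (\<integral>w. stopval X \<rho> w - stopval X \<sigma> w \<partial>M)"
  proof (rule integral_dominated_convergence[where w="\<lambda>_. C"])
    show "AE w in M. (\<lambda>T. stopped \<rho> T w - stopped \<sigma> T w) \<longlonglongrightarrow> stopval X \<rho> w - stopval X \<sigma> w"
      using hit0_finite AE_space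
    proof eventually_elim
      case (elim w)
      then show ?case using \<sigma> \<rho> by (intro tendsto_diff stopval_min_tendsto)
    qed
  qed (use bound in auto)
  moreover have "(\<integral>w. stopped \<rho> T w - stopped \<sigma> T w \<partial>M) = 0" for T
    using optional_stopping_min[OF \<rho>, of T] optional_stopping_min[OF \<sigma>, of T] by simp
  ultimately have "(\<lambda>T::nat. 0) \<longlonglongrightarrow> (\<integral>w. stopval X \<rho> w - stopval X \<sigma> w \<partial>M)" by (simp only:)
  then show ?thesis by (rule LIMSEQ_unique[OF _ tendsto_const])
qed

subsection \<open>The running maximum after a stopping time\<close>

text \<open>After absorption the path stays at 0, a value already taken at the absorption time, so
  lifting the cutoff adds nothing to the set of values.\<close>

lemma supafter_eq:
  assumes w: "w \<in> space M" and \<tau>: "\<tau> w = ereal s" "0 \<le> s" "\<tau> w \<le> hit0 X w"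
  shows "supafter X \<tau> w = Sup ((\<lambda>t. X t w) ` {s..})"
proof -
  have "{X t w | t. 0 \<le> t \<and> \<tau> w \<le> ereal t \<and> ereal t \<le> hit0 X w} = (\<lambda>t. X t w) ` {s..}"
  proof (intro equalityI subsetI)
    fix x assume "x \<in> (\<lambda>t. X t w) ` {s..}"
    then obtain t where t: "x = X t w" "s \<le> t" by auto
    show "x \<in> {X t w | t. 0 \<le> t \<and> \<tau> w \<le> ereal t \<and> ereal t \<le> hit0 X w}"
    proof (cases "ereal t \<le> hit0 X w")
      case True
      then show ?thesis using t \<tau> by auto
    next
      case False
      then obtain h where h: "hit0 X w = ereal h" using hit0_nonneg[of X w] by (cases "hit0 X w") auto
      have "X h w = 0" "0 \<le> h" using hit0_real[OF w h] by auto
      moreover have "X t w = 0" using X_zero_iff[OF w, of t] False t \<tau>(2) by auto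
      ultimately show ?thesis using t \<tau> h by (intro CollectI exI[of _ h]) auto
    qed
  qed (use \<tau> in auto)
  then show ?thesis by (simp add: supafter_def)
qed

lemma ex_later_greater_iff:
  assumes w: "w \<in> space M" and s: "0 \<le> s"
  shows "(\<exists>t\<in>{s..}. c < X t w) \<longleftrightarrow> (\<exists>q\<in>\<rat>. c < X (max s q) w)"
proof
  assume "\<exists>t\<in>{s..}. c < X t w"
  then obtain t where t: "s \<le> t" "c < X t w" by auto
  then have "0 \<le> t" using s by simp
  then have "\<forall>e>0. \<exists>d>0. \<forall>u\<in>{0..}. dist u t < d \<longrightarrow> dist (X u w) (X t w) < e"
    using X_cont[OF w] unfolding continuous_on_iff by (auto simp: Ball_def)
  moreover have "0 < X t w - c" using t by simp
  ultimately obtain d where d: "d > 0" "\<forall>u\<in>{0..}. dist u t < d \<longrightarrow> dist (X u w) (X t w) < X t w - c"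
    by blast
  have "t < t + d" using d(1) by simp
  then obtain q where q: "q \<in> \<rat>" "t < q" "q < t + d" using Rats_dense_in_real by blast
  have "dist (X q w) (X t w) < X t w - c"
    using q \<open>0 \<le> t\<close> by (intro d(2)[rule_format]) (auto simp: dist_real_def)
  then have "c < X q w" unfolding dist_real_def by linarith
  moreover have "max s q = q" using q t by simp
  ultimately show "\<exists>q\<in>\<rat>. c < X (max s q) w" using q(1) by (intro bexI[of _ q]) simp_all
qed (auto intro: max.cobounded1)

text \<open>Continuity reduces exceeding a level at a later time to rational times. The statement is
  for a general \<open>G\<close> because independence of the players needs measurability with
  respect to the sigma-algebra of a player's own path, not just with respect to
  \<open>M\<close>.\<close>

lemma supafter_measurable_sub:
  assumes \<tau>: "admissible M X \<tau>" and G: "space G = space M" "\<And>u. 0 \<le> u \<Longrightarrow> W u \<in> borel_measurable G"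
  shows "supafter X \<tau> \<in> borel_measurable G"
proof -
  define s where "s w = real_of_ereal (\<tau> w)" for w
  have \<tau>G [measurable]: "\<tau> \<in> borel_measurable G" by (rule admissible_measurable[OF \<tau> G])
  then have [measurable]: "s \<in> borel_measurable G" unfolding s_def[abs_def] by measurable
  have s: "0 \<le> s w" if "w \<in> space M" for w
    using admissible_bounds[OF \<tau> that] by (auto simp: s_def intro: real_of_ereal_pos)
  have Xq: "(\<lambda>w. X (max (s w) q) w) \<in> borel_measurable G" for q
    by (rule measurable_at_random_time[where X=X and s="\<lambda>w. max (s w) q"])
      (use G X_cont s in \<open>auto intro: X_measurable_sub simp: le_max_iff_disj\<close>)
  define E where "E c w = (\<exists>t\<in>{s w..}. c < X t w)" for c w
  have E: "Measurable.pred G (E c)" for c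
  proof -
    have "{w\<in>space G. \<exists>q\<in>\<rat>. c < X (max (s w) q) w} = (\<Union>q\<in>\<rat>. {w\<in>space G. c < X (max (s w) q) w})" by blast
    also have "... \<in> sets G"
    proof (intro sets.countable_UN'' countable_rat)
      fix q :: real
      show "{w\<in>space G. c < X (max (s w) q) w} \<in> sets G" using Xq[of q] by measurable
    qed
    also have "{w\<in>space G. \<exists>q\<in>\<rat>. c < X (max (s w) q) w} = {w\<in>space G. E c w}"
    proof (intro Collect_cong conj_cong refl)
      fix w assume "w \<in> space G"
      then have "w \<in> space M" by (simp add: G(1))
      from ex_later_greater_iff[OF this s[OF this], of c]
      show "(\<exists>q\<in>\<rat>. c < X (max (s w) q) w) = E c w" unfolding E_def by (rule sym)
    qed
    finally show ?thesis by (simp add: Measurable.pred_def)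
  qed
  note [measurable] = E
  have unbdd: "\<not> bdd_above ((\<lambda>t. X t w) ` {s w..}) \<longleftrightarrow> (\<forall>n::nat. E (real n) w)" for w
  proof
    assume n: "\<not> bdd_above ((\<lambda>t. X t w) ` {s w..})"
    show "\<forall>n::nat. E (real n) w"
    proof
      fix n :: nat
      have "\<not> (\<forall>x\<in>(\<lambda>t. X t w) ` {s w..}. x \<le> real n)" using n unfolding bdd_above_def by blast
      then show "E (real n) w" unfolding E_def by (auto simp: not_le)
    qed
  next
    assume n: "\<forall>n::nat. E (real n) w"
    show "\<not> bdd_above ((\<lambda>t. X t w) ` {s w..})"
    proof
      assume "bdd_above ((\<lambda>t. X t w) ` {s w..})"
      then obtain b where b: "\<And>t. t \<in> {s w..} \<Longrightarrow> X t w \<le> b" unfolding bdd_above_def by blast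
      obtain n :: nat where "b \<le> n" using real_arch_simple by blast
      moreover obtain t where "t \<in> {s w..}" "real n < X t w" using n unfolding E_def by blast
      ultimately show False using b[of t] by linarith
    qed
  qed
  txt \<open>\<open>supafter\<close> must be measurable also on the null event where \<open>X\<close> never hits \<open>0\<close>: there the supremum
    may be over an empty or an unbounded set, with the fixed junk values \<open>c1\<close> and \<open>c0\<close>.\<close>
  define c0 :: real where "c0 = (LEAST z. False)"
  define c1 :: real where "c1 = Sup {}"
  have eq: "a < supafter X \<tau> w \<longleftrightarrow> (if \<tau> w = \<infinity> then a < c1 else if \<forall>n::nat. E (real n) w then a < c0 else E a w)"
    if w: "w \<in> space G" for w a
  proof (cases "\<tau> w = \<infinity>")
    case True
    then show ?thesis by (simp add: supafter_def c1_def)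
  next
    case False
    have wM: "w \<in> space M" using w G(1) by simp
    have b: "0 \<le> \<tau> w" "\<tau> w \<le> hit0 X w" using admissible_bounds[OF \<tau> wM] by auto
    have \<tau>s: "\<tau> w = ereal (s w)" using False b(1) by (cases "\<tau> w") (auto simp: s_def)
    have sup: "supafter X \<tau> w = Sup ((\<lambda>t. X t w) ` {s w..})"
      by (rule supafter_eq[where \<tau>=\<tau>, OF wM \<tau>s s[OF wM] b(2)])
    show ?thesis
    proof (cases "bdd_above ((\<lambda>t. X t w) ` {s w..})")
      case True
      then have "a < Sup ((\<lambda>t. X t w) ` {s w..}) \<longleftrightarrow> E a w"
        by (subst less_cSup_iff) (auto simp: E_def)
      with True unbdd[of w] False sup show ?thesis by auto
    next
      case unb: False
      then have "\<not> (\<forall>x\<in>(\<lambda>t. X t w) ` {s w..}. x \<le> z)" for z unfolding bdd_above_def by blast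
      then have "Sup ((\<lambda>t. X t w) ` {s w..}) = c0" unfolding Sup_real_def c0_def by (simp only:)
      with unb unbdd[of w] False sup show ?thesis by simp
    qed
  qed
  show ?thesis
    unfolding borel_measurable_iff_greater
  proof
    fix a
    have "{w\<in>space G. a < supafter X \<tau> w} = {w\<in>space G. if \<tau> w = \<infinity> then a < c1 else if \<forall>n::nat. E (real n) w then a < c0 else E a w}"
      using eq by blast
    also have "... \<in> sets G" by measurable
    finally show "{w\<in>space G. a < supafter X \<tau> w} \<in> sets G" .
  qed
qed

text \<open>Let \<open>\<rho>\<close> be the first time from \<open>\<sigma>\<close> on outside (0,
  m). If the stopped value is at least m, then \<open>\<rho>\<close> equals \<open>\<sigma>\<close>;
  otherwise the value at \<open>\<rho>\<close> is m or 0 according to whether the later maximum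
  reaches m. The difference of the stopped values is at most m in absolute value at every horizon,
  so it has expectation 0.\<close>

lemma prob_supafter_ge:
  assumes \<sigma>: "admissible M X \<sigma>" and m: "0 < m"
  shows "m * prob {w\<in>space M. stopval X \<sigma> w < m \<and> m \<le> supafter X \<sigma> w} =
    (\<integral>w. stopval X \<sigma> w * indicator {w\<in>space M. stopval X \<sigma> w < m} w \<partial>M)"
proof -
  let ?A = "{w\<in>space M. stopval X \<sigma> w < m \<and> m \<le> supafter X \<sigma> w}" and ?B = "{w\<in>space M. stopval X \<sigma> w < m}"
  define g where "g x = min x (m - x)" for x :: real
  have g: "continuous_on UNIV g" unfolding g_def[abs_def] by (intro continuous_intros)
  define \<rho> where "\<rho> = debut \<sigma> g"
  have \<rho>: "admissible M X \<rho>"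
    unfolding \<rho>_def using m by (intro debut_admissible[OF g \<sigma>]) (simp add: g_def)
  have [measurable]: "stopval X \<sigma> \<in> borel_measurable M" "supafter X \<sigma> \<in> borel_measurable M"
    by (rule stopval_measurable[OF \<sigma>], rule supafter_measurable_sub[OF \<sigma>], auto)
  have ge: "\<sigma> w \<le> \<rho> w" for w
    unfolding \<rho>_def debut_def first_time_def by (rule Inf_greatest) auto
  have before: "0 < X t w \<and> X t w < m" if "w \<in> space M" "0 \<le> t" "\<sigma> w \<le> ereal t" "ereal t < \<rho> w" for w t
  proof -
    have "\<not> g (X t w) \<le> 0"
    proof
      assume "g (X t w) \<le> 0"
      then have "\<rho> w \<le> ereal t" unfolding \<rho>_def debut_def using that by (intro first_time_leI[of t]) auto
      with that(4) show False by simp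
    qed
    then show ?thesis by (auto simp: g_def)
  qed
  \<comment> \<open>A continuous path starting below m cannot leave (0, m) by jumping over
    m.\<close>
  have at: "X r w \<in> {0..m}" if w: "w \<in> space M" and s: "\<sigma> w = ereal s" and r: "\<rho> w = ereal r"
    and less: "X s w < m" for w s r
  proof -
    have sr: "0 \<le> s" "s \<le> r" using ge[of w] s r admissible_bounds[OF \<sigma> w] by auto
    have "X r w \<le> m"
    proof (cases "s = r")
      case False
      with sr have "s < r" by simp
      show ?thesis
      proof (rule ccontr)
        assume "\<not> X r w \<le> m"
        \<comment> \<open>The chosen level lies strictly between m and the value at
          \<open>r\<close>, so the path takes it before \<open>r\<close>, although it should still
          be below m then.\<close>
        then have "\<exists>t\<ge>s. t \<le> r \<and> X t w = (m + min (X r w) (m + 1)) / 2"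
          using sr less continuous_on_subset[OF X_cont[OF w], of "{s..r}"]
          by (intro IVT') auto
        then obtain t where t: "s \<le> t" "t \<le> r" "X t w = (m + min (X r w) (m + 1)) / 2" by blast
        have "X t w > m" "X t w < X r w" 
          using \<open>\<not> X r w \<le> m\<close> t(3) unfolding min_def by (auto split: if_splits)
        then have "t < r" using t(2) by (cases "t = r") auto
        then have "X t w < m" using before[OF w, of t] t sr s r by auto
        with \<open>X t w > m\<close> show False by simp
      qed
    qed (use less in auto)
    then show ?thesis using X_nonneg[OF w, of r] sr by auto
  qed
  have bound: "\<bar>stopped \<rho> T w - stopped \<sigma> T w\<bar> \<le> m"
    if w: "w \<in> space M" for w and T :: nat
  proof (cases "\<sigma> w \<le> ereal T")
    case False
    then have "min (\<sigma> w) (ereal T) = ereal T" "min (\<rho> w) (ereal T) = ereal T"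
      using ge[of w] by (auto simp: min_def)
    then show ?thesis using m by (simp add: stopval_def)
  next
    case True
    then obtain s where s: "\<sigma> w = ereal s" "0 \<le> s" using admissible_bounds[OF \<sigma> w] by (cases "\<sigma> w") auto
    have Ys: "stopped \<sigma> T w = X s w" using True s by (simp add: stopval_def min_def)
    show ?thesis
    proof (cases "X s w < m")
      case False
      then have "\<rho> w \<le> ereal s"
        unfolding \<rho>_def debut_def using s by (intro first_time_leI[of s]) (auto simp: g_def)
      then have "\<rho> w = \<sigma> w" using ge[of w] s by (simp add: antisym)
      then show ?thesis using m by (simp add: stopval_def)
    next
      case less: True
      have "stopped \<rho> T w \<in> {0..m}"
      proof (cases "\<rho> w \<le> ereal T")
        case True
        moreover have "0 \<le> \<rho> w" using admissible_bounds[OF \<rho> w] by simp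
        ultimately obtain r where r: "\<rho> w = ereal r" by (cases "\<rho> w") auto
        have "stopped \<rho> T w = X r w" using True r by (simp add: stopval_def min_def)
        with at[OF w s(1) r less] show ?thesis by simp
      next
        case False
        then have "stopped \<rho> T w = X T w" by (simp add: stopval_def min_def)
        moreover have "0 < X T w \<and> X T w < m" using before[OF w, of T] \<open>\<sigma> w \<le> ereal T\<close> False by auto
        ultimately show ?thesis by simp
      qed
      moreover have "0 \<le> X s w" using X_nonneg[OF w s(2)] .
      ultimately show ?thesis using less unfolding Ys by auto
    qed
  qed
  have "(\<integral>w. stopval X \<rho> w - stopval X \<sigma> w \<partial>M) = 0"
    by (rule optional_stopping_diff[OF \<sigma> \<rho> bound])
  moreover have "(\<integral>w. stopval X \<rho> w - stopval X \<sigma> w \<partial>M) =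
      (\<integral>w. m * indicator ?A w -
        stopval X \<sigma> w * indicator ?B w \<partial>M)"
  proof (rule integral_cong_AE)
    show "AE w in M. stopval X \<rho> w - stopval X \<sigma> w =
        m * indicator ?A w -
        stopval X \<sigma> w * indicator ?B w"
      using hit0_finite AE_space
    proof eventually_elim
      case (elim w)
      then have w: "w \<in> space M" by simp
      obtain h where h: "hit0 X w = ereal h" using elim hit0_nonneg[of X w] by (cases "hit0 X w") auto
      have Xh: "0 \<le> h" "X h w = 0" using hit0_real[OF w h] by auto
      obtain s where s: "\<sigma> w = ereal s" "0 \<le> s" "s \<le> h"
        using admissible_bounds[OF \<sigma> w] h by (cases "\<sigma> w") auto
      obtain r where r: "\<rho> w = ereal r" "0 \<le> r" "r \<le> h"
        using admissible_bounds[OF \<rho> w] h by (cases "\<rho> w") auto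
      have sr: "s \<le> r" using ge[of w] s r by simp
      have val: "stopval X \<sigma> w = X s w" "stopval X \<rho> w = X r w" using s r by (auto simp: stopval_def)
      have sup: "supafter X \<sigma> w = Sup ((\<lambda>t. X t w) ` {s..})"
        by (rule supafter_eq[where \<tau>=\<sigma>, OF w s(1,2)]) (use s h in simp)
      show ?case
      proof (cases "X s w < m")
        case False
        then have "\<rho> w \<le> ereal s"
          unfolding \<rho>_def debut_def using s by (intro first_time_leI[of s]) (auto simp: g_def)
        then have "s = r" using sr r by simp
        with False show ?thesis by (simp add: val indicator_def)
      next
        case True
        have rng: "X r w \<in> {0..m}" by (rule at[OF w s(1) r(1) True])
        have "g (X r w) \<le> 0" using debut_attained(3)[OF g w, of \<sigma> r] r(1) by (simp add: \<rho>_def)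
        then have cases: "X r w = 0 \<or> X r w = m" using rng by (auto simp: g_def min_def split: if_splits)
        have comp: "(\<lambda>t. X t w) ` {s..} = (\<lambda>t. X t w) ` {s..h}"
        proof (intro equalityI subsetI)
          fix x assume "x \<in> (\<lambda>t. X t w) ` {s..}"
          then obtain t where t: "s \<le> t" "x = X t w" by auto
          show "x \<in> (\<lambda>t. X t w) ` {s..h}"
          proof (cases "t \<le> h")
            case False
            then have "X t w = X h w" using X_zero_iff[OF w, of t] t s h Xh by simp
            then show ?thesis using t s by auto
          qed (use t in auto)
        qed auto
        \<comment> \<open>On the compact interval up to absorption the supremum is attained, so a
          later maximum of at least m means that the path really reaches m before being absorbed,
          and \<open>\<rho>\<close> stops it there.\<close>
        have iff: "m \<le> supafter X \<sigma> w \<longleftrightarrow> X r w = m"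
        proof
          assume mle: "m \<le> supafter X \<sigma> w"
          obtain t where t: "t \<in> {s..h}" "\<And>u. u \<in> {s..h} \<Longrightarrow> X u w \<le> X t w"
            using continuous_attains_sup[of "{s..h}" "\<lambda>t. X t w"] continuous_on_subset[OF X_cont[OF w], of "{s..h}"] s
            by auto
          have "supafter X \<sigma> w \<le> X t w" unfolding sup comp using t s by (intro cSup_least) auto
          then have mt: "m \<le> X t w" using mle by simp
          show "X r w = m"
          proof (rule ccontr)
            assume "X r w \<noteq> m"
            then have "X r w = 0" using cases by simp
            then have "h \<le> r" using X_zero_iff[OF w r(2)] h by simp
            have "\<rho> w \<le> ereal t"
              unfolding \<rho>_def debut_def using s t(1) mt by (intro first_time_leI[of t]) (auto simp: g_def)
            then have "t = h" using r(1) t(1) \<open>h \<le> r\<close> by simp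
            then show False using mt Xh m by simp
          qed
        next
          assume "X r w = m"
          have "bdd_above ((\<lambda>t. X t w) ` {s..h})"
            using continuous_on_subset[OF X_cont[OF w], of "{s..h}"] s
            by (intro bounded_imp_bdd_above compact_imp_bounded compact_continuous_image) auto
          then have "X r w \<le> Sup ((\<lambda>t. X t w) ` {s..h})"
            using sr r by (intro cSup_upper) auto
          with \<open>X r w = m\<close> show "m \<le> supafter X \<sigma> w" unfolding sup comp by simp
        qed
        show ?thesis using True iff cases m w by (auto simp: val indicator_def)
      qed
    qed
  qed (use stopval_measurable[OF \<rho>] in measurable)
  moreover have "integrable M (\<lambda>w. stopval X \<sigma> w * indicator ?B w)"
    using stopval_expectation_le(1)[OF \<sigma>] by (intro integrable_mult_indicator[where 'b=real, simplified mult.commute real_scaleR_def]) auto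
  moreover have "integrable M (\<lambda>w. m * indicator ?A w)"
    by (intro integrable_mult_right integrable_real_indicator) (auto simp: less_top[symmetric])
  moreover have "(\<integral>w. m * indicator ?A w \<partial>M) =
      m * prob ?A"
    by simp
  ultimately show ?thesis by (simp only: Bochner_Integration.integral_diff)
qed

end

section \<open>The reverse Azema-Yor embedding of the power law\<close>

text \<open>Here d is N - 1 and the ratio of the geometric grid is the m-th root of c. These are the
  m-fold products of the upper and lower one-step factors of the next lemma; the common limit closes
  the squeeze.\<close>

lemma power_grid_limits:
  fixes d c :: real
  assumes "d > 0" "0 < c" "c < 1"
  shows "(\<lambda>m::nat. (d / (d + 1 - c powr (1 / m))) ^ m) \<longlonglongrightarrow> c powr (1 / d)"
    "(\<lambda>m::nat. (((d + 1) * c powr (1 / m) - 1) / (d * c powr (1 / m))) ^ m) \<longlonglongrightarrow> c powr (1 / d)"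
    "\<forall>\<^sub>F m::nat in sequentially. (d + 1) * c powr (1 / m) > 1"
proof -
  show "(\<lambda>m::nat. (d / (d + 1 - c powr (1 / m))) ^ m) \<longlonglongrightarrow> c powr (1 / d)"
    using assms by real_asymp (simp add: powr_def field_simps)
  show "(\<lambda>m::nat. (((d + 1) * c powr (1 / m) - 1) / (d * c powr (1 / m))) ^ m) \<longlonglongrightarrow> c powr (1 / d)"
    using assms by real_asymp (simp add: powr_def field_simps)
  show "\<forall>\<^sub>F m::nat in sequentially. (d + 1) * c powr (1 / m) > 1"
    using assms by real_asymp
qed

text \<open>Taking y' = r y confines p(r y) / p(y) between (N r - 1)/((N - 1) r) and (N - 1)/(N -
  r), which agree to first order in 1 - r. Going from x0 to c x0 in m geometric steps and letting m
  grow determines p without any differentiability.\<close>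

lemma power_law_of_increment_bounds:
  fixes p :: "real \<Rightarrow> real"
  assumes N: "N > 1" and x0: "x0 > 0" and p1: "p x0 = 1" and nn: "\<And>y. 0 \<le> p y"
    and lo: "\<And>y y'. 0 < y' \<Longrightarrow> y' < y \<Longrightarrow> y \<le> x0 \<Longrightarrow> (N * y' - y) * (p y - p y') \<le> (y - y') * p y'"
    and up: "\<And>y y'. 0 < y' \<Longrightarrow> y' < y \<Longrightarrow> y \<le> x0 \<Longrightarrow> (y - y') * p y' \<le> (N - 1) * y * (p y - p y')"
    and c: "0 < c" "c \<le> 1"
  shows "p (c * x0) = c powr (1 / (N - 1))"
proof (cases "c = 1")
  case True
  then show ?thesis using p1 by simp
next
  case False
  with c have c: "0 < c" "c < 1" by auto
  have step: "p (x0 * r ^ Suc k) \<le> (N - 1) / (N - r) * p (x0 * r ^ k)"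
    "N * r > 1 \<Longrightarrow> (N * r - 1) / ((N - 1) * r) * p (x0 * r ^ k) \<le> p (x0 * r ^ Suc k)"
    if r: "0 < r" "r < 1" for r k
  proof -
    define y where "y = x0 * r ^ k"
    have y: "0 < y" "y \<le> x0" "r * y < y" "0 < r * y" using x0 r by (auto simp: y_def power_le_one)
    have y': "x0 * r ^ Suc k = r * y" by (simp add: y_def)
    have "y * ((N - r) * p (r * y)) \<le> y * ((N - 1) * p y)"
      using up[OF y(4,3,2)] by (simp add: algebra_simps)
    then have "(N - r) * p (r * y) \<le> (N - 1) * p y" using y(1) by simp
    then show "p (x0 * r ^ Suc k) \<le> (N - 1) / (N - r) * p (x0 * r ^ k)"
      using N r unfolding y' y_def[symmetric] by (simp add: field_simps)
    assume "N * r > 1"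
    have "y * ((N * r - 1) * p y) \<le> y * ((N - 1) * r * p (r * y))"
      using lo[OF y(4,3,2)] by (simp add: algebra_simps)
    then have "(N * r - 1) * p y \<le> (N - 1) * r * p (r * y)" using y(1) by simp
    then show "(N * r - 1) / ((N - 1) * r) * p (x0 * r ^ k) \<le> p (x0 * r ^ Suc k)"
      using N r unfolding y' y_def[symmetric] by (simp add: pos_divide_le_eq mult.commute)
  qed
  have upper: "p (x0 * r ^ k) \<le> ((N - 1) / (N - r)) ^ k" if r: "0 < r" "r < 1" for r k
  proof (induction k)
    case (Suc k)
    have "p (x0 * r ^ Suc k) \<le> (N - 1) / (N - r) * p (x0 * r ^ k)" by (rule step(1)[OF r])
    also have "... \<le> (N - 1) / (N - r) * ((N - 1) / (N - r)) ^ k"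
      using Suc N r by (intro mult_left_mono) auto
    finally show ?case by simp
  qed (simp add: p1)
  have lower: "((N * r - 1) / ((N - 1) * r)) ^ k \<le> p (x0 * r ^ k)" if r: "0 < r" "r < 1" "N * r > 1" for r k
  proof (induction k)
    case (Suc k)
    have "(N * r - 1) / ((N - 1) * r) * ((N * r - 1) / ((N - 1) * r)) ^ k \<le> (N * r - 1) / ((N - 1) * r) * p (x0 * r ^ k)"
      using Suc N r by (intro mult_left_mono) auto
    also have "... \<le> p (x0 * r ^ Suc k)" by (rule step(2)[OF r(1,2,3)])
    finally show ?case by simp
  qed (simp add: p1)
  have rm: "0 < c powr (1 / real m)" "c powr (1 / real m) < 1" "x0 * (c powr (1 / real m)) ^ m = c * x0"
    if "m > 0" for m :: nat
  proof -
    show "0 < c powr (1 / real m)" using c by simp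
    show "c powr (1 / real m) < 1" using c that powr_less_mono2[of "1 / real m" c 1] by simp
    have "(c powr (1 / real m)) ^ m = c powr (1 / real m * real m)"
      using c by (subst powr_powr[symmetric]) (simp add: powr_realpow)
    then show "x0 * (c powr (1 / real m)) ^ m = c * x0" using that c by simp
  qed
  have "(\<lambda>m::nat. ((N - 1) / (N - c powr (1 / m))) ^ m) \<longlonglongrightarrow> c powr (1 / (N - 1))"
    using power_grid_limits(1)[of "N - 1" c] N c by simp
  moreover have "\<forall>\<^sub>F m::nat in sequentially. p (c * x0) \<le> ((N - 1) / (N - c powr (1 / m))) ^ m"
    using eventually_gt_at_top[of 0]
  proof eventually_elim
    case (elim m)
    from upper[OF rm(1,2)[OF elim], of m] show ?case unfolding rm(3)[OF elim] .
  qed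
  ultimately have le: "p (c * x0) \<le> c powr (1 / (N - 1))"
    by (rule tendsto_lowerbound) simp
  have "(\<lambda>m::nat. ((N * c powr (1 / m) - 1) / ((N - 1) * c powr (1 / m))) ^ m) \<longlonglongrightarrow> c powr (1 / (N - 1))"
    using power_grid_limits(2)[of "N - 1" c] N c by simp
  moreover have "\<forall>\<^sub>F m::nat in sequentially. N * c powr (1 / m) > 1"
    using power_grid_limits(3)[of "N - 1" c] N c by simp
  then have "\<forall>\<^sub>F m::nat in sequentially. ((N * c powr (1 / m) - 1) / ((N - 1) * c powr (1 / m))) ^ m \<le> p (c * x0)"
    using eventually_gt_at_top[of 0]
  proof eventually_elim
    case (elim m)
    from lower[OF rm(1,2)[OF elim(2)] elim(1), of m] show ?case unfolding rm(3)[OF elim(2)] .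
  qed
  ultimately have ge: "c powr (1 / (N - 1)) \<le> p (c * x0)"
    by (rule tendsto_upperbound) simp
  from le ge show ?thesis by (rule antisym)
qed

section \<open>Stopping at a multiple of the running minimum\<close>

context brownian
begin

text \<open>The earlier time is written as \<open>a * s\<close> with \<open>a\<close> in the unit
  interval. The running minimum thus enters through an existential over a compact parameter set, and
  attainment and measurability both follow from joint continuity in \<open>a\<close> and
  \<open>s\<close>.\<close>

definition rise_time :: "real \<Rightarrow> 'a \<Rightarrow> ereal" where
  "rise_time N w = first_time (\<lambda>s. \<exists>a\<in>{0..1}. N * X (a * s) w - X s w \<le> 0)"

context
  fixes N :: real
  assumes N: "N > 1"
begin

lemma continuous_on_rise:
  assumes w: "w \<in> space M" and f: "continuous_on C f" "continuous_on C h" "\<And>z. z \<in> C \<Longrightarrow> 0 \<le> f z \<and> 0 \<le> h z"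
  shows "continuous_on C (\<lambda>z. N * X (f z) w - X (h z) w)"
  by (intro continuous_intros continuous_on_compose2[OF X_cont[OF w]]) (use f in auto)

lemma compact_rise:
  assumes w: "w \<in> space M"
  shows "compact {s. 0 \<le> s \<and> s \<le> t \<and> (\<exists>a\<in>{0..1}. N * X (a * s) w - X s w \<le> 0)}"
proof -
  let ?C = "{0..1::real} \<times> {0..t}"
  let ?f = "\<lambda>z. N * X (fst z * snd z) w - X (snd z) w"
  have "continuous_on ?C ?f"
    by (rule continuous_on_rise[OF w]) (auto intro!: continuous_intros)
  then have "closed (?C \<inter> ?f -` {..0})"
    by (intro continuous_closed_preimage closed_Times) auto
  moreover have "compact ?C" by (intro compact_Times compact_Icc)
  ultimately have "compact (?C \<inter> (?C \<inter> ?f -` {..0}))" by (rule compact_Int_closed[rotated])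
  then have "compact (snd ` (?C \<inter> (?C \<inter> ?f -` {..0})))"
    by (rule compact_continuous_image[rotated]) (auto intro!: continuous_intros)
  also have "snd ` (?C \<inter> (?C \<inter> ?f -` {..0})) = {s. 0 \<le> s \<and> s \<le> t \<and> (\<exists>a\<in>{0..1}. N * X (a * s) w - X s w \<le> 0)}"
    by force
  finally show ?thesis .
qed

lemma rise_time_le_iff:
  assumes w: "w \<in> space M"
  shows "rise_time N w \<le> ereal t \<longleftrightarrow> (\<exists>s. 0 \<le> s \<and> s \<le> t \<and> (\<exists>a\<in>{0..1}. N * X (a * s) w - X s w \<le> 0))"
  unfolding rise_time_def by (rule first_time_le_iff) (rule compact_rise[OF w])

text \<open>The argument of \<open>sets_debut\<close> with two parameters instead of one. At
  absorption the defining condition holds with \<open>a = 1\<close>, both values being 0, so this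
  time comes no later.\<close>

lemma rise_time_admissible: "admissible M X (rise_time N)"
proof (rule admissibleI)
  fix t :: real assume t: "0 \<le> t"
  let ?F = "nat_filt M X (ereal t)"
  let ?Q = "{s\<in>\<rat>. 0 \<le> s \<and> s \<le> (1::real)} \<union> {1}"
  let ?f = "\<lambda>w (a, b). N * X (a * (b * t)) w - X (b * t) w"
  have path: "rise_time N w \<le> ereal t \<longleftrightarrow> (\<forall>n::nat. \<exists>z\<in>?Q \<times> ?Q. ?f w z < 1 / Suc n)"
    if w: "w \<in> space M" for w
  proof -
    have "rise_time N w \<le> ereal t \<longleftrightarrow> (\<exists>z\<in>{0..1} \<times> {0..1}. ?f w z \<le> 0)"
    proof
      assume "rise_time N w \<le> ereal t"
      then obtain s a where s: "0 \<le> s" "s \<le> t" "a \<in> {0..1}" "N * X (a * s) w - X s w \<le> 0"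
        unfolding rise_time_le_iff[OF w] by blast
      \<comment> \<open>Rescaling the time by \<open>t\<close> moves both parameters into a fixed
        unit square; \<open>t = 0\<close> forces \<open>s = 0\<close>.\<close>
      define b where "b = (if t = 0 then 0 else s / t)"
      have "b * t = s" "b \<in> {0..1}" using s t by (auto simp: b_def divide_simps)
      then show "\<exists>z\<in>{0..1} \<times> {0..1}. ?f w z \<le> 0" using s by (intro bexI[of _ "(a, b)"]) auto
    next
      assume "\<exists>z\<in>{0..1} \<times> {0..1}. ?f w z \<le> 0"
      then obtain a b where ab: "a \<in> {0..1}" "b \<in> {0..1}" "N * X (a * (b * t)) w - X (b * t) w \<le> 0" by auto
      have "0 \<le> b * t" "b * t \<le> t" using ab t by (auto simp: mult_left_le_one_le)
      then show "rise_time N w \<le> ereal t" unfolding rise_time_le_iff[OF w] using ab by blast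
    qed
    also have "... \<longleftrightarrow> (\<forall>n::nat. \<exists>z\<in>?Q \<times> ?Q. ?f w z < 1 / Suc n)"
    proof (rule compact_ex_le_zero_iff)
      show "compact ({0..1::real} \<times> {0..1::real})" by (intro compact_Times compact_Icc)
      show "continuous_on ({0..1} \<times> {0..1}) (?f w)"
        unfolding case_prod_beta by (rule continuous_on_rise[OF w]) (use t in \<open>auto intro!: continuous_intros\<close>)
      show "?Q \<times> ?Q \<subseteq> {0..1} \<times> {0..1}" by auto
      show "{0..1} \<times> {0..1} \<subseteq> closure (?Q \<times> ?Q)"
        unfolding closure_Times by (intro Sigma_mono interval_subset_closure_rationals)
    qed
    finally show ?thesis .
  qed
  have "{w\<in>space M. rise_time N w \<le> ereal t} = (\<Inter>n::nat. \<Union>z\<in>?Q \<times> ?Q. {w\<in>space M. ?f w z < 1 / Suc n})"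
    unfolding set_eq_iff INT_iff UN_iff mem_Collect_eq using path by blast
  also have "... \<in> sets (?F)"
  proof (intro sets.countable_INT' image_subsetI sets.countable_UN'')
    show "countable (?Q \<times> ?Q)" by (intro countable_SIGMA) (auto intro: countable_subset[OF _ countable_rat])
    fix z :: "real \<times> real" and n :: nat assume "z \<in> ?Q \<times> ?Q"
    then obtain a b where z: "z = (a, b)" "0 \<le> a" "a \<le> 1" "0 \<le> b" "b \<le> 1" by auto
    have 1: "0 \<le> b * t" "b * t \<le> t" using z t by (auto simp: mult_left_le_one_le)
    have 2: "0 \<le> a * (b * t)" "a * (b * t) \<le> t"
      using z t 1 by (auto simp: mult_left_le_one_le intro: order_trans[of _ "b * t"])
    have [measurable]: "X (b * t) \<in> borel_measurable (?F)"
      "X (a * (b * t)) \<in> borel_measurable (?F)"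
      using 1 2 by (auto intro: X_nat_filt)
    have "{w\<in>space (?F). N * X (a * (b * t)) w - X (b * t) w < 1 / Suc n}
        \<in> sets (?F)" by measurable
    then show "{w\<in>space M. ?f w z < 1 / Suc n} \<in> sets (?F)" by (simp add: z)
  qed auto
  finally show "{w\<in>space M. rise_time N w \<le> ereal t} \<in> sets (?F)" .
next
  fix w assume w: "w \<in> space M"
  show "0 \<le> rise_time N w" unfolding rise_time_def by (rule first_time_nonneg)
  show "rise_time N w \<le> hit0 X w"
  proof (cases "hit0 X w")
    case (real h)
    with hit0_real[OF w real] show ?thesis
      unfolding rise_time_def by (intro first_time_leI[of h]) (auto intro!: bexI[of _ 1])
  qed (use hit0_nonneg[of X w] in auto)
qed

lemma before_rise_time:
  assumes w: "w \<in> space M" and s: "0 \<le> u" "u \<le> s" "ereal s < rise_time N w"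
  shows "X s w < N * X u w"
proof (rule ccontr)
  assume "\<not> X s w < N * X u w"
  then have le: "N * X u w - X s w \<le> 0" by simp
  define a where "a = (if s = 0 then 0 else u / s)"
  have a: "a * s = u" "a \<in> {0..1}" using s by (auto simp: a_def divide_simps)
  have "rise_time N w \<le> ereal s"
    unfolding rise_time_le_iff[OF w] using s a(2) le
    by (intro exI[of _ s] conjI bexI[of _ a]) (auto simp: a(1))
  with s show False by simp
qed

lemma upto_rise_time:
  assumes w: "w \<in> space M" and s: "0 \<le> u" "u \<le> s" "ereal s \<le> rise_time N w"
  shows "X s w \<le> N * X u w"
proof (cases "u = s")
  case True
  have "1 * X s w \<le> N * X s w" using N X_nonneg[OF w, of s] s by (intro mult_right_mono) auto
  then show ?thesis using True by simp
next
  case False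
  with s have us: "u < s" by simp
  show ?thesis
  proof (rule ccontr)
    assume "\<not> X s w \<le> N * X u w"
    then have gt: "0 < X s w - N * X u w" by simp
    have "\<forall>e>0. \<exists>d>0. \<forall>v\<in>{0..}. dist v s < d \<longrightarrow> dist (X v w) (X s w) < e"
      using X_cont[OF w] s unfolding continuous_on_iff by (auto simp: Ball_def)
    then obtain d where d: "d > 0" "\<forall>v\<in>{0..}. dist v s < d \<longrightarrow> dist (X v w) (X s w) < X s w - N * X u w"
      using gt by blast
    define v where "v = max u (s - d / 2)"
    have v: "u \<le> v" "v < s" "dist v s < d" "0 \<le> v" using us d(1) s by (auto simp: v_def dist_real_def)
    have "dist (X v w) (X s w) < X s w - N * X u w" using d(2) v by auto
    then have "N * X u w < X v w" unfolding dist_real_def by linarith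
    moreover have "ereal v < rise_time N w" using v s by (auto intro: less_le_trans[of _ "ereal s"])
    ultimately show False using before_rise_time[OF w s(1) v(1)] by simp
  qed
qed

text \<open>Up to the rise time the path is at most N times each of its earlier values. Equality at
  \<open>u\<close> therefore makes the value at \<open>u\<close> the minimum.\<close>

lemma rise_time_value:
  assumes w: "w \<in> space M" and \<tau>: "rise_time N w = ereal s"
  obtains u where "0 \<le> u" "u \<le> s" "X s w = N * X u w" "\<And>v. 0 \<le> v \<Longrightarrow> v \<le> s \<Longrightarrow> X u w \<le> X v w"
proof -
  have s: "0 \<le> s" "\<exists>a\<in>{0..1}. N * X (a * s) w - X s w \<le> 0"
    using first_time_attained[where P="\<lambda>s. \<exists>a\<in>{0..1}. N * X (a * s) w - X s w \<le> 0", OF compact_rise[OF w]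
      \<tau>[unfolded rise_time_def]] by auto
  then obtain a where a: "a \<in> {0..1}" "N * X (a * s) w - X s w \<le> 0" by auto
  have u: "0 \<le> a * s" "a * s \<le> s" using a s by (auto simp: mult_left_le_one_le)
  have le: "X s w \<le> N * X v w" if "0 \<le> v" "v \<le> s" for v
    using upto_rise_time[OF w that] \<tau> by simp
  have eq: "X s w = N * X (a * s) w" using le[OF u] a(2) by simp
  have "X (a * s) w \<le> X v w" if "0 \<le> v" "v \<le> s" for v
    using le[OF that] eq N by simp
  with u eq show ?thesis by (rule that)
qed

section \<open>First passage below a level and the law of the stopped value\<close>

definition drop_time :: "real \<Rightarrow> 'a \<Rightarrow> ereal" where
  "drop_time y = debut (\<lambda>_. 0) (\<lambda>x. x - y)"

lemma drop_time_admissible: "0 \<le> y \<Longrightarrow> admissible M X (drop_time y)"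
  unfolding drop_time_def by (rule debut_admissible) (auto intro!: continuous_intros admissible_zero)

abbreviation "rise_value \<equiv> stopval X (rise_time N)"

lemma rise_value_le:
  assumes w: "w \<in> space M" "hit0 X w < \<infinity>"
  shows "rise_value w \<le> N * x0"
proof -
  have b: "0 \<le> rise_time N w" "rise_time N w \<le> hit0 X w"
    using admissible_bounds[OF rise_time_admissible w(1)] by auto
  with w obtain s where s: "rise_time N w = ereal s" by (cases "rise_time N w") auto
  then have "X s w \<le> N * X 0 w" using b by (intro upto_rise_time[OF w(1)]) auto
  then show ?thesis using s X_0[OF w(1)] by (simp add: stopval_def)
qed

text \<open>The value at the rise time is N times the minimum so far. Hence it is at most
  \<open>N * y\<close> exactly when the path has come down to \<open>y\<close> by then, and in that
  case the minimum of the two times stops it at \<open>y\<close>.\<close>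

lemma rise_drop_value:
  assumes w: "w \<in> space M" "hit0 X w < \<infinity>" and y: "0 < y" "y \<le> x0"
  shows "stopval X (\<lambda>w. min (rise_time N w) (drop_time y w)) w =
    (if rise_value w \<le> N * y then y else rise_value w)"
proof -
  have g: "continuous_on UNIV (\<lambda>x. x - y)" by (intro continuous_intros)
  have b: "0 \<le> rise_time N w" "rise_time N w \<le> hit0 X w"
    using admissible_bounds[OF rise_time_admissible w(1)] by auto
  with w obtain s where s: "rise_time N w = ereal s" by (cases "rise_time N w") auto
  have bd: "0 \<le> drop_time y w" "drop_time y w \<le> hit0 X w"
    using admissible_bounds[OF drop_time_admissible w(1), of y] y by auto
  with w obtain k where k: "drop_time y w = ereal k" by (cases "drop_time y w") auto
  have k0: "0 \<le> k" "X k w \<le> y"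
    using debut_attained[OF g w(1), of "\<lambda>_. 0" k] k by (auto simp: drop_time_def)
  have first: "k \<le> t" if "0 \<le> t" "X t w \<le> y" for t
  proof -
    have "drop_time y w \<le> ereal t"
      unfolding drop_time_def debut_le_iff[OF g w(1)] using that by (intro exI[of _ t]) auto
    then show ?thesis using k by simp
  qed
  have Xk: "X k w = y"
  proof -
    have "\<exists>t\<ge>0. t \<le> k \<and> X t w = y"
      using k0 y X_0[OF w(1)] continuous_on_subset[OF X_cont[OF w(1)], of "{0..k}"]
      by (intro IVT2') auto
    then obtain t where t: "0 \<le> t" "t \<le> k" "X t w = y" by blast
    with first[of t] have "t = k" by simp
    with t show ?thesis by simp
  qed
  obtain u where u: "0 \<le> u" "u \<le> s" "X s w = N * X u w" "\<And>v. 0 \<le> v \<Longrightarrow> v \<le> s \<Longrightarrow> X u w \<le> X v w"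
    using rise_time_value[OF w(1) s] by blast
  have val: "rise_value w = X s w" using s by (simp add: stopval_def)
  show ?thesis
  proof (cases "X s w \<le> N * y")
    case True
    then have "X u w \<le> y" using u(3) N by simp
    then have "k \<le> s" using first[OF u(1)] u(2) by simp
    then have "min (rise_time N w) (drop_time y w) = ereal k" using s k by (simp add: min_def)
    then show ?thesis using True val Xk by (simp add: stopval_def)
  next
    case False
    then have "y < X u w" using u(3) N by simp
    have "s < k"
    proof (rule ccontr)
      assume "\<not> s < k"
      then have "X u w \<le> X k w" using u(4)[of k] k0 by simp
      with \<open>y < X u w\<close> Xk show False by simp
    qed
    then have "min (rise_time N w) (drop_time y w) = ereal s" using s k by (simp add: min_def)
    then show ?thesis using False val by (simp add: stopval_def)
  qed
qed

text \<open>Up to the rise time the path stays below N times its starting point, so the stopped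
  values are bounded and can be compared with stopping at time 0.\<close>

lemma rise_drop_expectation:
  assumes y: "0 < y" "y \<le> x0"
  shows "(\<integral>w. (if rise_value w \<le> N * y then y else rise_value w) - x0 \<partial>M) = 0"
proof -
  let ?\<rho> = "\<lambda>w. min (rise_time N w) (drop_time y w)"
  have \<rho>: "admissible M X ?\<rho>"
    using y by (intro admissible_min rise_time_admissible drop_time_admissible) simp
  note [measurable] = stopval_measurable[OF \<rho>] stopval_measurable[OF rise_time_admissible]
    stopval_measurable[OF admissible_zero]
  have "(\<integral>w. stopval X ?\<rho> w - stopval X (\<lambda>_. 0) w \<partial>M) = 0"
  proof (rule optional_stopping_diff[OF admissible_zero \<rho>])
    fix w and T :: nat assume w: "w \<in> space M"
    let ?r = "min (?\<rho> w) (ereal T)"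
    have "0 \<le> ?r" "?r \<le> ereal T" "?r \<le> rise_time N w"
      using admissible_bounds[OF \<rho> w] by (auto simp: min_le_iff_disj)
    then obtain r where r: "?r = ereal r" "0 \<le> r" by (cases ?r) auto
    have "X r w \<le> N * X 0 w" using r \<open>?r \<le> rise_time N w\<close> by (intro upto_rise_time[OF w]) auto
    then have "X r w \<le> N * x0" using X_0[OF w] by simp
    moreover have "0 \<le> X r w" using X_nonneg[OF w r(2)] .
    moreover have "1 * x0 \<le> N * x0" using N x0_pos by (intro mult_right_mono) auto
    moreover have "stopped ?\<rho> T w = X r w" using r by (simp add: stopval_def)
    moreover have "stopped (\<lambda>_. 0) T w = x0"
      using X_0[OF w] by (simp add: stopval_def zero_ereal_def min_def)
    ultimately show "\<bar>stopped ?\<rho> T w - stopped (\<lambda>_. 0) T w\<bar> \<le> N * x0"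
      using x0_pos by linarith
  qed
  also have "(\<integral>w. stopval X ?\<rho> w - stopval X (\<lambda>_. 0) w \<partial>M) =
      (\<integral>w. (if rise_value w \<le> N * y then y else rise_value w) - x0 \<partial>M)"
  proof (rule integral_cong_AE)
    show "AE w in M. stopval X ?\<rho> w - stopval X (\<lambda>_. 0) w = (if rise_value w \<le> N * y then y else rise_value w) - x0"
      using hit0_finite AE_space
    proof eventually_elim
      case (elim w)
      have "stopval X (\<lambda>_. 0) w = x0" using X_0 elim by (simp add: stopval_def)
      then show ?case using rise_drop_value[OF elim(2,1) y] by simp
    qed
  qed measurable
  finally show ?thesis .
qed

text \<open>Compare the expectation identity at \<open>y\<close> and at a smaller \<open>y'\<close>.
  The integrands differ by y - y' where the rise value is at most N y', agree where it exceeds N y,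
  and in between differ by y minus the rise value, which lies between y - N y and y - N y'. The two
  extremes yield the two increment bounds.\<close>

lemma rise_value_prob:
  assumes c: "0 < c" "c \<le> 1"
  shows "prob {w\<in>space M. rise_value w \<le> N * (c * x0)} = c powr (1 / (N - 1))"
proof -
  define p where "p y = prob {w\<in>space M. rise_value w \<le> N * y}" for y
  note [measurable] = stopval_measurable[OF rise_time_admissible]
  let ?V = "\<lambda>y w. if rise_value w \<le> N * y then y else rise_value w"
  let ?I = "\<lambda>y. indicator {w\<in>space M. rise_value w \<le> N * y} :: 'a \<Rightarrow> real"
  have int: "integrable M (?V y)" if "0 < y" "y \<le> x0" for y
  proof (rule integrable_const_bound[where B="x0 + N * x0"])
    show "AE w in M. norm (?V y w) \<le> x0 + N * x0"
      using hit0_finite AE_space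
    proof eventually_elim
      case (elim w)
      have "0 \<le> N * x0" using N x0_pos by simp
      then show ?case
        using rise_value_le[OF elim(2,1)] stopval_nonneg[OF rise_time_admissible elim(2)] that by auto
    qed
  qed measurable
  have EV: "(\<integral>w. ?V y w \<partial>M) = x0" if "0 < y" "y \<le> x0" for y
    using rise_drop_expectation[OF that] int[OF that] by (simp add: prob_space)
  have intI: "integrable M (?I y)" "(\<integral>w. ?I y w \<partial>M) = p y" for y
    by (auto simp: p_def intro!: integrable_real_indicator simp: less_top[symmetric])
  have "p (c * x0) = c powr (1 / (N - 1))"
  proof (rule power_law_of_increment_bounds[OF N x0_pos _ _ _ _ c])
    have "AE w in M. rise_value w \<le> N * x0"
      using hit0_finite AE_space by eventually_elim (rule rise_value_le)
    then show "p x0 = 1" unfolding p_def by (subst prob_Collect_eq_1) auto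
    show "0 \<le> p y" for y by (simp add: p_def)
    fix y y' assume y: "0 < y'" "y' < y" "y \<le> x0"
    have yy: "0 < y" "y' \<le> x0" using y by auto
    have Ny: "N * y' < N * y" using y N by simp
    have 0: "(\<integral>w. ?V y w - ?V y' w \<partial>M) = 0"
      using EV[OF yy(1) y(3)] EV[OF y(1) yy(2)] int[OF yy(1) y(3)] int[OF y(1) yy(2)] by simp
    \<comment> \<open>The number \<open>b\<close> stands in for y minus the rise value between the
      two levels: y - N y' for the upper estimate, y - N y for the lower one.\<close>
    have E: "(\<integral>w. (y - y') * ?I y' w + b * (?I y w - ?I y' w) \<partial>M) = (y - y') * p y' + b * (p y - p y')" for b
      using intI by simp
    have intE: "integrable M (\<lambda>w. (y - y') * ?I y' w + b * (?I y w - ?I y' w))" for b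
      using intI(1) by (intro Bochner_Integration.integrable_add integrable_mult_right Bochner_Integration.integrable_diff) auto
    have "(\<integral>w. ?V y w - ?V y' w \<partial>M) \<le> (\<integral>w. (y - y') * ?I y' w + (y - N * y') * (?I y w - ?I y' w) \<partial>M)"
      using int[OF yy(1) y(3)] int[OF y(1) yy(2)] Ny y
      by (intro integral_mono intE Bochner_Integration.integrable_diff) (auto simp: indicator_def)
    then show "(N * y' - y) * (p y - p y') \<le> (y - y') * p y'"
      unfolding E 0 by (simp add: algebra_simps)
    have "(\<integral>w. (y - y') * ?I y' w + (y - N * y) * (?I y w - ?I y' w) \<partial>M) \<le> (\<integral>w. ?V y w - ?V y' w \<partial>M)"
      using int[OF yy(1) y(3)] int[OF y(1) yy(2)] Ny y
      by (intro integral_mono intE Bochner_Integration.integrable_diff) (auto simp: indicator_def)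
    then show "(y - y') * p y' \<le> (N - 1) * y * (p y - p y')"
      unfolding E 0 by (simp add: algebra_simps)
  qed
  then show ?thesis by (simp add: p_def)
qed

lemma rise_value_law:
  "has_law M rise_value (\<lambda>x. if x < 0 then 0 else min ((x / (N * x0)) powr (1 / (N - 1))) 1)"
  unfolding has_law_def
proof (intro conjI allI)
  show [measurable]: "rise_value \<in> borel_measurable M" by (rule stopval_measurable[OF rise_time_admissible])
  fix x
  have B: "0 < N * x0" using N x0_pos by simp
  consider "x < 0" | "x = 0" | "0 < x" "x \<le> N * x0" | "N * x0 < x" by linarith
  then show "prob {w\<in>space M. rise_value w \<le> x} = (if x < 0 then 0 else min ((x / (N * x0)) powr (1 / (N - 1))) 1)"
  proof cases
    case 1
    then have "{w\<in>space M. rise_value w \<le> x} = {}"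
      using stopval_nonneg[OF rise_time_admissible] by force
    then have "prob {w\<in>space M. rise_value w \<le> x} = 0" by (simp only: measure_empty)
    then show ?thesis using 1 by simp
  next
    case 2
    \<comment> \<open>Mass at 0 is excluded by letting c run through 1/(n+1) in
      \<open>rise_value_prob\<close>.\<close>
    have "prob {w\<in>space M. rise_value w \<le> 0} \<le> 0"
    proof (rule LIMSEQ_le_const)
      show "(\<lambda>n. inverse (real (Suc n)) powr (1 / (N - 1))) \<longlonglongrightarrow> 0"
        using tendsto_powr'[OF LIMSEQ_inverse_real_of_nat tendsto_const, of "1 / (N - 1)"] N by simp
      show "\<exists>k. \<forall>n\<ge>k. prob {w\<in>space M. rise_value w \<le> 0} \<le> inverse (real (Suc n)) powr (1 / (N - 1))"
      proof (intro exI allI impI)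
        fix n :: nat
        have "0 < inverse (real (Suc n))" "inverse (real (Suc n)) \<le> 1" by (auto simp: inverse_le_1_iff)
        from rise_value_prob[OF this] have "prob {w\<in>space M. rise_value w \<le> N * (inverse (real (Suc n)) * x0)} =
            inverse (real (Suc n)) powr (1 / (N - 1))" .
        moreover have "0 \<le> N * (inverse (real (Suc n)) * x0)" using N x0_pos by simp
        then have "prob {w\<in>space M. rise_value w \<le> 0} \<le> prob {w\<in>space M. rise_value w \<le> N * (inverse (real (Suc n)) * x0)}"
          by (intro finite_measure_mono) (auto intro: order_trans)
        ultimately show "prob {w\<in>space M. rise_value w \<le> 0} \<le> inverse (real (Suc n)) powr (1 / (N - 1))" by simp
      qed
    qed
    then show ?thesis using 2 by (simp add: measure_le_0_iff)
  next
    case 3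
    have c: "0 < x / (N * x0)" "x / (N * x0) \<le> 1" using 3 B by auto
    moreover have "N * (x / (N * x0) * x0) = x" using B by auto
    moreover have "(x / (N * x0)) powr (1 / (N - 1)) \<le> 1" using c N by (intro powr_le1) auto
    ultimately show ?thesis using rise_value_prob[OF c] 3 by (simp add: min_def)
  next
    case 4
    have "AE w in M. rise_value w \<le> x"
      using hit0_finite AE_space
    proof eventually_elim
      case (elim w)
      then show ?case using rise_value_le[OF elim(2,1)] 4 by simp
    qed
    then have "prob {w\<in>space M. rise_value w \<le> x} = 1" by (subst prob_Collect_eq_1) auto
    moreover have "1 \<le> (x / (N * x0)) powr (1 / (N - 1))" using 4 B N by (intro ge_one_powr_ge_zero) auto
    ultimately show ?thesis using 4 B by simp
  qed
qed

end

end

section \<open>Power laws\<close>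

text \<open>One family for both laws on the same interval: exponent 1/(N-1) for a single player,
  exponent 1/(1+K) for the best of the opponents.\<close>

definition power_cdf :: "real \<Rightarrow> real \<Rightarrow> real \<Rightarrow> real" where
  "power_cdf a B x = (if x < 0 then 0 else min ((x / B) powr a) 1)"

definition power_density :: "real \<Rightarrow> real \<Rightarrow> real \<Rightarrow> real" where
  "power_density a B x = (if 0 < x \<and> x \<le> B then a / B powr a * x powr (a - 1) else 0)"

lemma power_density_nonneg: "0 < a \<Longrightarrow> 0 < B \<Longrightarrow> 0 \<le> power_density a B x"
  by (simp add: power_density_def)

lemma power_density_measurable [measurable]: "power_density a B \<in> borel_measurable borel"
  unfolding power_density_def[abs_def] by measurable

text \<open>Truncated moments: \<open>b = 0\<close> recovers the distribution function and
  \<open>b = 1\<close> the mean.\<close>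

lemma nn_integral_power_density:
  assumes "0 < a" "0 < B" "-1 < b + a - 1" "0 \<le> x" "x \<le> B"
  shows "(\<integral>\<^sup>+z. ennreal (power_density a B z * z powr b) * indicator {0..x} z \<partial>lborel) =
    ennreal (a / B powr a * (x powr (b + a) / (b + a)))"
proof -
  have "((\<lambda>z. a / B powr a * z powr (b + a - 1)) has_integral a / B powr a * (x powr (b + a - 1 + 1) / (b + a - 1 + 1))) {0..x}"
    by (intro has_integral_mult_right has_integral_powr_from_0) (use assms in auto)
  then have "((\<lambda>z. a / B powr a * z powr (b + a - 1)) has_integral a / B powr a * (x powr (b + a) / (b + a))) {0..x}"
    by simp
  then have "(\<integral>\<^sup>+z. ennreal (a / B powr a * z powr (b + a - 1)) * indicator {0..x} z \<partial>lborel) =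
      ennreal (a / B powr a * (x powr (b + a) / (b + a)))"
    using assms by (intro nn_integral_has_integral_lebesgue') auto
  moreover have "ennreal (power_density a B z * z powr b) * indicator {0..x} z =
      ennreal (a / B powr a * z powr (b + a - 1)) * indicator {0..x} z" for z
    using assms by (auto simp: power_density_def indicator_def powr_add[symmetric] algebra_simps)
  ultimately show ?thesis by simp
qed

lemma power_cdf_eq:
  assumes "0 < a" "0 < B" "0 \<le> x"
  shows "power_cdf a B x = (min x B / B) powr a"
proof (cases "x \<le> B")
  case True
  then have "(x / B) powr a \<le> 1" using assms by (intro powr_le1) auto
  then show ?thesis using True assms by (simp add: power_cdf_def min_def)
next
  case False
  then have "1 \<le> (x / B) powr a" using assms by (intro ge_one_powr_ge_zero) auto
  then show ?thesis using False assms by (simp add: power_cdf_def min_def)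
qed

lemma power_density_cdf:
  assumes a: "0 < a" and B: "0 < B"
  shows "emeasure (density lborel (power_density a B)) {..x} = ennreal (power_cdf a B x)"
proof -
  have "emeasure (density lborel (power_density a B)) {..x} =
      (\<integral>\<^sup>+z. ennreal (power_density a B z) * indicator {..x} z \<partial>lborel)"
    by (subst emeasure_density) auto
  also have "... = ennreal (power_cdf a B x)"
  proof (cases "x < 0")
    case True
    then have "ennreal (power_density a B z) * indicator {..x} z = 0" for z
      by (auto simp: power_density_def indicator_def)
    then have "(\<integral>\<^sup>+z. ennreal (power_density a B z) * indicator {..x} z \<partial>lborel) = (\<integral>\<^sup>+z. 0 \<partial>(lborel :: real measure))"
      by (intro nn_integral_cong)
    then show ?thesis using True by (simp add: power_cdf_def)
  next
    case False
    have "(\<integral>\<^sup>+z. ennreal (power_density a B z) * indicator {..x} z \<partial>lborel) =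
        (\<integral>\<^sup>+z. ennreal (power_density a B z * z powr 0) * indicator {0..min x B} z \<partial>lborel)"
      using False by (intro nn_integral_cong) (auto simp: power_density_def indicator_def)
    also have "... = ennreal (a / B powr a * (min x B powr (0 + a) / (0 + a)))"
      using a B False by (intro nn_integral_power_density) auto
    also have "a / B powr a * (min x B powr (0 + a) / (0 + a)) = power_cdf a B x"
      using a B False by (simp add: power_cdf_eq powr_divide)
    finally show ?thesis .
  qed
  finally show ?thesis .
qed

lemma power_cdf_bounds: "0 \<le> power_cdf a B x" "power_cdf a B x \<le> 1"
  by (auto simp: power_cdf_def)

context prob_space
begin

lemma power_law_distr:
  assumes a: "0 < a" and B: "0 < B" and law: "has_law M Z (power_cdf a B)"
  shows "distr M borel Z = density lborel (power_density a B)"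
proof (rule cdf_unique)
  have Z [measurable]: "Z \<in> borel_measurable M" using law by (simp add: has_law_def)
  show "real_distribution (distr M borel Z)" by (rule real_distribution_distr) simp
  have lim: "emeasure (density lborel (power_density a B)) UNIV = 1"
  proof -
    have "emeasure (density lborel (power_density a B)) UNIV = emeasure (density lborel (power_density a B)) {..B}"
      by (subst (1 2) emeasure_density) (auto intro!: nn_integral_cong simp: power_density_def indicator_def)
    also have "... = 1" using a B by (simp add: power_density_cdf power_cdf_eq)
    finally show ?thesis .
  qed
  show "real_distribution (density lborel (power_density a B))"
    by (intro real_distribution.intro prob_spaceI real_distribution_axioms.intro) (simp_all add: lim)
  show "cdf (distr M borel Z) = cdf (density lborel (power_density a B))"
  proof
    fix x
    have "cdf (distr M borel Z) x = prob {w\<in>space M. Z w \<le> x}"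
      unfolding cdf_def by (subst measure_distr) (auto simp: vimage_def Int_def conj_commute)
    also have "... = power_cdf a B x" using law by (simp add: has_law_def)
    also have "... = cdf (density lborel (power_density a B)) x"
      unfolding cdf_def measure_def power_density_cdf[OF a B] by (simp add: power_cdf_bounds)
    finally show "cdf (distr M borel Z) x = cdf (density lborel (power_density a B)) x" .
  qed
qed

lemma power_law_atomless:
  assumes "0 < a" "0 < B" "has_law M Z (power_cdf a B)"
  shows "prob {w\<in>space M. Z w = x} = 0"
proof -
  have [measurable]: "Z \<in> borel_measurable M" using assms by (simp add: has_law_def)
  have "emeasure M {w\<in>space M. Z w = x} = emeasure (distr M borel Z) {x}"
    by (subst emeasure_distr) (auto simp: vimage_def Int_def conj_commute)
  also have "... = 0"
    unfolding power_law_distr[OF assms]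
    by (subst emeasure_density) (auto intro!: nn_integral_0_iff_AE[THEN iffD2] AE_I[where N="{x}"] split: split_indicator_asm)
  finally show ?thesis by (simp add: emeasure_eq_measure)
qed

text \<open>This is the mean after rescaling the support to the unit interval. With a = 1/(N-1) it
  equals 1/N, the equilibrium payoff.\<close>

lemma power_law_expectation:
  assumes a: "0 < a" and B: "0 < B" and law: "has_law M Z (power_cdf a B)"
  shows "(\<integral>w. min (Z w / B) 1 \<partial>M) = a / (a + 1)"
proof -
  have Z [measurable]: "Z \<in> borel_measurable M" using law by (simp add: has_law_def)
  have neg: "AE w in M. 0 \<le> Z w"
  proof -
    have "AE z in distr M borel Z. 0 \<le> z"
      unfolding power_law_distr[OF a B law] by (subst AE_density) (auto simp: power_density_def)
    then show ?thesis by (subst (asm) AE_distr_iff) auto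
  qed
  have "(\<integral>\<^sup>+w. ennreal (min (Z w / B) 1) \<partial>M) = (\<integral>\<^sup>+z. ennreal (min (z / B) 1) \<partial>distr M borel Z)"
    by (subst nn_integral_distr) auto
  also have "... = (\<integral>\<^sup>+z. ennreal (power_density a B z) * ennreal (min (z / B) 1) \<partial>lborel)"
    unfolding power_law_distr[OF a B law] by (subst nn_integral_density) auto
  also have "... = (\<integral>\<^sup>+z. ennreal (1 / B) * (ennreal (power_density a B z * z powr 1) * indicator {0..B} z) \<partial>lborel)"
    using a B by (intro nn_integral_cong)
      (auto simp: power_density_def indicator_def ennreal_mult[symmetric] min_def field_simps)
  also have "... = ennreal (1 / B) * (\<integral>\<^sup>+z. ennreal (power_density a B z * z powr 1) * indicator {0..B} z \<partial>lborel)"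
    by (rule nn_integral_cmult) measurable
  also have "... = ennreal (1 / B) * ennreal (a / B powr a * (B powr (1 + a) / (1 + a)))"
    using a B by (subst nn_integral_power_density) auto
  also have "... = ennreal (a / (a + 1))"
    using a B by (simp add: ennreal_mult[symmetric] powr_add field_simps)
  finally have "(\<integral>\<^sup>+w. ennreal (min (Z w / B) 1) \<partial>M) = ennreal (a / (a + 1))" .
  moreover have "AE w in M. 0 \<le> min (Z w / B) 1" using neg by eventually_elim (use B in auto)
  ultimately show ?thesis using a by (subst integral_eq_nn_integral) auto
qed

text \<open>\<open>Y\<close> and \<open>S\<close>, a player's value and later maximum, depend on
  each other, so independence of \<open>Z\<close> has to be stated for the pair. The product formula
  on rectangles then identifies the joint law.\<close>

lemma pair_law_indep:
  assumes ind: "\<And>A C. A \<in> sets (borel \<Otimes>\<^sub>M borel) \<Longrightarrow> C \<in> sets borel \<Longrightarrow>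
      prob {w\<in>space M. (Y w, S w) \<in> A \<and> Z w \<in> C} = prob {w\<in>space M. (Y w, S w) \<in> A} * prob {w\<in>space M. Z w \<in> C}"
    and U [measurable]: "(\<lambda>w. (Y w, S w)) \<in> measurable M (borel \<Otimes>\<^sub>M borel)" and [measurable]: "Z \<in> borel_measurable M"
  shows "distr M (borel \<Otimes>\<^sub>M borel) (\<lambda>w. (Y w, S w)) \<Otimes>\<^sub>M distr M borel Z =
    distr M ((borel \<Otimes>\<^sub>M borel) \<Otimes>\<^sub>M borel) (\<lambda>w. ((Y w, S w), Z w))"
proof (rule pair_measure_eqI)
  let ?P = "distr M (borel \<Otimes>\<^sub>M borel) (\<lambda>w. (Y w, S w))" and ?Q = "distr M borel Z"
    and ?R = "distr M ((borel \<Otimes>\<^sub>M borel) \<Otimes>\<^sub>M borel) (\<lambda>w. ((Y w, S w), Z w))"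
  interpret P: prob_space ?P by (rule prob_space_distr) simp
  interpret Q: prob_space ?Q by (rule prob_space_distr) simp
  show "sigma_finite_measure (?P)" "sigma_finite_measure (?Q)" ..
  show "sets (?P \<Otimes>\<^sub>M ?Q) =
      sets (?R)"
    unfolding sets_distr by (rule sets_pair_measure_cong) simp_all
  fix A C assume "A \<in> sets (?P)" "C \<in> sets (?Q)"
  then have [measurable]: "A \<in> sets (borel \<Otimes>\<^sub>M borel)" "C \<in> sets borel" by simp_all
  have "emeasure (?P) A = ennreal (prob {w\<in>space M. (Y w, S w) \<in> A})"
    by (subst emeasure_distr) (auto simp: emeasure_eq_measure vimage_def Int_def conj_commute)
  moreover have "emeasure (?Q) C = ennreal (prob {w\<in>space M. Z w \<in> C})"
    by (subst emeasure_distr) (auto simp: emeasure_eq_measure vimage_def Int_def conj_commute)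
  moreover have "emeasure (?R) (A \<times> C) =
      ennreal (prob {w\<in>space M. (Y w, S w) \<in> A \<and> Z w \<in> C})"
    by (subst emeasure_distr) (auto simp: emeasure_eq_measure vimage_def Int_def conj_ac)
  ultimately show "emeasure (?P) A * emeasure (?Q) C =
      emeasure (?R) (A \<times> C)"
    by (simp add: ind ennreal_mult)
qed

lemma prob_le_indep:
  assumes ind: "\<And>A C. A \<in> sets (borel \<Otimes>\<^sub>M borel) \<Longrightarrow> C \<in> sets borel \<Longrightarrow>
      prob {w\<in>space M. (Y w, S w) \<in> A \<and> Z w \<in> C} = prob {w\<in>space M. (Y w, S w) \<in> A} * prob {w\<in>space M. Z w \<in> C}"
    and a: "0 < a" and B: "0 < B" and law: "has_law M Z (power_cdf a B)"
    and [measurable]: "Y \<in> borel_measurable M" "S \<in> borel_measurable M"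
  shows "prob {w\<in>space M. Z w \<le> Y w} = (\<integral>w. power_cdf a B (Y w) \<partial>M)"
    "AE w in M. Z w \<noteq> Y w \<and> Z w \<noteq> S w"
proof -
  have Z [measurable]: "Z \<in> borel_measurable M" using law by (simp add: has_law_def)
  let ?U = "\<lambda>w. (Y w, S w)"
  let ?P = "distr M (borel \<Otimes>\<^sub>M borel) ?U" and ?Q = "distr M borel Z"
  interpret Q: prob_space ?Q by (rule prob_space_distr) simp
  have pd: "?P \<Otimes>\<^sub>M ?Q = distr M ((borel \<Otimes>\<^sub>M borel) \<Otimes>\<^sub>M borel) (\<lambda>w. (?U w, Z w))"
    by (rule pair_law_indep[OF ind]) simp_all
  have sets_PQ: "sets (?P \<Otimes>\<^sub>M ?Q) = sets ((borel \<Otimes>\<^sub>M borel) \<Otimes>\<^sub>M borel)"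
    by (rule sets_pair_measure_cong) simp_all
  \<comment> \<open>Fubini for an arbitrary measurable relation, so that one computation serves both
    the comparison and the ties.\<close>
  have alt: "emeasure M {w\<in>space M. R (Y w, S w) (Z w)} = (\<integral>\<^sup>+w. emeasure M {w'\<in>space M. R (Y w, S w) (Z w')} \<partial>M)"
    if [measurable]: "Measurable.pred ((borel \<Otimes>\<^sub>M borel) \<Otimes>\<^sub>M borel) (\<lambda>x. R (fst x) (snd x))" for R :: "real \<times> real \<Rightarrow> real \<Rightarrow> bool"
  proof -
    let ?A = "{x\<in>space ((borel \<Otimes>\<^sub>M borel) \<Otimes>\<^sub>M borel). R (fst x) (snd x)}"
    have m: "?A \<in> sets (?P \<Otimes>\<^sub>M ?Q)"
      unfolding sets_PQ by (rule predE) measurable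
    have "emeasure M {w\<in>space M. R (Y w, S w) (Z w)} =
        emeasure (?P \<Otimes>\<^sub>M ?Q) ?A"
      unfolding pd using m[unfolded sets_PQ]
      by (subst emeasure_distr) (auto simp: space_pair_measure intro!: arg_cong[where f="emeasure M"])
    also have "... = (\<integral>\<^sup>+u. emeasure ?Q (Pair u -` ?A) \<partial>?P)"
      by (rule Q.emeasure_pair_measure_alt[OF m])
    also have "... = (\<integral>\<^sup>+u. emeasure ?Q {z. R u z} \<partial>?P)"
      by (intro nn_integral_cong arg_cong[where f="emeasure ?Q"]) (auto simp: space_pair_measure)
    also have "... = (\<integral>\<^sup>+w. emeasure ?Q {z. R (Y w, S w) z} \<partial>M)"
    proof (subst nn_integral_distr)
      show "(\<lambda>u. emeasure ?Q {z. R u z}) \<in> borel_measurable (distr M (borel \<Otimes>\<^sub>M borel) ?U)"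
        using Q.measurable_emeasure_Pair[OF m] by (simp add: space_pair_measure vimage_def)
    qed auto
    also have "... = (\<integral>\<^sup>+w. emeasure M {w'\<in>space M. R (Y w, S w) (Z w')} \<partial>M)"
    proof (intro nn_integral_cong)
      fix w
      have "Pair (Y w, S w) -` ?A \<in> sets borel"
        by (rule sets_Pair1) measurable
      then have "{z. R (Y w, S w) z} \<in> sets borel" by (simp add: space_pair_measure vimage_def)
      then show "emeasure ?Q {z. R (Y w, S w) z} = emeasure M {w'\<in>space M. R (Y w, S w) (Z w')}"
        by (subst emeasure_distr) (auto intro!: arg_cong[where f="emeasure M"])
    qed
    finally show ?thesis .
  qed
  have "emeasure M {w\<in>space M. Z w \<le> Y w} = (\<integral>\<^sup>+w. emeasure M {w'\<in>space M. Z w' \<le> Y w} \<partial>M)"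
    using alt[of "\<lambda>u z. z \<le> fst u"] by simp
  also have "... = (\<integral>\<^sup>+w. ennreal (power_cdf a B (Y w)) \<partial>M)"
    using law by (simp add: emeasure_eq_measure has_law_def)
  finally have e: "emeasure M {w\<in>space M. Z w \<le> Y w} = (\<integral>\<^sup>+w. ennreal (power_cdf a B (Y w)) \<partial>M)" .
  have [measurable]: "power_cdf a B \<in> borel_measurable borel" unfolding power_cdf_def[abs_def] by measurable
  have "(\<integral>w. power_cdf a B (Y w) \<partial>M) = enn2real (\<integral>\<^sup>+w. ennreal (power_cdf a B (Y w)) \<partial>M)"
    by (rule integral_eq_nn_integral) (auto simp: power_cdf_bounds)
  then show "prob {w\<in>space M. Z w \<le> Y w} = (\<integral>w. power_cdf a B (Y w) \<partial>M)"
    unfolding e[symmetric] by (simp add: measure_def)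
  have "emeasure M {w\<in>space M. Z w = Y w \<or> Z w = S w} = (\<integral>\<^sup>+w. emeasure M {w'\<in>space M. Z w' = Y w \<or> Z w' = S w} \<partial>M)"
    using alt[of "\<lambda>u z. z = fst u \<or> z = snd u"] by simp
  also have "... = (\<integral>\<^sup>+w. 0 \<partial>M)"
  proof (rule nn_integral_cong)
    fix w
    have "emeasure M {w'\<in>space M. Z w' = x} = 0" for x
      using power_law_atomless[OF a B law, of x] by (simp add: emeasure_eq_measure)
    then have "emeasure M ({w'\<in>space M. Z w' = Y w} \<union> {w'\<in>space M. Z w' = S w}) = 0"
      by (intro emeasure_Un_null_set[THEN trans] null_setsI) auto
    then show "emeasure M {w'\<in>space M. Z w' = Y w \<or> Z w' = S w} = 0"
      by (simp add: Un_def conj_disj_distribL)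
  qed
  finally have "emeasure M {w\<in>space M. Z w = Y w \<or> Z w = S w} = 0" by simp
  then show "AE w in M. Z w \<noteq> Y w \<and> Z w \<noteq> S w"
    by (intro AE_I[of _ _ "{w\<in>space M. Z w = Y w \<or> Z w = S w}"]) auto
qed

text \<open>This time \<open>Z = z\<close> is frozen, since \<open>S\<close> is controlled only
  through its crossing probability E[Y; Y < z]/z. Integrating against the density of
  \<open>Z\<close> and exchanging the integrals leaves, for each value y below B, y times the
  integral of a z^(a-2) / B^a from y to B, which is a/(1-a) times the difference of (y/B)^a and
  y/B.\<close>

lemma prob_between_indep:
  assumes ind: "\<And>A C. A \<in> sets (borel \<Otimes>\<^sub>M borel) \<Longrightarrow> C \<in> sets borel \<Longrightarrow>
      prob {w\<in>space M. (Y w, S w) \<in> A \<and> Z w \<in> C} = prob {w\<in>space M. (Y w, S w) \<in> A} * prob {w\<in>space M. Z w \<in> C}"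
    and B: "0 < B" and K: "0 < K" and law: "has_law M Z (power_cdf (1 / (1 + K)) B)"
    and [measurable]: "Y \<in> borel_measurable M" "S \<in> borel_measurable M"
    and Y0: "\<And>w. w \<in> space M \<Longrightarrow> 0 \<le> Y w" and intY: "integrable M Y"
    and S: "\<And>m. 0 < m \<Longrightarrow> m * prob {w\<in>space M. Y w < m \<and> m \<le> S w} =
      (\<integral>w. Y w * indicator {w\<in>space M. Y w < m} w \<partial>M)"
  shows "K * prob {w\<in>space M. Y w < Z w \<and> Z w \<le> S w} =
    (\<integral>w. power_cdf (1 / (1 + K)) B (Y w) - min (Y w / B) 1 \<partial>M)"
proof -
  define a where "a = 1 / (1 + K)"
  have a: "0 < a" "a < 1" using K by (auto simp: a_def)
  \<comment> \<open>The reason for the exponent 1/(1+K): the factor a/(1-a) from the integration is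
    1/K and cancels the penalty \<open>K\<close>.\<close>
  have Ka: "K * (a / (1 - a)) = 1" using K by (simp add: a_def field_simps)
  note law = law[folded a_def]
  have Z [measurable]: "Z \<in> borel_measurable M" using law by (simp add: has_law_def)
  let ?U = "\<lambda>w. (Y w, S w)"
  let ?P = "distr M (borel \<Otimes>\<^sub>M borel) ?U" and ?Q = "distr M borel Z"
  interpret P: prob_space ?P by (rule prob_space_distr) simp
  interpret Q: prob_space ?Q by (rule prob_space_distr) simp
  interpret PQ: pair_sigma_finite ?P ?Q ..
  have pd: "?P \<Otimes>\<^sub>M ?Q = distr M ((borel \<Otimes>\<^sub>M borel) \<Otimes>\<^sub>M borel) (\<lambda>w. (?U w, Z w))"
    by (rule pair_law_indep[OF ind]) simp_all
  have sets_PQ: "sets (?P \<Otimes>\<^sub>M ?Q) = sets ((borel \<Otimes>\<^sub>M borel) \<Otimes>\<^sub>M borel)"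
    by (rule sets_pair_measure_cong) simp_all
  have [measurable]: "(\<lambda>w. indicator {Y w<..} z :: real) \<in> borel_measurable M" for z
    unfolding indicator_def greaterThan_iff by measurable
  let ?A = "{x\<in>space ((borel \<Otimes>\<^sub>M borel) \<Otimes>\<^sub>M borel). fst (fst x) < snd x \<and> snd x \<le> snd (fst x)} :: ((real \<times> real) \<times> real) set"
  have m: "?A \<in> sets (?P \<Otimes>\<^sub>M ?Q)"
    unfolding sets_PQ by (rule predE) measurable
  have "emeasure M {w\<in>space M. Y w < Z w \<and> Z w \<le> S w} = emeasure (?P \<Otimes>\<^sub>M ?Q) ?A"
    unfolding pd using m[unfolded sets_PQ]
      by (subst emeasure_distr) (auto simp: space_pair_measure intro!: arg_cong[where f="emeasure M"])
  also have "... = (\<integral>\<^sup>+z. emeasure ?P ((\<lambda>u. (u, z)) -` ?A) \<partial>?Q)"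
    by (rule PQ.emeasure_pair_measure_alt2[OF m])
  also have "... = (\<integral>\<^sup>+z. ennreal (power_density a B z) * emeasure ?P ((\<lambda>u. (u, z)) -` ?A) \<partial>lborel)"
  proof -
    have "(\<lambda>z. emeasure ?P ((\<lambda>u. (u, z)) -` ?A)) \<in> borel_measurable ?Q"
      by (rule PQ.measurable_emeasure_Pair2[OF m])
    then have "(\<lambda>z. emeasure ?P ((\<lambda>u. (u, z)) -` ?A)) \<in> borel_measurable lborel" by simp
    then show ?thesis
      unfolding power_law_distr[OF a(1) B law] by (intro nn_integral_density) auto
  qed
  also have "... = (\<integral>\<^sup>+z. (\<integral>\<^sup>+w. ennreal (power_density a B z * (Y w * indicator {Y w<..} z / z)) \<partial>M) \<partial>lborel)"
  proof (rule nn_integral_cong)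
    fix z :: real
    show "ennreal (power_density a B z) * emeasure ?P ((\<lambda>u. (u, z)) -` ?A) =
        (\<integral>\<^sup>+w. ennreal (power_density a B z * (Y w * indicator {Y w<..} z / z)) \<partial>M)"
    proof (cases "0 < z")
      case False
      then show ?thesis by (simp add: power_density_def)
    next
      case True
      have "emeasure ?P ((\<lambda>u. (u, z)) -` ?A) = emeasure M {w\<in>space M. Y w < z \<and> z \<le> S w}"
        using sets_Pair2[OF m[unfolded sets_PQ], of z]
        by (subst emeasure_distr) (auto simp: space_pair_measure intro!: arg_cong[where f="emeasure M"])
      also have "... = ennreal ((\<integral>w. Y w * indicator {w\<in>space M. Y w < z} w \<partial>M) / z)"
        using S[OF True, symmetric] True by (simp add: emeasure_eq_measure)
      also have "(\<integral>w. Y w * indicator {w\<in>space M. Y w < z} w \<partial>M) = (\<integral>w. Y w * indicator {Y w<..} z \<partial>M)"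
        by (rule Bochner_Integration.integral_cong) (auto simp: indicator_def)
      also have "ennreal ((\<integral>w. Y w * indicator {Y w<..} z \<partial>M) / z) = ennreal (\<integral>w. Y w * indicator {Y w<..} z / z \<partial>M)"
        by simp
      also have "... = (\<integral>\<^sup>+w. ennreal (Y w * indicator {Y w<..} z / z) \<partial>M)"
      proof (rule nn_integral_eq_integral[symmetric])
        show "integrable M (\<lambda>w. Y w * indicator {Y w<..} z / z)"
          by (rule Bochner_Integration.integrable_bound[OF integrable_mult_left[OF intY, of "1 / z"]])
            (use True in \<open>auto simp: indicator_def\<close>)
      qed (use Y0 True in auto)
      finally have "ennreal (power_density a B z) * emeasure ?P ((\<lambda>u. (u, z)) -` ?A) =
          ennreal (power_density a B z) * (\<integral>\<^sup>+w. ennreal (Y w * indicator {Y w<..} z / z) \<partial>M)" by simp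
      also have "... = (\<integral>\<^sup>+w. ennreal (power_density a B z) * ennreal (Y w * indicator {Y w<..} z / z) \<partial>M)"
        by (rule nn_integral_cmult[symmetric]) measurable
      also have "... = (\<integral>\<^sup>+w. ennreal (power_density a B z * (Y w * indicator {Y w<..} z / z)) \<partial>M)"
        using Y0 True a B by (intro nn_integral_cong ennreal_mult[symmetric]) (auto simp: power_density_nonneg)
      finally show ?thesis .
    qed
  qed
  also have "... = (\<integral>\<^sup>+w. (\<integral>\<^sup>+z. ennreal (power_density a B z * (Y w * indicator {Y w<..} z / z)) \<partial>lborel) \<partial>M)"
  proof -
    interpret MB: pair_sigma_finite M lborel ..
    have "(\<lambda>(w, z). ennreal (power_density a B z * (Y w * indicator {Y w<..} z / z))) \<in> borel_measurable (M \<Otimes>\<^sub>M lborel)"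
      by (simp add: indicator_def)
    from MB.Fubini'[OF this] show ?thesis .
  qed
  also have "... = (\<integral>\<^sup>+w. ennreal ((power_cdf a B (Y w) - min (Y w / B) 1) / K) \<partial>M)"
  proof (rule nn_integral_cong)
    fix w assume "w \<in> space M"
    define y where "y = Y w"
    have y: "0 \<le> y" using Y0 \<open>w \<in> space M\<close> by (simp add: y_def)
    have "(\<integral>\<^sup>+z. ennreal (power_density a B z * (y * indicator {y<..} z / z)) \<partial>lborel) =
        ennreal ((power_cdf a B y - min (y / B) 1) / K)"
    proof -
      consider "y = 0" | "0 < y" "y < B" | "B \<le> y" using y by linarith
      then show ?thesis
      proof cases
        case 1
        then show ?thesis using a B by (simp add: power_cdf_def)
      next
        case 3
        have z0: "power_density a B z * (y * indicator {y<..} z / z) = 0" for z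
          using 3 by (auto simp: power_density_def indicator_def)
        have "(\<integral>\<^sup>+z. ennreal (power_density a B z * (y * indicator {y<..} z / z)) \<partial>lborel) = (\<integral>\<^sup>+z. 0 \<partial>(lborel :: real measure))"
          unfolding z0 by simp
        moreover have "power_cdf a B y = 1" "min (y / B) 1 = 1"
          using 3 B a by (auto simp: power_cdf_eq min_def)
        ultimately show ?thesis by simp
      next
        case 2
        define f where "f z = a / B powr a * y * z powr (a - 2)" for z
        \<comment> \<open>An antiderivative of \<open>f\<close>. In this case y > 0 keeps the range
          of integration away from the singularity of z^(a-2) at 0.\<close>
        define F where "F z = a / B powr a * y * (z powr (a - 1) / (a - 1))" for z
        have "(\<integral>\<^sup>+z. ennreal (power_density a B z * (y * indicator {y<..} z / z)) \<partial>lborel) =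
            (\<integral>\<^sup>+z. ennreal (f z) * indicator {y..B} z \<partial>lborel)"
        \<comment> \<open>The two indicators differ only at z = y, a null set.\<close>
        proof (rule nn_integral_cong_AE)
          show "AE z in lborel. ennreal (power_density a B z * (y * indicator {y<..} z / z)) = ennreal (f z) * indicator {y..B} z"
            using AE_lborel_singleton[of y]
          proof eventually_elim
            case (elim z)
            have "z powr (a - 1) / z = z powr (a - 2)" if "0 < z"
              using that powr_diff[of z "a - 1" 1] by simp
            moreover have "power_density a B z * (y * 1 / z) = a / B powr a * y * (z powr (a - 1) / z)" if "y < z" "z \<le> B"
              using that 2 by (simp add: power_density_def)
            ultimately have "power_density a B z * (y * 1 / z) = f z" if "y < z" "z \<le> B"
              using that 2 by (simp only: f_def)
            moreover have "power_density a B z = 0" if "B < z" using that by (simp add: power_density_def)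
            ultimately show ?case using elim 2 by (cases "y < z"; cases "z \<le> B") (auto simp: indicator_def)
          qed
        qed
        also have "... = ennreal (F B - F y)"
        proof (rule nn_integral_FTC_Icc)
          show "f \<in> borel_measurable borel" unfolding f_def[abs_def] by measurable
          fix x assume x: "x \<in> {y..B}"
          then have "0 < x" using 2 by simp
          have "((\<lambda>z. z powr (a - 1)) has_real_derivative (a - 1) * x powr (a - 1 - 1)) (at x)"
            by (rule has_real_derivative_powr[OF \<open>0 < x\<close>])
          then have "(F has_real_derivative a / B powr a * y * ((a - 1) * x powr (a - 1 - 1) / (a - 1))) (at x)"
            unfolding F_def[abs_def] by (intro DERIV_cmult DERIV_cdivide)
          moreover have "(a - 1) * x powr (a - 1 - 1) / (a - 1) = x powr (a - 2)" using a by simp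
          ultimately show "(F has_real_derivative f x) (at x)" by (simp only: f_def)
          show "0 \<le> f x" using a 2 by (simp add: f_def)
        qed (use 2 in simp)
        also have "F B - F y = (power_cdf a B y - min (y / B) 1) / K"
        proof -
          have inv: "a / (1 - a) = 1 / K" using Ka K by (simp add: field_simps)
          have "F B - F y = (a / (1 - a)) * (y * y powr (a - 1) / B powr a - y * B powr (a - 1) / B powr a)"
            using a by (simp add: F_def divide_simps) (simp add: algebra_simps)
          also have "y * y powr (a - 1) = y powr a" using 2 by (simp add: powr_mult_base)
          also have "y * B powr (a - 1) / B powr a = y / B" using B by (simp add: powr_diff)
          also have "y powr a / B powr a = power_cdf a B y"
            using 2 a B by (simp add: power_cdf_eq powr_divide)
          finally show ?thesis using 2 B by (simp add: inv)
        qed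
        finally show ?thesis .
      qed
    qed
    then show "(\<integral>\<^sup>+z. ennreal (power_density a B z * (Y w * indicator {Y w<..} z / z)) \<partial>lborel) =
        ennreal ((power_cdf a B (Y w) - min (Y w / B) 1) / K)" by (simp add: y_def)
  qed
  finally have e: "emeasure M {w\<in>space M. Y w < Z w \<and> Z w \<le> S w} =
      (\<integral>\<^sup>+w. ennreal ((power_cdf a B (Y w) - min (Y w / B) 1) / K) \<partial>M)" .
  have [measurable]: "power_cdf a B \<in> borel_measurable borel" unfolding power_cdf_def[abs_def] by measurable
  \<comment> \<open>On the unit interval a power with exponent below 1 dominates the identity, so
    the integrand is nonnegative and the passage to the Bochner integral is legitimate.\<close>
  have nn: "0 \<le> power_cdf a B y - min (y / B) 1" if "0 \<le> y" for y
  proof -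
    have "0 \<le> min y B / B" "min y B / B \<le> 1" using that B by auto
    then have "(min y B / B) powr 1 \<le> (min y B / B) powr a"
      using a by (intro powr_mono') auto
    moreover have "min (y / B) 1 = min y B / B" using B by (auto simp: min_def field_simps)
    ultimately show ?thesis using that a B by (simp add: power_cdf_eq)
  qed
  have "(\<integral>w. (power_cdf a B (Y w) - min (Y w / B) 1) / K \<partial>M) =
      enn2real (\<integral>\<^sup>+w. ennreal ((power_cdf a B (Y w) - min (Y w / B) 1) / K) \<partial>M)"
    by (rule integral_eq_nn_integral) (use nn Y0 K in auto)
  then have "prob {w\<in>space M. Y w < Z w \<and> Z w \<le> S w} = (\<integral>w. (power_cdf a B (Y w) - min (Y w / B) 1) / K \<partial>M)"
    unfolding e[symmetric] by (simp add: measure_def)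
  then show ?thesis using K by (simp add: a_def)
qed

end

section \<open>The contest\<close>

lemma others_nonempty:
  assumes "2 \<le> (n::nat)"
  shows "{..<n} - {i} \<noteq> {}"
proof -
  have "(if i = 0 then 1 else 0) \<in> {..<n} - {i}" using assms by auto
  then show ?thesis by blast
qed

text \<open>With no tie against the best opponent, a winner wins alone and k = 1. As
  \<open>Z\<close> also differs from \<open>Mi\<close>, the strict comparison with \<open>Mi\<close>
  may be written as \<open>Z \<le> Mi\<close>, the form of the event in
  \<open>prob_supafter_ge\<close>.\<close>

lemma payoff_eq:
  fixes Y :: "nat \<Rightarrow> real"
  assumes n: "2 \<le> n" "i < n" and Z: "Z = Max (Y ` ({..<n} - {i}))" "Z \<noteq> Y i" "Z \<noteq> Mi"
  shows "payoff n K K2 Y Mi i = (if Z \<le> Y i then 1 else 0) - K * (if Y i < Z \<and> Z \<le> Mi then 1 else 0)"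
proof -
  note ne = others_nonempty[OF n(1), of i]
  have "{..<n} = insert i ({..<n} - {i})" using n by auto
  then have "Y ` {..<n} = insert (Y i) (Y ` ({..<n} - {i}))" by blast
  then have mx: "Max (Y ` {..<n}) = max (Y i) Z" using ne Z(1) by simp
  show ?thesis
  proof (cases "Z < Y i")
    case True
    have "Y l < Y i" if "l < n" "l \<noteq> i" for l
    proof -
      have "Y l \<le> Z" unfolding Z(1) using that by (intro Max_ge) auto
      with True show ?thesis by simp
    qed
    then have "{l\<in>{..<n}. Y l = Y i} = {i}" using n by force
    then have "card {l\<in>{..<n}. Y l = Y i} = 1" by simp
    then show ?thesis using True mx Z(1) unfolding payoff_def Let_def by simp
  next
    case False
    with Z(2) have "Y i < Z" by simp
    then show ?thesis using mx Z unfolding payoff_def Let_def by auto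
  qed
qed

lemma payoff_measurable:
  assumes Y [measurable]: "\<And>j. j < n \<Longrightarrow> Y j \<in> borel_measurable M" and [measurable]: "S \<in> borel_measurable M"
    and i: "i < n"
  shows "(\<lambda>w. payoff n K K2 (\<lambda>j. Y j w) (S w) i) \<in> borel_measurable M"
proof -
  have mx [measurable]: "(\<lambda>w. Max ((\<lambda>j. Y j w) ` {..<n})) \<in> borel_measurable M"
    by (rule borel_measurable_Max) auto
  have mo [measurable]: "(\<lambda>w. Max ((\<lambda>j. Y j w) ` ({..<n} - {i}))) \<in> borel_measurable M"
    by (rule borel_measurable_Max) auto
  have Yi [measurable]: "Y i \<in> borel_measurable M" using i by (rule Y)
  \<comment> \<open>Counting the tied players by a sum of indicators makes the size of the tie
    visibly measurable.\<close>
  have card: "real (card {l\<in>{..<n}. Y l w = m}) = (\<Sum>l<n. if Y l w = m then 1 else 0)" for w m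
    by (simp add: sum.If_cases Int_def)
  have [measurable]: "(\<lambda>w. \<Sum>l<n. if Y l w = Max ((\<lambda>j. Y j w) ` {..<n}) then 1 else 0 :: real) \<in> borel_measurable M"
  proof (rule borel_measurable_sum)
    fix l assume "l \<in> {..<n}"
    then have [measurable]: "Y l \<in> borel_measurable M" by (intro Y) simp
    show "(\<lambda>w. if Y l w = Max ((\<lambda>j. Y j w) ` {..<n}) then 1 else 0 :: real) \<in> borel_measurable M" by measurable
  qed
  show ?thesis unfolding payoff_def Let_def card by measurable
qed

text \<open>Independence passes to anything measurable with respect to the sigma-algebras generated
  by the \<open>X i\<close>. It is phrased this way because a stopped value is not given as an
  explicit function on path space.\<close>

lemma (in prob_space) indep_vars_sub_algebra:
  assumes X: "indep_vars N X I"
    and U: "\<And>i. i \<in> I \<Longrightarrow> U i \<in> measurable (vimage_algebra (space M) (X i) (N i)) (N' i)"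
  shows "indep_vars N' U I"
  unfolding indep_vars_def
proof (intro conjI ballI)
  have rv: "\<And>i. i \<in> I \<Longrightarrow> random_variable (N i) (X i)" using X by (auto simp: indep_vars_def)
  show "random_variable (N' i) (U i)" if "i \<in> I" for i
  proof (rule measurable_from_subalg[OF _ U[OF that]])
    show "subalgebra M (vimage_algebra (space M) (X i) (N i))"
      using sets_image_in_sets[OF refl rv[OF that]] by (simp add: subalgebra_def)
  qed
  have "indep_sets (\<lambda>i. sigma_sets (space M) {X i -` A \<inter> space M | A. A \<in> sets (N i)}) I"
    using X by (simp add: indep_vars_def)
  then show "indep_sets (\<lambda>i. sigma_sets (space M) {U i -` A \<inter> space M | A. A \<in> sets (N' i)}) I"
  proof (rule indep_sets_mono_sets)
    fix i assume i: "i \<in> I"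
    have "sigma_sets (space M) {U i -` A \<inter> space M | A. A \<in> sets (N' i)} \<subseteq> sets (vimage_algebra (space M) (X i) (N i))"
      by (rule sets.sigma_sets_subset[of _ "vimage_algebra (space M) (X i) (N i)", unfolded space_vimage_algebra])
        (use measurable_sets[OF U[OF i]] in auto)
    then show "sigma_sets (space M) {U i -` A \<inter> space M | A. A \<in> sets (N' i)} \<subseteq>
        sigma_sets (space M) {X i -` A \<inter> space M | A. A \<in> sets (N i)}"
      by (simp only: sets_vimage_algebra)
  qed
qed

section \<open>Players, the best opponent, and the expected payoff\<close>

locale contest = prob_space M for M :: "'a measure" +
  fixes W :: "nat \<Rightarrow> real \<Rightarrow> 'a \<Rightarrow> real" and n :: nat and x0 K K2 :: real
  assumes n: "2 \<le> n" and x0: "0 < x0" and K: "0 \<le> K"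
    and BM: "\<And>i. i < n \<Longrightarrow> is_BM M x0 (W i)"
    and indep: "indep_vars (\<lambda>_. PiM UNIV (\<lambda>_. borel)) (\<lambda>i w. \<lambda>t. W i t w) {..<n}"
begin

abbreviation X :: "nat \<Rightarrow> real \<Rightarrow> 'a \<Rightarrow> real" where "X i \<equiv> absorbed (W i)"

definition N :: real where "N = real n + K * (real n - 1)"

text \<open>The factorization is where \<open>N\<close> comes from: n - 1 independent copies of a
  law with exponent 1/(N-1) have a maximum with exponent 1/(1+K).\<close>

lemma N_gt_1: "1 < N" and N_minus_1: "N - 1 = (real n - 1) * (1 + K)"
proof -
  show eq: "N - 1 = (real n - 1) * (1 + K)" by (simp add: N_def algebra_simps)
  have "0 < (real n - 1) * (1 + K)" using n K by (intro mult_pos_pos) auto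
  with eq show "1 < N" by simp
qed

lemma brownian: "i < n \<Longrightarrow> brownian M (W i) x0"
  using BM x0 by (intro brownian.intro brownian_axioms.intro) (auto intro: prob_space_axioms)

text \<open>A player's stopped value and later maximum are determined by that player's own path,
  which carries independence of the paths over to these pairs.\<close>

lemma player_variables_measurable:
  assumes j: "j < n" and adm: "admissible M (X j) \<tau>"
  shows "(\<lambda>w. (stopval (X j) \<tau> w, supafter (X j) \<tau> w)) \<in>
    measurable (vimage_algebra (space M) (\<lambda>w t. W j t w) (PiM UNIV (\<lambda>_. borel))) (borel \<Otimes>\<^sub>M borel)"
proof -
  interpret b: brownian M "W j" x0 by (rule brownian[OF j])
  let ?G = "vimage_algebra (space M) (\<lambda>w t. W j t w) (PiM UNIV (\<lambda>_. borel))"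
  have "(\<lambda>w t. W j t w) \<in> measurable ?G (PiM UNIV (\<lambda>_. borel))"
    by (rule measurable_vimage_algebra1) (auto simp: space_PiM)
  then have "(\<lambda>w. W j u w) \<in> borel_measurable ?G" for u
    by (rule measurable_compose) (auto intro: measurable_component_singleton)
  then have W: "W j u \<in> borel_measurable ?G" for u by simp
  have [measurable]: "stopval (X j) \<tau> \<in> borel_measurable ?G" "supafter (X j) \<tau> \<in> borel_measurable ?G"
    by (rule b.stopval_measurable_sub[OF adm] b.supafter_measurable_sub[OF adm]; simp add: W)+
  show ?thesis by measurable
qed

context
  fixes \<tau> :: "nat \<Rightarrow> 'a \<Rightarrow> ereal" and i :: nat
  assumes adm: "\<And>j. j < n \<Longrightarrow> admissible M (X j) (\<tau> j)" and i: "i < n"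
    and law: "\<And>j. j < n \<Longrightarrow> j \<noteq> i \<Longrightarrow> has_law M (stopval (X j) (\<tau> j)) (power_cdf (1 / (N - 1)) (N * x0))"
begin

definition V :: "nat \<Rightarrow> 'a \<Rightarrow> real \<times> real" where
  "V j w = (stopval (X j) (\<tau> j) w, supafter (X j) (\<tau> j) w)"

definition Z :: "'a \<Rightarrow> real" where
  "Z w = Max ((\<lambda>j. stopval (X j) (\<tau> j) w) ` ({..<n} - {i}))"

lemma V_indep: "indep_vars (\<lambda>_. borel \<Otimes>\<^sub>M borel) V {..<n}"
proof (rule indep_vars_sub_algebra[OF indep])
  fix j assume "j \<in> {..<n}"
  then show "V j \<in> measurable (vimage_algebra (space M) (\<lambda>w t. W j t w) (PiM UNIV (\<lambda>_. borel))) (borel \<Otimes>\<^sub>M borel)"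
    unfolding V_def[abs_def] using adm by (intro player_variables_measurable) auto
qed

lemma V_Z_indep:
  assumes A: "A \<in> sets (borel \<Otimes>\<^sub>M borel)" and C: "C \<in> sets borel"
  shows "prob {w\<in>space M. V i w \<in> A \<and> Z w \<in> C} = prob {w\<in>space M. V i w \<in> A} * prob {w\<in>space M. Z w \<in> C}"
proof -
  let ?J = "{..<n} - {i}" and ?B = "borel \<Otimes>\<^sub>M borel :: (real \<times> real) measure"
  have iv: "indep_var (PiM {i} (\<lambda>_. ?B)) (\<lambda>w. restrict (\<lambda>j. V j w) {i}) (PiM ?J (\<lambda>_. ?B)) (\<lambda>w. restrict (\<lambda>j. V j w) ?J)"
    using i by (intro indep_var_restrict[OF V_indep]) auto
  define A' where "A' = (\<lambda>f. f i) -` A \<inter> space (PiM {i} (\<lambda>_. ?B))"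
  define C' where "C' = (\<lambda>f. Max ((\<lambda>j. fst (f j)) ` ?J)) -` C \<inter> space (PiM ?J (\<lambda>_. ?B))"
  have "A' \<in> sets (PiM {i} (\<lambda>_. ?B))"
  proof -
    have "(\<lambda>f. f i) \<in> measurable (PiM {i} (\<lambda>_. ?B)) ?B" by (rule measurable_component_singleton) simp
    from measurable_sets[OF this A] show ?thesis unfolding A'_def .
  qed
  moreover have "C' \<in> sets (PiM ?J (\<lambda>_. ?B))"
    unfolding C'_def
  proof (rule measurable_sets[OF _ C], rule borel_measurable_Max)
    fix j assume "j \<in> ?J"
    then have "(\<lambda>f. f j) \<in> measurable (PiM ?J (\<lambda>_. ?B)) ?B" by (rule measurable_component_singleton)
    then show "(\<lambda>f. fst (f j)) \<in> borel_measurable (PiM ?J (\<lambda>_. ?B))" by (rule measurable_compose[OF _ measurable_fst])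
  qed simp
  ultimately have "prob ((\<lambda>w. (restrict (\<lambda>j. V j w) {i}, restrict (\<lambda>j. V j w) ?J)) -` (A' \<times> C') \<inter> space M) =
      prob ((\<lambda>w. restrict (\<lambda>j. V j w) {i}) -` A' \<inter> space M) * prob ((\<lambda>w. restrict (\<lambda>j. V j w) ?J) -` C' \<inter> space M)"
    by (rule indep_varD[OF iv])
  moreover have "restrict (\<lambda>j. V j w) {i} \<in> A' \<longleftrightarrow> V i w \<in> A" for w
    by (auto simp: A'_def space_PiM space_pair_measure)
  moreover have "restrict (\<lambda>j. V j w) ?J \<in> C' \<longleftrightarrow> Z w \<in> C" for w
  proof -
    have "(\<lambda>j. fst (restrict (\<lambda>j. V j w) ?J j)) ` ?J = (\<lambda>j. stopval (X j) (\<tau> j) w) ` ?J"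
      by (rule image_cong) (auto simp: V_def)
    moreover have "restrict (\<lambda>j. V j w) ?J \<in> space (PiM ?J (\<lambda>_. ?B))" by (simp add: space_PiM space_pair_measure)
    ultimately show ?thesis unfolding C'_def Z_def by simp
  qed
  ultimately show ?thesis by (simp add: vimage_def Int_def conj_ac)
qed

text \<open>By independence the distribution function of the maximum is a product of n - 1 equal
  factors, and (n-1)/(N-1) = 1/(1+K).\<close>

lemma Z_law: "has_law M Z (power_cdf (1 / (1 + K)) (N * x0))"
  unfolding has_law_def
proof (intro conjI allI)
  have m: "stopval (X j) (\<tau> j) \<in> borel_measurable M" if "j < n" for j
    using adm that by (intro brownian.stopval_measurable[OF brownian]) auto
  show "Z \<in> borel_measurable M"
    unfolding Z_def[abs_def] by (rule borel_measurable_Max) (use m in auto)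
  fix x
  let ?J = "{..<n} - {i}"
  have "{w\<in>space M. Z w \<le> x} = (\<Inter>j\<in>?J. V j -` ({..x} \<times> UNIV) \<inter> space M)"
    using others_nonempty[OF n, of i] by (auto simp: Z_def V_def)
  also have "prob ... = (\<Prod>j\<in>?J. prob (V j -` ({..x} \<times> UNIV) \<inter> space M))"
    by (rule indep_varsD_finite[OF indep_vars_subset[OF V_indep]]) (use others_nonempty[OF n, of i] in auto)
  also have "... = (\<Prod>j\<in>?J. power_cdf (1 / (N - 1)) (N * x0) x)"
  proof (rule prod.cong[OF refl])
    fix j assume j: "j \<in> ?J"
    have "V j -` ({..x} \<times> UNIV) \<inter> space M = {w\<in>space M. stopval (X j) (\<tau> j) w \<le> x}" by (auto simp: V_def)
    then show "prob (V j -` ({..x} \<times> UNIV) \<inter> space M) = power_cdf (1 / (N - 1)) (N * x0) x"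
      using law[of j] j by (simp add: has_law_def)
  qed
  also have "... = power_cdf (1 / (N - 1)) (N * x0) x ^ (n - 1)" using i by simp
  also have "... = power_cdf (1 / (1 + K)) (N * x0) x"
  proof (cases "x < 0")
    case True
    then show ?thesis using n by (simp add: power_cdf_def)
  next
    case False
    have B: "0 < N * x0" using N_gt_1 x0 by simp
    have "((min x (N * x0) / (N * x0)) powr (1 / (N - 1))) ^ (n - 1) = (min x (N * x0) / (N * x0)) powr (1 / (1 + K))"
    \<comment> \<open>At 0 the rule combining the powers, which needs a positive base, does not
      apply; both sides are 0.\<close>
    proof (cases "x = 0")
      case True
      then show ?thesis using n B by simp
    next
      case x: False
      have "0 < min x (N * x0) / (N * x0)" using B x False by simp
      then have "((min x (N * x0) / (N * x0)) powr (1 / (N - 1))) ^ (n - 1) =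
          (min x (N * x0) / (N * x0)) powr (1 / (N - 1) * real (n - 1))"
        by (subst powr_powr[symmetric], subst powr_realpow) auto
      also have "1 / (N - 1) * real (n - 1) = 1 / (1 + K)"
        unfolding N_minus_1 using n K by (simp add: of_nat_diff)
      finally show ?thesis .
    qed
    then show ?thesis using False N_gt_1 B K by (simp add: power_cdf_eq)
  qed
  finally show "prob {w\<in>space M. Z w \<le> x} = power_cdf (1 / (1 + K)) (N * x0) x" .
qed

text \<open>Laws are prescribed only for the opponents, so the formula covers deviations of player i
  as well as equilibrium play. The chance of winning is the expectation of the distribution function
  of \<open>Z\<close> at the stopped value, and the regret term removes all of it except the capped
  linear part.\<close>

lemma expected_payoff_eq:
  "expected_payoff M n K K2 X \<tau> i = (\<integral>w. min (stopval (X i) (\<tau> i) w / (N * x0)) 1 \<partial>M)"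
proof -
  interpret b: brownian M "W i" x0 by (rule brownian[OF i])
  let ?Y = "stopval (X i) (\<tau> i)" and ?S = "supafter (X i) (\<tau> i)" and ?B = "N * x0" and ?a = "1 / (1 + K)"
  have ai: "admissible M (X i) (\<tau> i)" using adm i by simp
  have a: "0 < ?a" and B: "0 < ?B" using K N_gt_1 x0 by auto
  have Y [measurable]: "?Y \<in> borel_measurable M" by (rule b.stopval_measurable[OF ai])
  have S [measurable]: "?S \<in> borel_measurable M" by (rule b.supafter_measurable_sub[OF ai]) auto
  have Z [measurable]: "Z \<in> borel_measurable M" using Z_law by (simp add: has_law_def)
  have ind: "prob {w\<in>space M. (?Y w, ?S w) \<in> A \<and> Z w \<in> C} = prob {w\<in>space M. (?Y w, ?S w) \<in> A} * prob {w\<in>space M. Z w \<in> C}"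
    if "A \<in> sets (borel \<Otimes>\<^sub>M borel)" "C \<in> sets borel" for A C
    using V_Z_indep[OF that] by (simp add: V_def)
  have le: "prob {w\<in>space M. Z w \<le> ?Y w} = (\<integral>w. power_cdf ?a ?B (?Y w) \<partial>M)"
    by (rule prob_le_indep(1)[OF ind a B Z_law Y S])
  have ties: "AE w in M. Z w \<noteq> ?Y w \<and> Z w \<noteq> ?S w"
    by (rule prob_le_indep(2)[OF ind a B Z_law Y S])
  have Y0: "0 \<le> ?Y w" if "w \<in> space M" for w by (rule b.stopval_nonneg[OF ai that])
  have meas: "(\<lambda>w. payoff n K K2 (\<lambda>j. stopval (X j) (\<tau> j) w) (?S w) i) \<in> borel_measurable M"
  proof (rule payoff_measurable[OF _ S i])
    show "stopval (X j) (\<tau> j) \<in> borel_measurable M" if "j < n" for j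
      using adm that by (intro brownian.stopval_measurable[OF brownian]) auto
  qed
  let ?P = "{w\<in>space M. Z w \<le> ?Y w}" and ?R = "{w\<in>space M. ?Y w < Z w \<and> Z w \<le> ?S w}"
  have "expected_payoff M n K K2 X \<tau> i = (\<integral>w. indicator ?P w - K * indicator ?R w \<partial>M)"
    unfolding expected_payoff_def
  proof (rule integral_cong_AE[OF meas])
    show "AE w in M. payoff n K K2 (\<lambda>j. stopval (X j) (\<tau> j) w) (?S w) i = indicator ?P w - K * indicator ?R w"
      using ties AE_space
    proof eventually_elim
      case (elim w)
      then show ?case
        by (subst payoff_eq[OF n i, of "Z w"]) (auto simp: Z_def indicator_def)
    qed
  qed measurable
  also have "... = prob ?P - K * prob ?R"
    by (subst Bochner_Integration.integral_diff) (auto intro!: integrable_real_indicator simp: less_top[symmetric])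
  also have "... = (\<integral>w. min (?Y w / ?B) 1 \<partial>M)"
  proof -
    have [measurable]: "power_cdf ?a ?B \<in> borel_measurable borel" unfolding power_cdf_def[abs_def] by measurable
    have i1: "integrable M (\<lambda>w. power_cdf ?a ?B (?Y w))"
      by (rule integrable_const_bound[where B=1]) (auto simp: power_cdf_bounds)
    have i2: "integrable M (\<lambda>w. min (?Y w / ?B) 1)"
      by (rule integrable_const_bound[where B=1]) (use Y0 B in auto)
    show ?thesis
    \<comment> \<open>Without a penalty for regret the exponent is 1, and the distribution function
      of \<open>Z\<close> is already the capped linear function.\<close>
    proof (cases "K = 0")
      case True
      have "(\<integral>w. power_cdf ?a ?B (?Y w) \<partial>M) = (\<integral>w. min (?Y w / ?B) 1 \<partial>M)"
        using True Y0 B by (intro Bochner_Integration.integral_cong) (auto simp: power_cdf_def not_less[symmetric])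
      then show ?thesis using le True by simp
    next
      case False
      with K have K: "0 < K" by simp
      have "K * prob ?R = (\<integral>w. power_cdf ?a ?B (?Y w) - min (?Y w / ?B) 1 \<partial>M)"
        by (rule prob_between_indep[OF ind B K Z_law Y S Y0 b.stopval_expectation_le(1)[OF ai] b.prob_supafter_ge[OF ai]])
      then show ?thesis using le i1 i2 by simp
    qed
  qed
  finally show ?thesis .
qed

end

lemma expected_payoff_le:
  assumes "\<And>j. j < n \<Longrightarrow> admissible M (X j) (\<tau> j)" "i < n"
    "\<And>j. j < n \<Longrightarrow> j \<noteq> i \<Longrightarrow> has_law M (stopval (X j) (\<tau> j)) (power_cdf (1 / (N - 1)) (N * x0))"
  shows "expected_payoff M n K K2 X \<tau> i \<le> 1 / N"
proof -
  interpret b: brownian M "W i" x0 by (rule brownian[OF assms(2)])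
  let ?Y = "stopval (X i) (\<tau> i)"
  have ai: "admissible M (X i) (\<tau> i)" using assms by simp
  have B: "0 < N * x0" using N_gt_1 x0 by simp
  note [measurable] = b.stopval_measurable[OF ai]
  have "expected_payoff M n K K2 X \<tau> i = (\<integral>w. min (?Y w / (N * x0)) 1 \<partial>M)"
    using assms by (rule expected_payoff_eq)
  also have "... \<le> (\<integral>w. ?Y w / (N * x0) \<partial>M)"
  proof (rule integral_mono)
    show "integrable M (\<lambda>w. min (?Y w / (N * x0)) 1)"
      by (rule integrable_const_bound[where B=1]) (use b.stopval_nonneg[OF ai] B in auto)
  qed (use b.stopval_expectation_le(1)[OF ai] in auto)
  also have "... \<le> x0 / (N * x0)"
    using divide_right_mono[OF b.stopval_expectation_le(2)[OF ai], of "N * x0"] B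
    by (simp only: Bochner_Integration.integral_divide_zero less_imp_le)
  finally show ?thesis using x0 by simp
qed

lemma expected_payoff_equilibrium:
  assumes "\<And>j. j < n \<Longrightarrow> admissible M (X j) (\<tau> j)" "i < n"
    and law: "\<And>j. j < n \<Longrightarrow> has_law M (stopval (X j) (\<tau> j)) (power_cdf (1 / (N - 1)) (N * x0))"
  shows "expected_payoff M n K K2 X \<tau> i = 1 / N"
proof -
  have "expected_payoff M n K K2 X \<tau> i = (\<integral>w. min (stopval (X i) (\<tau> i) w / (N * x0)) 1 \<partial>M)"
    using assms by (intro expected_payoff_eq) auto
  also have "... = 1 / (N - 1) / (1 / (N - 1) + 1)"
    using N_gt_1 x0 by (intro power_law_expectation[OF _ _ law[OF assms(2)]]) auto
  also have "... = 1 / N" using N_gt_1 by (simp add: field_simps)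
  finally show ?thesis .
qed

lemma equilibrium_exists:
  assumes "i < n"
  shows "admissible M (X i) (brownian.rise_time (W i) N)"
    "has_law M (stopval (X i) (brownian.rise_time (W i) N)) (power_cdf (1 / (N - 1)) (N * x0))"
proof -
  interpret b: brownian M "W i" x0 by (rule brownian[OF assms])
  show "admissible M (X i) (b.rise_time N)" by (rule b.rise_time_admissible[OF N_gt_1])
  show "has_law M (stopval (X i) (b.rise_time N)) (power_cdf (1 / (N - 1)) (N * x0))"
    using b.rise_value_law[OF N_gt_1] unfolding power_cdf_def[abs_def] .
qed

end

theorem theorem3:
  fixes M :: "'a measure" and W :: "nat \<Rightarrow> real \<Rightarrow> 'a \<Rightarrow> real"
    and n :: nat and x0 K K2 :: real
  assumes "prob_space M" and "n \<ge> 2" and "x0 > 0" and "K \<ge> 0" and "0 \<le> K2" and "K2 \<le> K"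
    and "\<forall>i<n. is_BM M x0 (W i)"
    and "prob_space.indep_vars M (\<lambda>_. PiM UNIV (\<lambda>_. borel)) (\<lambda>i \<omega>. \<lambda>t. W i t \<omega>) {..<n}"
  defines "X \<equiv> \<lambda>i. absorbed (W i)"
    and "F \<equiv> \<lambda>x::real. if x < 0 then 0 else min ((x / ((real n + K * (real n - 1)) * x0)) powr (1 / (real n + K * (real n - 1) - 1))) 1"
  shows "(\<exists>\<tau>. \<forall>i<n. admissible M (X i) (\<tau> i) \<and> has_law M (stopval (X i) (\<tau> i)) F \<and>
                 (\<forall>x. measure M {\<omega>\<in>space M. stopval (X i) (\<tau> i) \<omega> = x} = 0))
       \<and> (\<forall>\<tau>. (\<forall>j<n. admissible M (X j) (\<tau> j) \<and> has_law M (stopval (X j) (\<tau> j)) F) \<longrightarrow>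
            (\<forall>i<n. \<forall>\<sigma>. admissible M (X i) \<sigma> \<longrightarrow>
               expected_payoff M n K K2 X (\<tau>(i := \<sigma>)) i \<le> expected_payoff M n K K2 X \<tau> i))"
proof -
  interpret c: contest M W n x0 K K2
    using assms by (intro contest.intro contest_axioms.intro) auto
  have F: "F = power_cdf (1 / (c.N - 1)) (c.N * x0)"
    by (simp add: F_def power_cdf_def[abs_def] c.N_def)
  have a: "0 < 1 / (c.N - 1)" "0 < c.N * x0" using c.N_gt_1 c.x0 by auto
  show ?thesis
  proof (intro conjI allI impI)
    show "\<exists>\<tau>. \<forall>i<n. admissible M (X i) (\<tau> i) \<and> has_law M (stopval (X i) (\<tau> i)) F \<and>
        (\<forall>x. measure M {w\<in>space M. stopval (X i) (\<tau> i) w = x} = 0)"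
    proof (intro exI[of _ "\<lambda>i. brownian.rise_time (W i) c.N"] allI impI conjI)
      fix i x assume i: "i < n"
      show "admissible M (X i) (brownian.rise_time (W i) c.N)"
        unfolding X_def by (rule c.equilibrium_exists(1)[OF i])
      show "has_law M (stopval (X i) (brownian.rise_time (W i) c.N)) F"
        unfolding X_def F by (rule c.equilibrium_exists(2)[OF i])
      show "measure M {w\<in>space M. stopval (X i) (brownian.rise_time (W i) c.N) w = x} = 0"
        unfolding X_def by (rule c.power_law_atomless[OF a c.equilibrium_exists(2)[OF i]])
    qed
  next
    fix \<tau> i \<sigma>
    assume \<tau>: "\<forall>j<n. admissible M (X j) (\<tau> j) \<and> has_law M (stopval (X j) (\<tau> j)) F"
      and i: "i < n" and \<sigma>: "admissible M (X i) \<sigma>"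
    have "expected_payoff M n K K2 X (\<tau>(i := \<sigma>)) i \<le> 1 / c.N"
      unfolding X_def
    proof (rule c.expected_payoff_le[OF _ i])
      fix j assume j: "j < n"
      show "admissible M (absorbed (W j)) ((\<tau>(i := \<sigma>)) j)"
        using \<tau> \<sigma> j by (cases "j = i") (auto simp: X_def)
      assume "j \<noteq> i"
      then show "has_law M (stopval (absorbed (W j)) ((\<tau>(i := \<sigma>)) j)) (power_cdf (1 / (c.N - 1)) (c.N * x0))"
        using \<tau> j by (simp add: X_def F)
    qed
    \<comment> \<open>The bound on a deviation uses the opponents' laws only; it is attained because
      player i's own value has law \<open>F\<close> too.\<close>
    also have "1 / c.N = expected_payoff M n K K2 X \<tau> i"
      unfolding X_def
      by (rule c.expected_payoff_equilibrium[symmetric]) (use \<tau> i in \<open>simp_all add: X_def F\<close>)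
    finally show "expected_payoff M n K K2 X (\<tau>(i := \<sigma>)) i \<le> expected_payoff M n K K2 X \<tau> i" .
  qed
qed

end
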